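(* Let $\frac{1}{16}<\omega<\frac14$. Then the positive solution $\chi$ of the minimization problem $$S_\omega^{\min}=\min\{S_\omega(\chi):\chi\in H^1(\mathbb{R}^3)\}$$ is unique; that is, if $\chi_1,\chi_2\in H^1(\mathbb{R}^3)$ are positive functions with $S_\omega(\chi_1)=S_\omega(\chi_2)=S_\omega^{\min}$, then $\chi_1=\chi_2$.
   Context: For $\chi\in H^1(\mathbb{R}^3)$ and $\omega>0$, the action functional is $$S_\omega(\chi)=\frac12\|\nabla\chi\|_{L^2}^2+\frac14 A(|\chi|^2)-\frac12\int_{\mathbb{R}^3}\frac{|\chi(x)|^2}{|x|}\,dx+\frac{\omega}{2}\|\chi\|_{L^2}^2,$$ where $$A(f)=\int_{\mathbb{R}^3}\int_{\mathbb{R}^3}\frac{f(x)f(y)}{|x-y|}\,dy\,dx.$$ *)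

theory Defs
  imports "HOL-Analysis.Analysis"
begin

definition partial_deriv :: "3 \<Rightarrow> (real^3 \<Rightarrow> real) \<Rightarrow> real^3 \<Rightarrow> real"
  where "partial_deriv i f x = frechet_derivative f (at x) (axis i 1)"

primrec cont_diff :: "nat \<Rightarrow> (real^3 \<Rightarrow> real) \<Rightarrow> bool" where
  "cont_diff 0 f \<longleftrightarrow> continuous_on UNIV f"
| "cont_diff (Suc k) f \<longleftrightarrow>
     (\<forall>x. f differentiable (at x)) \<and> (\<forall>i. cont_diff k (partial_deriv i f))"

definition test_function :: "(real^3 \<Rightarrow> real) \<Rightarrow> bool"
  where "test_function \<phi> \<longleftrightarrow> (\<forall>k. cont_diff k \<phi>) \<and> compact (closure {x. \<phi> x \<noteq> 0})"

definition locally_integrable :: "(real^3 \<Rightarrow> 'b::euclidean_space) \<Rightarrow> bool"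
  where "locally_integrable f \<longleftrightarrow> (\<forall>K. compact K \<longrightarrow> set_integrable lborel K f)"

text \<open>Elements of the Lebesgue and Sobolev spaces are represented by Borel measurable functions;
  two representatives are identified when they agree almost everywhere.\<close>

definition L2 :: "(real^3 \<Rightarrow> 'b::euclidean_space) set"
  where "L2 = {f \<in> borel_measurable lborel. integrable lborel (\<lambda>x. (norm (f x))\<^sup>2)}"

text \<open>Testing against real-valued functions suffices for complex-valued \<^term>\<open>f\<close>,
  since the identity extends complex-linearly.\<close>

definition has_weak_gradient :: "(real^3 \<Rightarrow> complex) \<Rightarrow> (real^3 \<Rightarrow> complex^3) \<Rightarrow> bool"
  where "has_weak_gradient f G \<longleftrightarrow> locally_integrable f \<and> locally_integrable G \<and>
    (\<forall>\<phi> i. test_function \<phi> \<longrightarrow>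
      (\<integral>x. partial_deriv i \<phi> x *\<^sub>R f x \<partial>lborel) = - (\<integral>x. \<phi> x *\<^sub>R (G x $ i) \<partial>lborel))"

definition H1 :: "(real^3 \<Rightarrow> complex) set"
  where "H1 = {f \<in> L2. \<exists>G \<in> L2. has_weak_gradient f G}"

text \<open>A weak gradient is unique up to null sets, so the choice does not affect any integral.\<close>

definition weak_gradient :: "(real^3 \<Rightarrow> complex) \<Rightarrow> real^3 \<Rightarrow> complex^3"
  where "weak_gradient f = (SOME G. has_weak_gradient f G)"

definition L2_norm :: "(real^3 \<Rightarrow> 'b::euclidean_space) \<Rightarrow> real"
  where "L2_norm f = sqrt (\<integral>x. (norm (f x))\<^sup>2 \<partial>lborel)"

definition coulomb :: "(real^3 \<Rightarrow> real) \<Rightarrow> real"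
  where "coulomb f = (\<integral>x. (\<integral>y. f x * f y / norm (x - y) \<partial>lborel) \<partial>lborel)"

text \<open>For \<^term>\<open>u \<in> H1\<close> every integral below converges absolutely, so the convention that
  a Bochner integral of a non-integrable function is zero never takes effect.\<close>

definition action :: "real \<Rightarrow> (real^3 \<Rightarrow> complex) \<Rightarrow> real"
  where "action \<omega> u =
      1/2 * (L2_norm (weak_gradient u))\<^sup>2
    + 1/4 * coulomb (\<lambda>x. (norm (u x))\<^sup>2)
    - 1/2 * (\<integral>x. (norm (u x))\<^sup>2 / norm x \<partial>lborel)
    + \<omega>/2 * (L2_norm u)\<^sup>2"

definition positive_ae :: "(real^3 \<Rightarrow> complex) \<Rightarrow> bool"
  where "positive_ae u \<longleftrightarrow> (AE x in lborel. Im (u x) = 0 \<and> Re (u x) > 0)"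

end

theory Submission
  imports Defs "HOL-Probability.Distributions"
begin

text \<open>
  The functional is convex in the density \<open>|\<chi>|\<^sup>2\<close>, and strictly so because of the electrostatic
  repulsion. Let \<open>w\<^sub>1, w\<^sub>2\<close> be two positive minimizers and compare them with their quadratic mean
  \<open>v = sqrt ((w\<^sub>1\<^sup>2 + w\<^sub>2\<^sup>2) / 2)\<close>, whose density is the average of the two densities. Mass and
  nuclear attraction are linear in the density, so they take the average value at \<open>v\<close>. The kinetic
  energy takes at most the average value: \<open>\<nabla>v = (w\<^sub>1 \<nabla>w\<^sub>1 + w\<^sub>2 \<nabla>w\<^sub>2) / (2 v)\<close>, and the
  Cauchy-Schwarz inequality bounds \<open>|\<nabla>v|\<^sup>2\<close> by the mean of the \<open>|\<nabla>w\<^sub>j|\<^sup>2\<close>. The repulsion \<open>A\<close> is a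
  quadratic form, so its value at the average is the average of its values minus
  \<open>A (w\<^sub>1\<^sup>2 - w\<^sub>2\<^sup>2) / 4\<close>. Altogether the action of \<open>v\<close> is at most the minimum minus
  \<open>A (w\<^sub>1\<^sup>2 - w\<^sub>2\<^sup>2) / 16\<close> (\<open>action_quadratic_mean_le\<close>), and minimality forces
  \<open>A (w\<^sub>1\<^sup>2 - w\<^sub>2\<^sup>2) \<le> 0\<close>. The Coulomb kernel is positive definite (\<open>coulomb_positive_definite\<close>), hence
  \<open>w\<^sub>1\<^sup>2 = w\<^sub>2\<^sup>2\<close>, and positivity gives \<open>w\<^sub>1 = w\<^sub>2\<close>.

  Three analytic facts carry this argument.

  The formula for \<open>\<nabla>v\<close> is a chain rule for weak derivatives (\<open>quadratic_mean_weak_partial\<close>). It is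
  obtained from difference quotients rather than by mollification: a function in \<open>L\<^sup>2\<close> has a weak
  derivative \<open>g\<close> in \<open>L\<^sup>2\<close> only if each of its difference quotients is the mean of \<open>g\<close> over a segment
  (\<open>weak_partial_difference\<close>), and these means converge to \<open>g\<close> in \<open>L\<^sup>1\<close> on compact sets.

  The splitting of the integrals needs their absolute convergence, which is Hardy's inequality
  (\<open>hardy_bound\<close>). It comes from testing \<open>w\<^sup>2\<close> against a smoothed version of the field \<open>x / |x|\<close>, whose
  divergence is \<open>2 / |x|\<close>.

  Positive definiteness comes from writing \<open>1 / |x - y|\<close> as a superposition of products of two
  Gaussians, one centred at \<open>x\<close> and one at \<open>y\<close>. Then \<open>A f\<close> is the integral of the squares of all
  Gaussian averages of \<open>f\<close>, and these averages determine \<open>f\<close>.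
\<close>

section \<open>Translations of integrable functions\<close>

lemma integrable_lborel_translate:
  fixes f :: "'a::euclidean_space \<Rightarrow> 'b::{banach, second_countable_topology}"
  assumes "integrable lborel f"
  shows "integrable lborel (\<lambda>x. f (x + a))"
proof -
  have "integrable (distr lborel borel ((+) a)) f"
    using assms by (simp add: lborel_distr_plus)
  then have "integrable lborel (\<lambda>x. f (a + x))"
    by (rule integrable_distr[rotated]) simp
  then show ?thesis by (simp add: add.commute)
qed

lemma integral_lborel_translate:
  fixes f :: "'a::euclidean_space \<Rightarrow> 'b::{banach, second_countable_topology}"
  assumes [measurable]: "f \<in> borel_measurable borel"
  shows "(LBINT x. f (x + a)) = integral\<^sup>L lborel f"
proof -
  have "integral\<^sup>L lborel f = integral\<^sup>L (distr lborel borel ((+) a)) f"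
    by (simp add: lborel_distr_plus)
  also have "\<dots> = (LBINT x. f (a + x))"
    by (rule integral_distr) simp_all
  finally show ?thesis by (simp add: add.commute)
qed

lemma nn_integral_lborel_translate:
  fixes f :: "'a::euclidean_space \<Rightarrow> ennreal"
  assumes [measurable]: "f \<in> borel_measurable borel"
  shows "(\<integral>\<^sup>+x. f (x + a) \<partial>lborel) = integral\<^sup>N lborel f"
proof -
  have "integral\<^sup>N lborel f = integral\<^sup>N (distr lborel borel ((+) a)) f"
    by (simp add: lborel_distr_plus)
  also have "\<dots> = (\<integral>\<^sup>+x. f (a + x) \<partial>lborel)"
    by (rule nn_integral_distr) simp_all
  finally show ?thesis by (simp add: add.commute)
qed

text \<open>Sequences \<open>h\<close> instead of a limit at \<open>0\<close> make the dominated convergence theorem applicable.\<close>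

definition L1_continuous_translation :: "('a::euclidean_space \<Rightarrow> real) \<Rightarrow> bool" where
  "L1_continuous_translation f \<longleftrightarrow>
    (\<forall>h. h \<longlonglongrightarrow> 0 \<longrightarrow> (\<lambda>n. LBINT x. \<bar>f (x + h n) - f x\<bar>) \<longlonglongrightarrow> 0)"

lemma L1_continuous_translation_approx:
  fixes f :: "'a::euclidean_space \<Rightarrow> real"
  assumes f: "integrable lborel f"
    and approx: "\<And>e. e > 0 \<Longrightarrow> \<exists>g. integrable lborel g \<and> L1_continuous_translation g \<and>
      (LBINT x. \<bar>f x - g x\<bar>) < e"
  shows "L1_continuous_translation f"
  unfolding L1_continuous_translation_def
proof (intro allI impI)
  fix h :: "nat \<Rightarrow> 'a" assume h: "h \<longlonglongrightarrow> 0"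
  show "(\<lambda>n. LBINT x. \<bar>f (x + h n) - f x\<bar>) \<longlonglongrightarrow> 0"
  proof (rule LIMSEQ_I)
    fix e :: real assume "e > 0"
    then obtain g where g: "integrable lborel g" "L1_continuous_translation g"
      "(LBINT x. \<bar>f x - g x\<bar>) < e / 3"
      using approx[of "e / 3"] by auto
    from g(2) h have "(\<lambda>n. LBINT x. \<bar>g (x + h n) - g x\<bar>) \<longlonglongrightarrow> 0"
      by (auto simp: L1_continuous_translation_def)
    from LIMSEQ_D[OF this, of "e / 3"] \<open>e > 0\<close> obtain N where
      N: "\<And>n. n \<ge> N \<Longrightarrow> \<bar>LBINT x. \<bar>g (x + h n) - g x\<bar>\<bar> < e / 3" by auto
    have "norm ((LBINT x. \<bar>f (x + h n) - f x\<bar>) - 0) < e" if "n \<ge> N" for n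
    proof -
      note tr = integrable_lborel_translate[of _ "h n"]
      have fg: "integrable lborel (\<lambda>x. \<bar>f x - g x\<bar>)"
        using f g by (intro integrable_abs Bochner_Integration.integrable_diff)
      note fgt = tr[OF fg]
      have gg: "integrable lborel (\<lambda>x. \<bar>g (x + h n) - g x\<bar>)"
        using g tr[OF g(1)] by (intro integrable_abs Bochner_Integration.integrable_diff)
      have ff: "integrable lborel (\<lambda>x. \<bar>f (x + h n) - f x\<bar>)"
        using f tr[OF f] by (intro integrable_abs Bochner_Integration.integrable_diff)
      have "(LBINT x. \<bar>f (x + h n) - f x\<bar>)
        \<le> (LBINT x. \<bar>f (x + h n) - g (x + h n)\<bar> + \<bar>g (x + h n) - g x\<bar> + \<bar>f x - g x\<bar>)"
        using ff fg fgt gg by (intro integral_mono) auto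
      also have "\<dots> = (LBINT x. \<bar>f (x + h n) - g (x + h n)\<bar>) + (LBINT x. \<bar>g (x + h n) - g x\<bar>)
          + (LBINT x. \<bar>f x - g x\<bar>)"
        using fg fgt gg by simp
      also have "(LBINT x. \<bar>f (x + h n) - g (x + h n)\<bar>) = (LBINT x. \<bar>f x - g x\<bar>)"
        using fg by (intro integral_lborel_translate[of "\<lambda>x. \<bar>f x - g x\<bar>"]) auto
      finally show ?thesis using g(3) N[OF that] by simp
    qed
    then show "\<exists>N. \<forall>n\<ge>N. norm ((LBINT x. \<bar>f (x + h n) - f x\<bar>) - 0) < e" by blast
  qed
qed

text \<open>
  Since both sets have the same measure, the symmetric difference of \<open>U\<close> and a translate of \<open>U\<close> has
  twice the measure of the points of \<open>U\<close> which the translation moves out of \<open>U\<close>. As \<open>U\<close> is open,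
  each point eventually stays in \<open>U\<close>, and dominated convergence applies.
\<close>

lemma L1_continuous_translation_open:
  fixes U :: "'a::euclidean_space set"
  assumes U: "open U" "emeasure lborel U < \<infinity>"
  shows "L1_continuous_translation (indicator U)"
  unfolding L1_continuous_translation_def
proof (intro allI impI)
  fix h :: "nat \<Rightarrow> 'a" assume h: "h \<longlonglongrightarrow> 0"
  let ?I = "indicator U :: 'a \<Rightarrow> real"
  have Um[measurable]: "U \<in> sets borel" using U by simp
  have I: "integrable lborel ?I" using U by (simp add: integrable_indicator_iff)
  have It: "integrable lborel (\<lambda>x. ?I (x + h n))" for n
    using integrable_lborel_translate[OF I] .
  have IIb: "integrable lborel (\<lambda>x. ?I x * (1 - ?I (x + h n)))" for n
    by (rule Bochner_Integration.integrable_bound[OF I]) (auto split: split_indicator)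
  have "(\<lambda>n. LBINT x. 2 * (?I x * (1 - ?I (x + h n)))) \<longlonglongrightarrow> (\<integral>x. 0 \<partial>(lborel :: 'a measure))"
  proof (rule integral_dominated_convergence[where w="\<lambda>x. 2 * ?I x"])
    show "AE x in lborel. (\<lambda>n. 2 * (?I x * (1 - ?I (x + h n)))) \<longlonglongrightarrow> 0"
    proof (rule AE_I2)
      fix x
      show "(\<lambda>n. 2 * (?I x * (1 - ?I (x + h n)))) \<longlonglongrightarrow> 0"
      proof (cases "x \<in> U")
        case True
        have "(\<lambda>n. x + h n) \<longlonglongrightarrow> x + 0" by (intro tendsto_intros h)
        then have "eventually (\<lambda>n. x + h n \<in> U) sequentially"
          using topological_tendstoD[of "\<lambda>n. x + h n" x sequentially U] U True by simp
        then have "eventually (\<lambda>n. 2 * (?I x * (1 - ?I (x + h n))) = 0) sequentially"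
          by eventually_elim simp
        then show ?thesis by (rule tendsto_eventually)
      qed simp
    qed
  qed (use I in \<open>auto split: split_indicator\<close>)
  moreover have "(LBINT x. \<bar>?I (x + h n) - ?I x\<bar>) = (LBINT x. 2 * (?I x * (1 - ?I (x + h n))))" for n
  proof -
    have "(LBINT x. \<bar>?I (x + h n) - ?I x\<bar>)
      = (LBINT x. (?I (x + h n) - ?I x) + 2 * (?I x * (1 - ?I (x + h n))))"
      by (rule Bochner_Integration.integral_cong) (auto split: split_indicator)
    also have "\<dots> = (LBINT x. ?I (x + h n)) - (LBINT x. ?I x) + (LBINT x. 2 * (?I x * (1 - ?I (x + h n))))"
      using I It[of n] IIb[of n]
      by (subst Bochner_Integration.integral_add) (auto simp del: integral_indicator)
    also have "(LBINT x. ?I (x + h n)) = (LBINT x. ?I x)"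
      by (rule integral_lborel_translate) simp
    finally show ?thesis by simp
  qed
  ultimately show "(\<lambda>n. LBINT x. \<bar>?I (x + h n) - ?I x\<bar>) \<longlonglongrightarrow> 0" by simp
qed

lemma L1_continuous_translation_cmult:
  "L1_continuous_translation f \<Longrightarrow> L1_continuous_translation (\<lambda>x. c * f x)"
  unfolding L1_continuous_translation_def
proof (intro allI impI)
  fix h :: "nat \<Rightarrow> 'a"
  assume f: "\<forall>h. h \<longlonglongrightarrow> 0 \<longrightarrow> (\<lambda>n. LBINT x. \<bar>f (x + h n) - f x\<bar>) \<longlonglongrightarrow> 0" and "h \<longlonglongrightarrow> 0"
  then have "(\<lambda>n. LBINT x. \<bar>f (x + h n) - f x\<bar>) \<longlonglongrightarrow> 0" by blast
  from tendsto_mult_left[OF this, of "\<bar>c\<bar>"]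
  show "(\<lambda>n. LBINT x. \<bar>c * f (x + h n) - c * f x\<bar>) \<longlonglongrightarrow> 0"
    by (simp add: right_diff_distrib[symmetric] abs_mult)
qed

text \<open>
  The property passes to \<open>L\<^sup>1\<close> limits, so outer regularity reduces sets of finite measure to open
  sets, and integrable functions are \<open>L\<^sup>1\<close> limits of simple ones.
\<close>

theorem L1_continuous_translation:
  fixes f :: "'a::euclidean_space \<Rightarrow> real"
  assumes "integrable lborel f"
  shows "L1_continuous_translation f"
  using assms
proof (induction rule: integrable_induct)
  case (base A c)
  then have A[measurable]: "A \<in> sets borel" and fin: "emeasure lborel A < \<infinity>" by auto
  have "L1_continuous_translation (indicator A :: 'a \<Rightarrow> real)"
  proof (rule L1_continuous_translation_approx)
    show "integrable lborel (indicator A :: 'a \<Rightarrow> real)"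
      using fin by (simp add: integrable_indicator_iff)
    fix e :: real assume "e > 0"
    obtain U where U: "open U" "A \<subseteq> U" "emeasure lborel (U - A) < ennreal e"
      using outer_regular_lborel[OF A \<open>e > 0\<close>] by blast
    have Um[measurable]: "U \<in> sets borel" using U by simp
    have "emeasure lborel U = emeasure lborel A + emeasure lborel (U - A)"
      using U(2) by (subst plus_emeasure) (auto intro!: arg_cong[where f="emeasure lborel"])
    also have "\<dots> < \<infinity>"
      using fin order.strict_trans[OF U(3) ennreal_less_top] by (simp add: less_top)
    finally have Ufin: "emeasure lborel U < \<infinity>" .
    have "(LBINT x. \<bar>indicator A x - indicator U x :: real\<bar>) = (LBINT x. indicator (U - A) x)"
      using U(2) by (intro Bochner_Integration.integral_cong) (auto split: split_indicator)
    also have "\<dots> = measure lborel (U - A)" by simp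
    also have "\<dots> < e"
    proof -
      have "emeasure lborel (U - A) = ennreal (measure lborel (U - A))"
        using order.strict_trans[OF U(3) ennreal_less_top] by (intro emeasure_eq_ennreal_measure) auto
      with U(3) show ?thesis by (simp add: ennreal_less_iff)
    qed
    finally show "\<exists>g. integrable lborel g \<and> L1_continuous_translation g \<and>
        (LBINT x. \<bar>indicator A x - g x\<bar>) < e"
      using L1_continuous_translation_open[OF U(1) Ufin] Ufin
      by (intro exI[of _ "indicator U"]) (auto simp: integrable_indicator_iff)
  qed
  from L1_continuous_translation_cmult[OF this, of c] show ?case by (simp add: mult.commute)
next
  case (add f g)
  show ?case unfolding L1_continuous_translation_def
  proof (intro allI impI)
    fix h :: "nat \<Rightarrow> 'a" assume "h \<longlonglongrightarrow> 0"
    with add have l: "(\<lambda>n. (LBINT x. \<bar>f (x + h n) - f x\<bar>) + (LBINT x. \<bar>g (x + h n) - g x\<bar>)) \<longlonglongrightarrow> 0 + 0"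
      by (intro tendsto_add) (auto simp: L1_continuous_translation_def)
    have tr: "integrable lborel (\<lambda>x. f (x + h n))" "integrable lborel (\<lambda>x. g (x + h n))" for n
      using add integrable_lborel_translate by blast+
    have int: "integrable lborel (\<lambda>x. \<bar>f (x + h n) - f x\<bar>)" "integrable lborel (\<lambda>x. \<bar>g (x + h n) - g x\<bar>)" for n
      using add tr[of n] by auto
    have "(LBINT x. \<bar>f (x + h n) + g (x + h n) - (f x + g x)\<bar>)
      \<le> (LBINT x. \<bar>f (x + h n) - f x\<bar>) + (LBINT x. \<bar>g (x + h n) - g x\<bar>)" for n
      unfolding Bochner_Integration.integral_add[OF int, symmetric]
      using add tr[of n] by (intro integral_mono) auto
    then show "(\<lambda>n. LBINT x. \<bar>f (x + h n) + g (x + h n) - (f x + g x)\<bar>) \<longlonglongrightarrow> 0"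
      using l by (intro Lim_null_comparison[OF _ l[simplified]] always_eventually allI) simp
  qed
next
  case (lim f s)
  show ?case
  proof (rule L1_continuous_translation_approx)
    fix e :: real assume "e > 0"
    have "(\<lambda>i. LBINT x. \<bar>f x - s i x\<bar>) \<longlonglongrightarrow> (\<integral>x. 0 \<partial>(lborel :: 'a measure))"
    proof (rule integral_dominated_convergence[where w="\<lambda>x. 3 * \<bar>f x\<bar>"])
      show "AE x in lborel. (\<lambda>i. \<bar>f x - s i x\<bar>) \<longlonglongrightarrow> 0"
      proof (rule AE_I2)
        fix x
        have "(\<lambda>i. \<bar>f x - s i x\<bar>) \<longlonglongrightarrow> \<bar>f x - f x\<bar>"
          by (intro tendsto_intros lim) simp
        then show "(\<lambda>i. \<bar>f x - s i x\<bar>) \<longlonglongrightarrow> 0" by simp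
      qed
      show "AE x in lborel. norm \<bar>f x - s i x\<bar> \<le> 3 * \<bar>f x\<bar>" for i
      proof (rule AE_I2)
        fix x
        have "norm (s i x) \<le> 2 * norm (f x)" by (rule lim) simp
        then show "norm \<bar>f x - s i x\<bar> \<le> 3 * \<bar>f x\<bar>" unfolding real_norm_def by linarith
      qed
    qed (use lim in auto)
    then have "(\<lambda>i. LBINT x. \<bar>f x - s i x\<bar>) \<longlonglongrightarrow> 0" by simp
    from order_tendstoD(2)[OF this \<open>e > 0\<close>] obtain i where "(LBINT x. \<bar>f x - s i x\<bar>) < e"
      by (auto simp: eventually_sequentially)
    then show "\<exists>g. integrable lborel g \<and> L1_continuous_translation g \<and> (LBINT x. \<bar>f x - g x\<bar>) < e"
      using lim by (intro exI[of _ "s i"]) auto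
  qed (use lim in auto)
qed

section \<open>Smooth bumps and the fundamental lemma\<close>

text \<open>
  For \<open>k = 0\<close> this is the classical smooth function that vanishes to infinite order at \<open>0\<close>. The powers
  of \<open>s\<close> in the denominator make the family closed under differentiation.
\<close>

definition flat_exp :: "nat \<Rightarrow> real \<Rightarrow> real" where
  "flat_exp k s = (if s > 0 then exp (- 1 / s) / s ^ k else 0)"

lemma flat_exp_nonneg: "0 \<le> flat_exp k s"
  by (simp add: flat_exp_def)

lemma flat_exp_0_le_1: "flat_exp 0 s \<le> 1"
  by (simp add: flat_exp_def)

text \<open>
  Infinite order of vanishing is needed only to second order, which gives the derivative \<open>0\<close> at the
  origin. With \<open>n = k + 2\<close> it follows from \<open>y\<^sup>n \<le> exp (n y)\<close> at \<open>y = 1 / (n s)\<close>.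
\<close>

lemma flat_exp_le_square: "flat_exp k s \<le> real (k + 2) ^ (k + 2) * s\<^sup>2"
proof (cases "s > 0")
  case True
  let ?n = "k + 2"
  have "1 / (real ?n * s) \<le> exp (1 / (real ?n * s))"
    using exp_ge_add_one_self[of "1 / (real ?n * s)"] by linarith
  then have "(1 / (real ?n * s)) ^ ?n \<le> exp (1 / (real ?n * s)) ^ ?n"
    using True by (intro power_mono) auto
  also have "\<dots> = exp (real ?n * (1 / (real ?n * s)))" by (rule exp_of_nat_mult[symmetric])
  also have "real ?n * (1 / (real ?n * s)) = 1 / s"
    by (simp del: of_nat_add)
  finally have "1 \<le> exp (1 / s) * (real ?n * s) ^ ?n"
    using True by (simp add: power_divide pos_divide_le_eq)
  then have "exp (- (1 / s)) \<le> (real ?n * s) ^ ?n"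
    by (simp add: exp_minus field_simps)
  also have "\<dots> = (real ?n ^ ?n * s\<^sup>2) * s ^ k"
    by (simp add: power_mult_distrib power_add power2_eq_square)
  finally show ?thesis using True by (simp add: flat_exp_def pos_divide_le_eq)
qed (simp add: flat_exp_def)

lemma flat_exp_has_derivative:
  "(flat_exp k has_real_derivative flat_exp (k + 2) s - real k * flat_exp (k + 1) s) (at s)"
proof -
  consider "s > 0" | "s = 0" | "s < 0" by linarith
  then show ?thesis
  proof cases
    case 1
    have "((\<lambda>s. exp (- 1 / s) / s ^ k) has_real_derivative
        flat_exp (k + 2) s - real k * flat_exp (k + 1) s) (at s)"
      using 1 by (auto intro!: derivative_eq_intros simp: flat_exp_def field_simps power2_eq_square)
        (cases k; simp add: field_simps)
    then show ?thesis
      by (rule has_field_derivative_transform_within_open[of _ _ _ "{0<..}"])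
        (use 1 in \<open>auto simp: flat_exp_def\<close>)
  next
    case 2
    have "(\<lambda>h. flat_exp k h / h) \<midarrow>0\<rightarrow> 0"
    proof (rule Lim_null_comparison)
      show "eventually (\<lambda>h. norm (flat_exp k h / h) \<le> real (k + 2) ^ (k + 2) * \<bar>h\<bar>) (at 0)"
      proof (intro always_eventually allI)
        fix h :: real
        show "norm (flat_exp k h / h) \<le> real (k + 2) ^ (k + 2) * \<bar>h\<bar>"
        proof (cases "h > 0")
          case True
          then show ?thesis using flat_exp_le_square[of k h] flat_exp_nonneg[of k h]
            by (simp add: field_simps power2_eq_square)
        next
          case False
          then have "flat_exp k h / h = 0" by (simp add: flat_exp_def)
          moreover have "0 \<le> real (k + 2) ^ (k + 2) * \<bar>h\<bar>"
            by (intro mult_nonneg_nonneg zero_le_power) auto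
          ultimately show ?thesis by (simp only: norm_zero)
        qed
      qed
      have "((\<lambda>h. real (k + 2) ^ (k + 2) * \<bar>h\<bar>) \<longlongrightarrow> real (k + 2) ^ (k + 2) * \<bar>0\<bar>) (at (0::real))"
        by (intro tendsto_intros)
      then show "((\<lambda>h. real (k + 2) ^ (k + 2) * \<bar>h\<bar>) \<longlongrightarrow> 0) (at (0::real))" by simp
    qed
    with 2 show ?thesis by (simp add: DERIV_def flat_exp_def)
  next
    case 3
    have "((\<lambda>s. 0) has_real_derivative flat_exp (k + 2) s - real k * flat_exp (k + 1) s) (at s)"
      using 3 by (simp add: flat_exp_def)
    then show ?thesis
      by (rule has_field_derivative_transform_within_open[of _ _ _ "{..<0}"])
        (use 3 in \<open>auto simp: flat_exp_def\<close>)
  qed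
qed

text \<open>
  A class of differentiable functions that contains all partial derivatives of its members consists
  of smooth functions; this one contains the bumps below.
\<close>

inductive flat_algebra :: "(real^3 \<Rightarrow> real) \<Rightarrow> bool" where
  const: "flat_algebra (\<lambda>x. c)"
| flat: "flat_algebra (\<lambda>x. flat_exp k (c * x $ i + d))"
| add: "flat_algebra f \<Longrightarrow> flat_algebra g \<Longrightarrow> flat_algebra (\<lambda>x. f x + g x)"
| mult: "flat_algebra f \<Longrightarrow> flat_algebra g \<Longrightarrow> flat_algebra (\<lambda>x. f x * g x)"

lemma flat_algebra_has_derivative:
  assumes "flat_algebra f"
  shows "\<exists>D. (\<forall>x. (f has_derivative D x) (at x)) \<and> (\<forall>v. flat_algebra (\<lambda>x. D x v))"
  using assms
proof induction
  case (const c)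
  show ?case by (intro exI[of _ "\<lambda>x v. 0"]) (auto intro: flat_algebra.const)
next
  case (flat k c i d)
  let ?D = "\<lambda>x v. (flat_exp (k + 2) (c * x $ i + d) + (- real k) * flat_exp (k + 1) (c * x $ i + d)) * (c * v $ i)"
  have "((\<lambda>x. flat_exp k (c * x $ i + d)) has_derivative ?D x) (at x)" for x :: "real^3"
  proof -
    have "((\<lambda>x. c * x $ i + d) has_derivative (\<lambda>v. c * v $ i + 0)) (at x)"
      by (intro has_derivative_add has_derivative_const has_derivative_mult_right
          bounded_linear_imp_has_derivative bounded_linear_vec_nth)
    from has_derivative_compose[OF this
        flat_exp_has_derivative[of k "c * x $ i + d", unfolded has_field_derivative_def]]
    show ?thesis by (simp add: algebra_simps)
  qed
  moreover have "flat_algebra (\<lambda>x. ?D x v)" for v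
    by (intro flat_algebra.intros)
  ultimately show ?case by (intro exI[of _ ?D] conjI allI)
next
  case (add f g)
  then obtain D1 D2 where "\<And>x. (f has_derivative D1 x) (at x)" "\<And>v. flat_algebra (\<lambda>x. D1 x v)"
    "\<And>x. (g has_derivative D2 x) (at x)" "\<And>v. flat_algebra (\<lambda>x. D2 x v)" by blast
  then show ?case
    by (intro exI[of _ "\<lambda>x v. D1 x v + D2 x v"] conjI allI)
      (auto intro!: has_derivative_add flat_algebra.add)
next
  case (mult f g)
  then obtain D1 D2 where "\<And>x. (f has_derivative D1 x) (at x)" "\<And>v. flat_algebra (\<lambda>x. D1 x v)"
    "\<And>x. (g has_derivative D2 x) (at x)" "\<And>v. flat_algebra (\<lambda>x. D2 x v)" by blast
  with mult show ?case
    by (intro exI[of _ "\<lambda>x v. f x * D2 x v + D1 x v * g x"] conjI allI)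
      (auto intro!: has_derivative_mult flat_algebra.add flat_algebra.mult)
qed

lemma flat_algebra_cont_diff: "flat_algebra f \<Longrightarrow> cont_diff k f"
proof (induction k arbitrary: f)
  case 0
  from flat_algebra_has_derivative[OF this] show ?case
    by (auto simp: continuous_on_eq_continuous_at intro: has_derivative_continuous)
next
  case (Suc k)
  from flat_algebra_has_derivative[OF Suc.prems] obtain D where
    D: "\<And>x. (f has_derivative D x) (at x)" "\<And>v. flat_algebra (\<lambda>x. D x v)" by blast
  have "partial_deriv i f = (\<lambda>x. D x (axis i 1))" for i
    using frechet_derivative_at[OF D(1)] by (auto simp: partial_deriv_def fun_eq_iff)
  with D Suc.IH show ?case by (auto simp: differentiable_def)
qed

text \<open>
  As \<open>n\<close> grows these functions increase to the indicator of the open box, so no bump with a plateau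
  is needed to recover integrals over boxes.
\<close>

definition box_bump :: "nat \<Rightarrow> real^3 \<Rightarrow> real^3 \<Rightarrow> real^3 \<Rightarrow> real" where
  "box_bump n a b x =
    (\<Prod>i\<in>UNIV. flat_exp 0 (real n * (x $ i - a $ i)) * flat_exp 0 (real n * (b $ i - x $ i)))"

lemma box_bump_nonneg: "0 \<le> box_bump n a b x"
  by (auto simp: box_bump_def intro!: prod_nonneg mult_nonneg_nonneg flat_exp_nonneg)

lemma box_bump_le_1: "box_bump n a b x \<le> 1"
  unfolding box_bump_def
  by (intro prod_le_1 conjI mult_nonneg_nonneg mult_le_one flat_exp_nonneg flat_exp_0_le_1)

lemma box_bump_eq_0:
  assumes "x \<notin> box a b"
  shows "box_bump n a b x = 0"
proof -
  from assms obtain i where "x $ i \<le> a $ i \<or> b $ i \<le> x $ i"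
    by (auto simp: mem_box_cart not_less)
  then have "flat_exp 0 (real n * (x $ i - a $ i)) * flat_exp 0 (real n * (b $ i - x $ i)) = 0"
    by (auto simp: flat_exp_def zero_less_mult_iff)
  then show ?thesis unfolding box_bump_def by (intro prod_zero) auto
qed

lemma flat_algebra_box_bump: "flat_algebra (box_bump n a b)"
proof -
  have *: "flat_algebra (\<lambda>x. \<Prod>i\<in>I. f i x)"
    if "finite I" "\<And>i. i \<in> I \<Longrightarrow> flat_algebra (f i)" for I :: "3 set" and f
    using that by induction (auto intro: flat_algebra.intros)
  have "flat_algebra (\<lambda>x. flat_exp 0 (real n * (x $ i - a $ i)))"
    "flat_algebra (\<lambda>x. flat_exp 0 (real n * (b $ i - x $ i)))" for i
    using flat_algebra.flat[of 0 "real n" i "- real n * a $ i"]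
      flat_algebra.flat[of 0 "- real n" i "real n * b $ i"] by (simp_all add: algebra_simps)
  then show ?thesis unfolding box_bump_def[abs_def]
    by (intro * flat_algebra.mult) auto
qed

lemma test_function_box_bump: "test_function (box_bump n a b)"
  unfolding test_function_def
proof
  show "\<forall>k. cont_diff k (box_bump n a b)"
    by (simp add: flat_algebra_cont_diff flat_algebra_box_bump)
  have "{x. box_bump n a b x \<noteq> 0} \<subseteq> cbox a b"
    using box_bump_eq_0 box_subset_cbox by blast
  then show "compact (closure {x. box_bump n a b x \<noteq> 0})"
    by (meson bounded_cbox bounded_subset compact_closure)
qed

lemma continuous_on_box_bump: "continuous_on UNIV (box_bump n a b)"
  using flat_algebra_cont_diff[OF flat_algebra_box_bump, of 0] by simp

lemma box_bump_tendsto_indicator: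
  "(\<lambda>n. box_bump n a b x) \<longlonglongrightarrow> indicator (box a b) x"
proof (cases "x \<in> box a b")
  case True
  have lim1: "(\<lambda>n. flat_exp 0 (real n * c)) \<longlonglongrightarrow> 1" if "c > 0" for c
  proof -
    have "(\<lambda>n. exp (- (1 / c) * inverse (real n))) \<longlonglongrightarrow> exp (- (1 / c) * 0)"
      by (intro tendsto_intros lim_inverse_n)
    then have "(\<lambda>n. exp (- 1 / (real n * c))) \<longlonglongrightarrow> 1" by (simp add: field_simps)
    moreover have "eventually (\<lambda>n. exp (- 1 / (real n * c)) = flat_exp 0 (real n * c)) sequentially"
      using eventually_gt_at_top[of 0] by eventually_elim (use that in \<open>simp add: flat_exp_def\<close>)
    ultimately show ?thesis by (rule Lim_transform_eventually)
  qed
  have "(\<lambda>n. box_bump n a b x) \<longlonglongrightarrow> (\<Prod>i\<in>(UNIV :: 3 set). 1 * 1)"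
    unfolding box_bump_def by (intro tendsto_prod tendsto_mult lim1) (use True in \<open>auto simp: mem_box_cart\<close>)
  with True show ?thesis by simp
qed (simp add: box_bump_eq_0)

lemma locally_integrable_measurable:
  assumes "locally_integrable f"
  shows "f \<in> borel_measurable borel"
proof (rule borel_measurable_LIMSEQ_metric)
  fix n :: nat
  have "set_integrable lborel (cball 0 (real n)) f"
    using assms by (auto simp: locally_integrable_def)
  then show "(\<lambda>x. indicator (cball 0 (real n)) x *\<^sub>R f x) \<in> borel_measurable borel"
    unfolding set_integrable_def using borel_measurable_integrable by fastforce
next
  fix x :: "real^3"
  obtain N :: nat where N: "norm x \<le> real N" using real_arch_simple by blast
  have "eventually (\<lambda>n. indicator (cball 0 (real n)) x *\<^sub>R f x = f x) sequentially"
    using eventually_ge_at_top[of N] by eventually_elim (use N in \<open>auto simp: dist_norm\<close>)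
  then show "(\<lambda>n. indicator (cball 0 (real n)) x *\<^sub>R f x) \<longlonglongrightarrow> f x"
    by (rule tendsto_eventually)
qed

text \<open>
  The Borel sets \<open>A\<close> with \<open>\<integral>\<^sub>A h = 0\<close> form a Dynkin system, and the boxes are a generator of the Borel
  sets that is stable under intersection.
\<close>

lemma AE_zero_if_box_integrals_zero:
  fixes h :: "'a::euclidean_space \<Rightarrow> real"
  assumes h: "integrable lborel h"
    and zero: "\<And>a b. (LBINT x. indicator (box a b) x * h x) = 0"
  shows "AE x in lborel. h x = 0"
proof -
  have int: "integrable lborel (\<lambda>x. indicator A x * h x)" if "A \<in> sets borel" for A
    using integrable_mult_indicator[OF _ h, of A] that by simp
  let ?E = "range (\<lambda>(a, b). box a b :: 'a set)"
  have st: "Int_stable ?E" by (auto simp: Int_stable_def box_Int_box)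
  have sub: "?E \<subseteq> Pow UNIV" by simp
  have all: "(LBINT x. h x) = 0"
  proof (rule LIMSEQ_unique)
    let ?A = "\<lambda>n::nat. box (- (real n *\<^sub>R One)) (real n *\<^sub>R One) :: 'a set"
    show "(\<lambda>n. LBINT x. indicator (?A n) x * h x) \<longlonglongrightarrow> (LBINT x. h x)"
    proof (rule integral_dominated_convergence[where w="\<lambda>x. \<bar>h x\<bar>"])
      show "AE x in lborel. (\<lambda>n. indicator (?A n) x * h x) \<longlonglongrightarrow> h x"
      proof (rule AE_I2)
        fix x :: 'a
        obtain N where N: "x \<in> ?A N" using UN_box_eq_UNIV by blast
        have "eventually (\<lambda>n. indicator (?A n) x * h x = h x) sequentially"
          using eventually_ge_at_top[of N]
        proof eventually_elim
          case (elim n)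
          then have "x \<in> ?A n" using N by (force simp: mem_box)
          then show ?case by simp
        qed
        then show "(\<lambda>n. indicator (?A n) x * h x) \<longlonglongrightarrow> h x" by (rule tendsto_eventually)
      qed
    qed (use h in \<open>auto split: split_indicator intro: borel_measurable_integrable\<close>)
    show "(\<lambda>n. LBINT x. indicator (?A n) x * h x) \<longlonglongrightarrow> 0" using zero by simp
  qed
  have "(LBINT x. indicator A x * h x) = 0" if A: "A \<in> sets borel" for A
  proof -
    have "A \<in> sigma_sets UNIV ?E" using A by (simp add: borel_eq_box)
    then show ?thesis
    proof (induction rule: sigma_sets_induct_disjoint[OF st sub, consumes 1, case_names basic empty compl union])
      case (compl A)
      then have [measurable]: "A \<in> sets borel" by (simp add: borel_eq_box)
      have "(LBINT x. indicator (UNIV - A) x * h x) = (LBINT x. h x - indicator A x * h x)"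
        by (intro Bochner_Integration.integral_cong) (auto split: split_indicator)
      also have "\<dots> = 0" using compl all h int[of A] by simp
      finally show ?case .
    next
      case (union A)
      then have A[measurable]: "\<And>i. A i \<in> sets borel" by (auto simp: borel_eq_box)
      have "(LINT x:(\<Union>i. A i)|lborel. h x) = (\<Sum>i. LINT x:A i|lborel. h x)"
      proof (rule lebesgue_integral_countable_add)
        show "set_integrable lborel (\<Union>i. A i) h"
          using int[of "\<Union>i. A i"] by (simp add: set_integrable_def)
      qed (use union in \<open>auto simp: disjoint_family_on_def\<close>)
      with union show ?case by (simp add: set_lebesgue_integral_def)
    qed (use zero in auto)
  qed
  then have "AE x in lborel. h x = (\<lambda>x. 0) x"
    by (intro density_unique_real h) (auto simp: set_lebesgue_integral_def)
  then show ?thesis by simp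
qed

text \<open>
  The fundamental lemma of the calculus of variations. Box bumps are at once test functions and
  bounded continuous functions, so the lemma serves both for weak derivatives and for the Gaussian
  averages in the study of the Coulomb energy.
\<close>

lemma AE_zero_if_box_bump_integrals_zero:
  assumes h: "locally_integrable h"
    and zero: "\<And>n a b. (LBINT x. box_bump n a b x * h x) = 0"
  shows "AE x in lborel. h x = 0"
proof -
  note [measurable] = locally_integrable_measurable[OF h]
  have bm[measurable]: "box_bump n a b \<in> borel_measurable borel" for n a b
    by (intro borel_measurable_continuous_onI continuous_on_box_bump)
  have zero': "(LBINT x. indicator (box a b) x * h x) = 0" for a b
  proof (rule LIMSEQ_unique)
    show "(\<lambda>n. LBINT x. box_bump n a b x * h x) \<longlonglongrightarrow> (LBINT x. indicator (box a b) x * h x)"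
    proof (rule integral_dominated_convergence[where w="\<lambda>x. \<bar>indicator (cbox a b) x * h x\<bar>"])
      show "integrable lborel (\<lambda>x. \<bar>indicator (cbox a b) x * h x\<bar>)"
        using h by (intro integrable_abs) (auto simp: locally_integrable_def set_integrable_def)
      show "AE x in lborel. (\<lambda>n. box_bump n a b x * h x) \<longlonglongrightarrow> indicator (box a b) x * h x"
        by (intro AE_I2 tendsto_intros box_bump_tendsto_indicator)
      show "AE x in lborel. norm (box_bump n a b x * h x) \<le> \<bar>indicator (cbox a b) x * h x\<bar>" for n
      proof (rule AE_I2)
        fix x
        show "norm (box_bump n a b x * h x) \<le> \<bar>indicator (cbox a b) x * h x\<bar>"
        proof (cases "x \<in> box a b")
          case True
          then have "x \<in> cbox a b" using box_subset_cbox by blast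
          then show ?thesis using box_bump_nonneg[of n a b x] box_bump_le_1[of n a b x]
            by (simp add: abs_mult mult_left_le_one_le)
        qed (simp add: box_bump_eq_0)
      qed
    qed auto
    show "(\<lambda>n. LBINT x. box_bump n a b x * h x) \<longlonglongrightarrow> 0" using zero by simp
  qed
  let ?A = "\<lambda>n::nat. box (- (real n *\<^sub>R One)) (real n *\<^sub>R One) :: (real^3) set"
  have "AE x in lborel. indicator (?A n) x * h x = 0" for n
  proof (rule AE_zero_if_box_integrals_zero)
    let ?C = "cbox (- (real n *\<^sub>R One)) (real n *\<^sub>R One) :: (real^3) set"
    have "integrable lborel (\<lambda>x. indicator ?C x * h x)"
      using h unfolding locally_integrable_def set_integrable_def by (simp add: compact_cbox)
    then show "integrable lborel (\<lambda>x. indicator (?A n) x * h x)"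
      by (rule Bochner_Integration.integrable_bound)
        (use box_subset_cbox in \<open>auto split: split_indicator\<close>)
    fix a b :: "real^3"
    obtain c d where cd: "box a b \<inter> ?A n = box c d" using box_Int_box by blast
    have "(LBINT x. indicator (box a b) x * (indicator (?A n) x * h x))
        = (LBINT x. indicator (box a b \<inter> ?A n) x * h x)"
      by (intro Bochner_Integration.integral_cong) (auto simp: indicator_inter_arith)
    then show "(LBINT x. indicator (box a b) x * (indicator (?A n) x * h x)) = 0"
      using zero' cd by simp
  qed
  then have "AE x in lborel. \<forall>n. indicator (?A n) x * h x = 0" unfolding AE_all_countable by blast
  then show ?thesis
  proof eventually_elim
    case (elim x)
    obtain N where "x \<in> ?A N" using UN_box_eq_UNIV by blast
    with elim[rule_format, of N] show ?case by simp
  qed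
qed

lemma L2_real_iff: "(f :: real^3 \<Rightarrow> real) \<in> L2 \<longleftrightarrow> f \<in> borel_measurable borel \<and> integrable lborel (\<lambda>x. (f x)\<^sup>2)"
  by (simp add: L2_def)

section \<open>Weak derivatives as averaged difference quotients\<close>

lemma abs_mult_le_sum_squares: "\<bar>a * b\<bar> \<le> a\<^sup>2 + (b::real)\<^sup>2"
proof -
  have "2 * (\<bar>a\<bar> * \<bar>b\<bar>) \<le> a\<^sup>2 + b\<^sup>2"
    using sum_squares_bound[of "\<bar>a\<bar>" "\<bar>b\<bar>"] by simp
  moreover have "0 \<le> \<bar>a\<bar> * \<bar>b\<bar>" by simp
  ultimately show ?thesis unfolding abs_mult by linarith
qed

lemma L2_integrable_mult:
  fixes f g :: "real^3 \<Rightarrow> real"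
  assumes "f \<in> L2" "g \<in> L2"
  shows "integrable lborel (\<lambda>x. f x * g x)"
proof (rule Bochner_Integration.integrable_bound)
  have [measurable]: "f \<in> borel_measurable borel" "g \<in> borel_measurable borel"
    using assms by (auto simp: L2_def)
  show "integrable lborel (\<lambda>x. (f x)\<^sup>2 + (g x)\<^sup>2)"
    using assms by (simp add: L2_real_iff)
  show "(\<lambda>x. f x * g x) \<in> borel_measurable lborel" by simp
  show "AE x in lborel. norm (f x * g x) \<le> norm ((f x)\<^sup>2 + (g x)\<^sup>2)"
    using abs_mult_le_sum_squares by (intro AE_I2) simp
qed

lemma L2_add:
  fixes f g :: "real^3 \<Rightarrow> real"
  assumes "f \<in> L2" "g \<in> L2"
  shows "(\<lambda>x. f x + g x) \<in> L2"
  using assms L2_integrable_mult[OF assms]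
  by (auto simp: L2_real_iff power2_sum mult.assoc)

lemma L2_cmult: "f \<in> L2 \<Longrightarrow> (\<lambda>x. c * f x :: real) \<in> L2"
  by (auto simp: L2_real_iff power_mult_distrib)

lemma L2_diff:
  fixes f g :: "real^3 \<Rightarrow> real"
  assumes "f \<in> L2" "g \<in> L2"
  shows "(\<lambda>x. f x - g x) \<in> L2"
  using L2_add[OF assms(1) L2_cmult[OF assms(2), of "-1"]] by simp

lemma L2_translate:
  fixes f :: "real^3 \<Rightarrow> real"
  assumes "f \<in> L2"
  shows "(\<lambda>x. f (x + a)) \<in> L2"
proof -
  have [measurable]: "f \<in> borel_measurable borel" using assms by (simp add: L2_def)
  show ?thesis
    using assms integrable_lborel_translate[of "\<lambda>x. (f x)\<^sup>2" a] by (simp add: L2_real_iff)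
qed

lemma L2_locally_integrable:
  fixes f :: "real^3 \<Rightarrow> 'b::euclidean_space"
  assumes f: "f \<in> L2"
  shows "locally_integrable f"
  unfolding locally_integrable_def set_integrable_def
proof (intro allI impI)
  fix K :: "(real^3) set" assume K: "compact K"
  have [measurable]: "f \<in> borel_measurable borel" "K \<in> sets borel"
    using f K by (auto simp: L2_def compact_imp_closed)
  show "integrable lborel (\<lambda>x. indicator K x *\<^sub>R f x)"
  proof (rule Bochner_Integration.integrable_bound)
    show "integrable lborel (\<lambda>x. indicator K x + (norm (f x))\<^sup>2 :: real)"
      using f emeasure_compact_finite[OF K]
      by (intro Bochner_Integration.integrable_add) (auto simp: L2_def integrable_indicator_iff)
    have "norm (f x) \<le> 1 + (norm (f x))\<^sup>2" for x
      using sum_squares_bound[of 1 "norm (f x)"] norm_ge_zero[of "f x"] by (simp del: norm_ge_zero)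
    then show "AE x in lborel. norm (indicator K x *\<^sub>R f x) \<le> norm (indicator K x + (norm (f x))\<^sup>2 :: real)"
      by (intro AE_I2) (auto split: split_indicator)
  qed simp
qed

lemma test_function_support:
  assumes "test_function \<phi>"
  shows "\<exists>K. compact K \<and> (\<forall>x. x \<notin> K \<longrightarrow> \<phi> x = 0) \<and> (\<forall>x i. x \<notin> K \<longrightarrow> partial_deriv i \<phi> x = 0)"
proof (intro exI[of _ "closure {x. \<phi> x \<noteq> 0}"] conjI allI impI)
  let ?K = "closure {x. \<phi> x \<noteq> 0}"
  show "compact ?K" using assms by (simp add: test_function_def)
  show 0: "\<phi> x = 0" if "x \<notin> ?K" for x
    using that closure_subset[of "{x. \<phi> x \<noteq> 0}"] by (metis (mono_tags, lifting) mem_Collect_eq subsetD)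
  show "partial_deriv i \<phi> x = 0" if "x \<notin> ?K" for x i
  proof -
    have "((\<lambda>x. 0) has_derivative (\<lambda>v. 0)) (at x)" by simp
    then have "(\<phi> has_derivative (\<lambda>v. 0)) (at x)"
    proof (rule has_derivative_transform_within_open)
      show "open (- ?K)" "x \<in> - ?K" using that by (simp_all add: open_Compl)
      show "0 = \<phi> y" if "y \<in> - ?K" for y using 0[of y] that by simp
    qed
    from frechet_derivative_at[OF this] show ?thesis
      unfolding partial_deriv_def by metis
  qed
qed

lemma test_function_has_derivative:
  assumes "test_function \<phi>"
  shows "(\<phi> has_derivative frechet_derivative \<phi> (at x)) (at x)"
proof -
  have "cont_diff (Suc 0) \<phi>" using assms unfolding test_function_def by blast
  then have "\<phi> differentiable (at x)" by simp
  then show ?thesis by (simp only: frechet_derivative_works)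
qed

lemma test_function_continuous: "test_function \<phi> \<Longrightarrow> continuous_on UNIV \<phi>"
  unfolding test_function_def by (drule conjunct1, drule spec[of _ 0]) simp

lemma test_function_continuous_partial: "test_function \<phi> \<Longrightarrow> continuous_on UNIV (partial_deriv i \<phi>)"
  unfolding test_function_def by (drule conjunct1, drule spec[of _ "Suc 0"]) simp

lemma test_function_measurable:
  "test_function \<phi> \<Longrightarrow> \<phi> \<in> borel_measurable borel"
  by (intro borel_measurable_continuous_onI test_function_continuous)

lemma test_function_partial_measurable:
  "test_function \<phi> \<Longrightarrow> partial_deriv i \<phi> \<in> borel_measurable borel"
  by (intro borel_measurable_continuous_onI test_function_continuous_partial)

lemma continuous_compact_support_bounded:
  fixes \<phi> :: "'a::euclidean_space \<Rightarrow> real"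
  assumes "continuous_on UNIV \<phi>" "compact K" "\<And>x. x \<notin> K \<Longrightarrow> \<phi> x = 0"
  shows "\<exists>B. \<forall>x. \<bar>\<phi> x\<bar> \<le> B"
proof -
  have "bounded (\<phi> ` K)"
    using assms by (intro compact_imp_bounded compact_continuous_image) (auto intro: continuous_on_subset)
  then obtain B where B: "\<And>x. x \<in> K \<Longrightarrow> \<bar>\<phi> x\<bar> \<le> B" by (auto simp: bounded_iff)
  show ?thesis
  proof (intro exI[of _ "max B 0"] allI)
    fix x
    show "\<bar>\<phi> x\<bar> \<le> max B 0"
    proof (cases "x \<in> K")
      case True
      with B[of x] show ?thesis by simp
    qed (simp add: assms(3))
  qed
qed

lemma L2_continuous_compact_support:
  fixes \<phi> :: "real^3 \<Rightarrow> real"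
  assumes \<phi>: "continuous_on UNIV \<phi>" "compact K" "\<And>x. x \<notin> K \<Longrightarrow> \<phi> x = 0"
  shows "\<phi> \<in> L2"
proof -
  obtain B where B: "\<And>x. \<bar>\<phi> x\<bar> \<le> B"
    using continuous_compact_support_bounded[OF \<phi>] by auto
  have [measurable]: "\<phi> \<in> borel_measurable borel" "K \<in> sets borel"
    using \<phi> by (auto intro!: borel_measurable_continuous_onI borel_closed compact_imp_closed)
  have "integrable lborel (\<lambda>x. (\<phi> x)\<^sup>2)"
  proof (rule Bochner_Integration.integrable_bound)
    show "integrable lborel (\<lambda>x. B\<^sup>2 * indicator K x :: real)"
      using emeasure_compact_finite[OF \<phi>(2)] by (auto simp: integrable_indicator_iff)
    have "(\<phi> x)\<^sup>2 \<le> B\<^sup>2" for x using B[of x] by (simp add: abs_le_square_iff[symmetric])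
    then show "AE x in lborel. norm ((\<phi> x)\<^sup>2) \<le> norm (B\<^sup>2 * indicator K x :: real)"
      using \<phi>(3) by (intro AE_I2) (auto split: split_indicator)
  qed simp
  then show ?thesis by (simp add: L2_real_iff)
qed

lemma test_function_L2:
  assumes "test_function \<phi>"
  shows "\<phi> \<in> L2" "partial_deriv i \<phi> \<in> L2"
proof -
  obtain K where K: "compact K" "\<And>x. x \<notin> K \<Longrightarrow> \<phi> x = 0" "\<And>x i. x \<notin> K \<Longrightarrow> partial_deriv i \<phi> x = 0"
    using test_function_support[OF assms] by auto
  show "\<phi> \<in> L2"
    by (rule L2_continuous_compact_support[OF test_function_continuous[OF assms] K(1,2)])
  show "partial_deriv i \<phi> \<in> L2"
    by (rule L2_continuous_compact_support[OF test_function_continuous_partial[OF assms] K(1,3)])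
qed

lemma partial_deriv_translate:
  assumes "\<And>x. f differentiable (at x)"
  shows "partial_deriv i (\<lambda>x. f (x + a)) = (\<lambda>x. partial_deriv i f (x + a))"
proof
  fix x
  have "((\<lambda>x. x + a) has_derivative (\<lambda>v. v)) (at x)"
    by (rule has_derivative_add_const[OF has_derivative_ident])
  moreover have "(f has_derivative frechet_derivative f (at (x + a))) (at (x + a))"
    using assms frechet_derivative_works by blast
  ultimately have "((\<lambda>x. f (x + a)) has_derivative frechet_derivative f (at (x + a))) (at x)"
    by (rule has_derivative_compose)
  then have "frechet_derivative f (at (x + a)) = frechet_derivative (\<lambda>x. f (x + a)) (at x)"
    by (rule frechet_derivative_at)
  then show "partial_deriv i (\<lambda>x. f (x + a)) x = partial_deriv i f (x + a)"
    by (simp add: partial_deriv_def)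
qed

lemma cont_diff_translate: "cont_diff k f \<Longrightarrow> cont_diff k (\<lambda>x. f (x + a))"
proof (induction k arbitrary: f)
  case 0
  then show ?case by (auto intro!: continuous_on_compose2[of UNIV f] continuous_intros)
next
  case (Suc k)
  have "(\<lambda>x. f (x + a)) differentiable (at x)" for x
    using Suc.prems by (intro differentiable_compose[of f "\<lambda>x. x + a"]) auto
  moreover have "partial_deriv i (\<lambda>x. f (x + a)) = (\<lambda>x. partial_deriv i f (x + a))" for i
    using Suc.prems by (intro partial_deriv_translate) simp
  ultimately show ?case using Suc by simp
qed

lemma test_function_differentiable: "test_function \<phi> \<Longrightarrow> \<phi> differentiable (at x)"
  unfolding test_function_def by (drule conjunct1, drule spec[of _ "Suc 0"]) simp

lemma test_function_translate:
  assumes \<phi>: "test_function \<phi>"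
  shows "test_function (\<lambda>x. \<phi> (x + a))"
  unfolding test_function_def
proof
  show "\<forall>k. cont_diff k (\<lambda>x. \<phi> (x + a))"
  proof
    fix k
    show "cont_diff k (\<lambda>x. \<phi> (x + a))"
      using \<phi> by (intro cont_diff_translate[of k \<phi> a]) (simp add: test_function_def)
  qed
  obtain K where K: "compact K" "\<And>x. x \<notin> K \<Longrightarrow> \<phi> x = 0"
    using test_function_support[OF \<phi>] by auto
  have "{x. \<phi> (x + a) \<noteq> 0} \<subseteq> (\<lambda>x. - a + x) ` K"
  proof
    fix x assume "x \<in> {x. \<phi> (x + a) \<noteq> 0}"
    then have "x + a \<in> K" using K(2) by auto
    then show "x \<in> (\<lambda>x. - a + x) ` K" by (rule rev_image_eqI) simp
  qed
  moreover have "bounded ((\<lambda>x. - a + x) ` K)"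
    using K(1) by (intro compact_imp_bounded compact_translation)
  ultimately have "bounded {x. \<phi> (x + a) \<noteq> 0}"
    by (rule bounded_subset[rotated])
  then show "compact (closure {x. \<phi> (x + a) \<noteq> 0})"
    by (simp add: compact_closure)
qed

lemma test_function_directional_derivative:
  assumes "test_function \<phi>"
  shows "((\<lambda>t. \<phi> (x + t *\<^sub>R axis i 1)) has_real_derivative partial_deriv i \<phi> (x + t *\<^sub>R axis i 1)) (at t)"
proof -
  have lin: "linear (frechet_derivative \<phi> (at (x + t *\<^sub>R axis i 1)))"
    using test_function_has_derivative[OF assms] by (rule has_derivative_linear)
  have "((\<lambda>t. x + t *\<^sub>R axis i 1) has_derivative (\<lambda>s. s *\<^sub>R axis i 1)) (at t)"
    by (rule has_derivative_eq_rhs,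
        rule has_derivative_add[OF has_derivative_const has_derivative_scaleR_left[OF has_derivative_ident]]) simp
  from has_derivative_compose[OF this test_function_has_derivative[OF assms]]
  have "((\<lambda>t. \<phi> (x + t *\<^sub>R axis i 1)) has_derivative
      (\<lambda>s. frechet_derivative \<phi> (at (x + t *\<^sub>R axis i 1)) (s *\<^sub>R axis i 1))) (at t)" .
  also have "(\<lambda>s. frechet_derivative \<phi> (at (x + t *\<^sub>R axis i 1)) (s *\<^sub>R axis i 1))
      = (*) (partial_deriv i \<phi> (x + t *\<^sub>R axis i 1))"
    by (simp add: partial_deriv_def linear_cmul[OF lin] fun_eq_iff)
  finally show ?thesis unfolding has_field_derivative_def .
qed

text \<open>
  The difference quotient of a differentiable function is the mean of its derivative over a segment.
  Parametrizing the segment by \<open>{0..1}\<close> instead of by length turns every limit of shrinking segments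
  into a limit of integrals over a fixed set, and admits both signs of the step.
\<close>

definition segment_mean :: "'a::euclidean_space \<Rightarrow> ('a \<Rightarrow> real) \<Rightarrow> 'a \<Rightarrow> real" where
  "segment_mean c g x = (LBINT t. indicator {0..1::real} t * g (x + t *\<^sub>R c))"

lemma segment_mean_measurable [measurable]:
  assumes [measurable]: "g \<in> borel_measurable borel"
  shows "segment_mean c g \<in> borel_measurable borel"
  unfolding segment_mean_def[abs_def]
  by (intro lborel.borel_measurable_lebesgue_integral) measurable

lemma test_function_segment_mean:
  assumes \<phi>: "test_function \<phi>"
  shows "\<phi> (x + h *\<^sub>R axis i 1) - \<phi> x = h * segment_mean (h *\<^sub>R axis i 1) (partial_deriv i \<phi>) x"
proof -
  let ?e = "axis i 1 :: real^3"
  have "(LBINT t. indicator {0..1::real} t *\<^sub>R (h * partial_deriv i \<phi> (x + t *\<^sub>R (h *\<^sub>R ?e))))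
    = \<phi> (x + 1 *\<^sub>R (h *\<^sub>R ?e)) - \<phi> (x + 0 *\<^sub>R (h *\<^sub>R ?e))"
  proof (rule integral_FTC_atLeastAtMost)
    fix t :: real
    have "((\<lambda>t. \<phi> (x + t *\<^sub>R ?e)) has_real_derivative partial_deriv i \<phi> (x + (t * h) *\<^sub>R ?e)) (at (t * h))"
      by (rule test_function_directional_derivative[OF \<phi>])
    then have "((\<lambda>t. \<phi> (x + (t * h) *\<^sub>R ?e)) has_real_derivative partial_deriv i \<phi> (x + (t * h) *\<^sub>R ?e) * h) (at t)"
      by (rule DERIV_chain2) (auto intro!: derivative_eq_intros)
    then show "((\<lambda>t. \<phi> (x + t *\<^sub>R h *\<^sub>R ?e)) has_vector_derivative
        h * partial_deriv i \<phi> (x + t *\<^sub>R h *\<^sub>R ?e)) (at t within {0..1})"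
      by (simp add: has_real_derivative_iff_has_vector_derivative mult.commute has_vector_derivative_at_within)
    show "continuous_on {0..1} (\<lambda>t. h * partial_deriv i \<phi> (x + t *\<^sub>R h *\<^sub>R ?e))"
      by (intro continuous_intros continuous_on_compose2[OF test_function_continuous_partial[OF \<phi>]]) auto
  qed simp
  moreover have "(LBINT t. indicator {0..1::real} t *\<^sub>R (h * partial_deriv i \<phi> (x + t *\<^sub>R (h *\<^sub>R ?e))))
      = h * segment_mean (h *\<^sub>R ?e) (partial_deriv i \<phi>) x"
    unfolding segment_mean_def integral_mult_right_zero[symmetric]
    by (intro Bochner_Integration.integral_cong) (auto simp: mult_ac)
  ultimately show ?thesis by simp
qed

text \<open>
  The Cauchy-Schwarz inequality on the unit interval and translation invariance: averaging does not
  increase the \<open>L\<^sup>2\<close> norm.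
\<close>

lemma segment_mean_square_nn_integral_le:
  fixes g :: "'a::euclidean_space \<Rightarrow> real"
  assumes [measurable]: "g \<in> borel_measurable borel"
  shows "(\<integral>\<^sup>+x. ennreal ((segment_mean c g x)\<^sup>2) \<partial>lborel) \<le> (\<integral>\<^sup>+x. ennreal ((g x)\<^sup>2) \<partial>lborel)"
proof -
  let ?I = "indicator {0..1::real} :: real \<Rightarrow> ennreal"
  have "ennreal ((segment_mean c g x)\<^sup>2) \<le> (\<integral>\<^sup>+t. ?I t * ennreal ((g (x + t *\<^sub>R c))\<^sup>2) \<partial>lborel)" for x
  proof -
    have "ennreal \<bar>segment_mean c g x\<bar> \<le> (\<integral>\<^sup>+t. ?I t * (?I t * ennreal \<bar>g (x + t *\<^sub>R c)\<bar>) \<partial>lborel)"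
    proof (cases "integrable lborel (\<lambda>t. indicator {0..1::real} t * g (x + t *\<^sub>R c))")
      case True
      from integral_norm_bound_ennreal[OF this]
      have "ennreal \<bar>segment_mean c g x\<bar> \<le> (\<integral>\<^sup>+t. ennreal (norm (indicator {0..1::real} t * g (x + t *\<^sub>R c))) \<partial>lborel)"
        by (simp add: segment_mean_def)
      also have "\<dots> = (\<integral>\<^sup>+t. ?I t * (?I t * ennreal \<bar>g (x + t *\<^sub>R c)\<bar>) \<partial>lborel)"
        by (intro nn_integral_cong) (auto split: split_indicator)
      finally show ?thesis .
    next
      case False
      then show ?thesis by (simp add: segment_mean_def not_integrable_integral_eq)
    qed
    then have "(ennreal \<bar>segment_mean c g x\<bar>)\<^sup>2 \<le> (\<integral>\<^sup>+t. ?I t * (?I t * ennreal \<bar>g (x + t *\<^sub>R c)\<bar>) \<partial>lborel)\<^sup>2"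
      by (intro power_mono) auto
    also have "\<dots> \<le> (\<integral>\<^sup>+t. (?I t)\<^sup>2 \<partial>lborel) * (\<integral>\<^sup>+t. (?I t * ennreal \<bar>g (x + t *\<^sub>R c)\<bar>)\<^sup>2 \<partial>lborel)"
      by (intro Cauchy_Schwarz_nn_integral) measurable
    also have "(\<integral>\<^sup>+t. (?I t)\<^sup>2 \<partial>lborel) = (\<integral>\<^sup>+t. ?I t \<partial>lborel)"
      by (intro nn_integral_cong) (auto split: split_indicator)
    also have "\<dots> = 1" by simp
    also have "(\<integral>\<^sup>+t. (?I t * ennreal \<bar>g (x + t *\<^sub>R c)\<bar>)\<^sup>2 \<partial>lborel)
        = (\<integral>\<^sup>+t. ?I t * ennreal ((g (x + t *\<^sub>R c))\<^sup>2) \<partial>lborel)"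
      by (intro nn_integral_cong) (auto split: split_indicator simp: ennreal_power)
    finally show ?thesis by (simp add: ennreal_power)
  qed
  then have "(\<integral>\<^sup>+x. ennreal ((segment_mean c g x)\<^sup>2) \<partial>lborel)
    \<le> (\<integral>\<^sup>+x. \<integral>\<^sup>+t. ?I t * ennreal ((g (x + t *\<^sub>R c))\<^sup>2) \<partial>lborel \<partial>lborel)"
    by (intro nn_integral_mono)
  also have "\<dots> = (\<integral>\<^sup>+t. \<integral>\<^sup>+x. ?I t * ennreal ((g (x + t *\<^sub>R c))\<^sup>2) \<partial>lborel \<partial>lborel)"
    by (intro lborel_pair.Fubini') measurable
  also have "\<dots> = (\<integral>\<^sup>+t. ?I t * (\<integral>\<^sup>+x. ennreal ((g x)\<^sup>2) \<partial>lborel) \<partial>lborel)"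
    by (intro nn_integral_cong, subst nn_integral_cmult)
      (auto simp: nn_integral_lborel_translate[of "\<lambda>x. ennreal ((g x)\<^sup>2)"])
  also have "\<dots> = (\<integral>\<^sup>+x. ennreal ((g x)\<^sup>2) \<partial>lborel)"
    by (simp add: nn_integral_multc)
  finally show ?thesis .
qed

lemma segment_mean_L2:
  assumes g: "g \<in> L2"
  shows "segment_mean c g \<in> L2"
    and "(LBINT x. (segment_mean c g x)\<^sup>2) \<le> (LBINT x. (g x)\<^sup>2)"
proof -
  have [measurable]: "g \<in> borel_measurable borel" using g by (simp add: L2_def)
  have gi: "integrable lborel (\<lambda>x. (g x)\<^sup>2)" using g by (simp add: L2_def)
  note le = segment_mean_square_nn_integral_le[of g c]
  have "(\<integral>\<^sup>+x. ennreal ((g x)\<^sup>2) \<partial>lborel) = ennreal (LBINT x. (g x)\<^sup>2)"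
    using gi by (intro nn_integral_eq_integral) auto
  with le have le': "(\<integral>\<^sup>+x. ennreal ((segment_mean c g x)\<^sup>2) \<partial>lborel) \<le> ennreal (LBINT x. (g x)\<^sup>2)" by simp
  have int: "integrable lborel (\<lambda>x. (segment_mean c g x)\<^sup>2)"
    using le' by (intro integrableI_bounded) (auto simp: order_le_less_trans[OF _ ennreal_less_top])
  then show "segment_mean c g \<in> L2" by (simp add: L2_real_iff)
  have "ennreal (LBINT x. (segment_mean c g x)\<^sup>2) = (\<integral>\<^sup>+x. ennreal ((segment_mean c g x)\<^sup>2) \<partial>lborel)"
    using int by (intro nn_integral_eq_integral[symmetric]) auto
  with le' have "ennreal (LBINT x. (segment_mean c g x)\<^sup>2) \<le> ennreal (LBINT x. (g x)\<^sup>2)"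
    by simp
  then show "(LBINT x. (segment_mean c g x)\<^sup>2) \<le> (LBINT x. (g x)\<^sup>2)"
    by (subst (asm) ennreal_le_iff) auto
qed

lemma integrable_pair_segment:
  fixes a b :: "real^3 \<Rightarrow> real"
  assumes a: "a \<in> L2" and b: "b \<in> L2"
  shows "integrable (lborel \<Otimes>\<^sub>M lborel) (\<lambda>(x, t). indicator {0..1::real} t * (a x * b (x + t *\<^sub>R c)))"
proof -
  have [measurable]: "a \<in> borel_measurable borel" "b \<in> borel_measurable borel"
    using a b by (auto simp: L2_def)
  let ?I = "indicator {0..1::real} :: real \<Rightarrow> real"
  have *: "integrable (lborel \<Otimes>\<^sub>M lborel) (\<lambda>(x, t). ?I t * (f (x + t *\<^sub>R d))\<^sup>2)" if f: "f \<in> L2" for f :: "real^3 \<Rightarrow> real" and d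
  proof -
    have [measurable]: "f \<in> borel_measurable borel" using f by (simp add: L2_def)
    have fi: "(\<integral>\<^sup>+x. ennreal ((f x)\<^sup>2) \<partial>lborel) < \<infinity>"
      using f by (auto simp: L2_real_iff integrable_iff_bounded)
    have "(\<integral>\<^sup>+p. ennreal (norm (case p of (x, t) \<Rightarrow> ?I t * (f (x + t *\<^sub>R d))\<^sup>2)) \<partial>(lborel \<Otimes>\<^sub>M lborel))
      = (\<integral>\<^sup>+t. \<integral>\<^sup>+x. ennreal (?I t * (f (x + t *\<^sub>R d))\<^sup>2) \<partial>lborel \<partial>lborel)"
      by (subst lborel_pair.nn_integral_snd[symmetric]) (auto simp: abs_mult)
    also have "\<dots> = (\<integral>\<^sup>+t. indicator {0..1::real} t * (\<integral>\<^sup>+x. ennreal ((f x)\<^sup>2) \<partial>lborel) \<partial>lborel)"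
      by (intro nn_integral_cong, subst nn_integral_lborel_translate[of "\<lambda>x. ennreal ((f x)\<^sup>2)", symmetric])
        (auto split: split_indicator)
    also have "\<dots> < \<infinity>" using fi by (simp add: nn_integral_multc)
    finally show ?thesis by (intro integrableI_bounded) auto
  qed
  show ?thesis
  proof (rule Bochner_Integration.integrable_bound)
    show "integrable (lborel \<Otimes>\<^sub>M lborel)
       (\<lambda>p. (case p of (x, t) \<Rightarrow> ?I t * (a (x + t *\<^sub>R 0))\<^sup>2) + (case p of (x, t) \<Rightarrow> ?I t * (b (x + t *\<^sub>R c))\<^sup>2))"
      by (intro Bochner_Integration.integrable_add * a b)
    have "\<bar>a x * b y\<bar> \<le> (a x)\<^sup>2 + (b y)\<^sup>2" for x y
      by (rule abs_mult_le_sum_squares)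
    then show "AE p in lborel \<Otimes>\<^sub>M lborel. norm (case p of (x, t) \<Rightarrow> ?I t * (a x * b (x + t *\<^sub>R c))) \<le>
       norm ((case p of (x, t) \<Rightarrow> ?I t * (a (x + t *\<^sub>R 0))\<^sup>2) + (case p of (x, t) \<Rightarrow> ?I t * (b (x + t *\<^sub>R c))\<^sup>2))"
      by (intro AE_I2) (auto split: split_indicator)
  qed measurable
qed

lemma integral_mult_segment_mean:
  fixes a b :: "real^3 \<Rightarrow> real"
  assumes a: "a \<in> L2" and b: "b \<in> L2"
  shows "(LBINT x. a x * segment_mean c b x)
    = (LBINT t. indicator {0..1::real} t * (LBINT x. a x * b (x + t *\<^sub>R c)))"
proof -
  let ?I = "indicator {0..1::real} :: real \<Rightarrow> real"
  have "(LBINT x. a x * segment_mean c b x) = (LBINT x. LBINT t. ?I t * (a x * b (x + t *\<^sub>R c)))"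
    unfolding segment_mean_def integral_mult_right_zero[symmetric] by (simp add: mult_ac)
  also have "\<dots> = (LBINT t. LBINT x. ?I t * (a x * b (x + t *\<^sub>R c)))"
    using lborel_pair.Fubini_integral[OF integrable_pair_segment[OF a b, of c]] by simp
  finally show ?thesis by simp
qed

text \<open>The real, one-directional part of the weak gradient.\<close>

definition weak_partial :: "3 \<Rightarrow> (real^3 \<Rightarrow> real) \<Rightarrow> (real^3 \<Rightarrow> real) \<Rightarrow> bool" where
  "weak_partial i f g \<longleftrightarrow> (\<forall>\<phi>. test_function \<phi> \<longrightarrow>
    (LBINT x. partial_deriv i \<phi> x * f x) = - (LBINT x. \<phi> x * g x))"

text \<open>
  Tested against \<open>\<phi>\<close>, the difference of \<open>f\<close> is moved to \<open>\<phi>\<close>, which is smooth, so that its difference is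
  a segment mean of its derivative. Fubini's theorem and the definition of the weak derivative, used
  for the translates of \<open>\<phi>\<close>, turn this into a segment mean of \<open>g\<close>, and the fundamental lemma removes
  the test function.
\<close>

lemma weak_partial_difference:
  assumes f: "f \<in> L2" and g: "g \<in> L2" and fg: "weak_partial i f g"
  shows "AE x in lborel. f (x + h *\<^sub>R axis i 1) - f x = h * segment_mean (h *\<^sub>R axis i 1) g x"
proof -
  let ?c = "h *\<^sub>R axis i 1 :: real^3"
  let ?D = "\<lambda>x. (f (x + ?c) - f x) - h * segment_mean ?c g x"
  let ?I = "indicator {0..1::real} :: real \<Rightarrow> real"
  have D: "?D \<in> L2"
    by (intro L2_diff L2_translate[OF f] L2_cmult segment_mean_L2 f g)
  have "AE x in lborel. ?D x = 0"
  proof (rule AE_zero_if_box_bump_integrals_zero)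
    show "locally_integrable ?D" by (rule L2_locally_integrable[OF D])
    fix n a b
    define \<phi> where "\<phi> = box_bump n a b"
    have \<phi>: "test_function \<phi>" by (simp add: \<phi>_def test_function_box_bump)
    note \<phi>L2 = test_function_L2[OF \<phi>]
    have [measurable]: "f \<in> borel_measurable borel" "g \<in> borel_measurable borel" "\<phi> \<in> borel_measurable borel"
      using f g \<phi>L2 by (auto simp: L2_def)
    have "(LBINT x. \<phi> x * f (x + ?c)) = (LBINT x. \<phi> (x + (- ?c)) * f (x + (- ?c) + ?c))"
      by (subst integral_lborel_translate[of "\<lambda>x. \<phi> x * f (x + ?c)"]) simp_all
    then have "(LBINT x. \<phi> x * f (x + ?c)) - (LBINT x. \<phi> x * f x)
        = (LBINT x. \<phi> (x + (- h) *\<^sub>R axis i 1) * f x) - (LBINT x. \<phi> x * f x)"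
      by simp
    also have "\<dots> = (LBINT x. \<phi> (x + (- h) *\<^sub>R axis i 1) * f x - \<phi> x * f x)"
      by (intro Bochner_Integration.integral_diff[symmetric] L2_integrable_mult f \<phi>L2 L2_translate[OF \<phi>L2(1)])
    also have "\<dots> = (LBINT x. (- h) * (f x * segment_mean ((- h) *\<^sub>R axis i 1) (partial_deriv i \<phi>) x))"
    proof (intro Bochner_Integration.integral_cong refl)
      fix x
      show "\<phi> (x + (- h) *\<^sub>R axis i 1) * f x - \<phi> x * f x
        = (- h) * (f x * segment_mean ((- h) *\<^sub>R axis i 1) (partial_deriv i \<phi>) x)"
        unfolding left_diff_distrib[symmetric] test_function_segment_mean[OF \<phi>] by (simp only: mult_ac)
    qed
    also have "\<dots> = (- h) * (LBINT t. ?I t * (LBINT x. f x * partial_deriv i \<phi> (x + t *\<^sub>R ((- h) *\<^sub>R axis i 1))))"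
      by (simp only: integral_mult_right_zero integral_mult_segment_mean[OF f \<phi>L2(2)])
    also have "(\<lambda>t. ?I t * (LBINT x. f x * partial_deriv i \<phi> (x + t *\<^sub>R ((- h) *\<^sub>R axis i 1))))
      = (\<lambda>t. - (?I t * (LBINT x. \<phi> x * g (x + t *\<^sub>R ?c))))"
    proof
      fix t
      let ?s = "t *\<^sub>R ((- h) *\<^sub>R axis i 1) :: real^3"
      have "(LBINT x. f x * partial_deriv i \<phi> (x + ?s))
          = (LBINT x. partial_deriv i (\<lambda>x. \<phi> (x + ?s)) x * f x)"
        unfolding partial_deriv_translate[OF test_function_differentiable[OF \<phi>], of i ?s]
        by (simp add: mult.commute)
      also have "\<dots> = - (LBINT x. \<phi> (x + ?s) * g x)"
        using fg test_function_translate[OF \<phi>] unfolding weak_partial_def by blast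
      also have "(LBINT x. \<phi> (x + ?s) * g x) = (LBINT x. \<phi> (x + t *\<^sub>R ?c + ?s) * g (x + t *\<^sub>R ?c))"
        by (rule integral_lborel_translate[symmetric]) measurable
      finally show "?I t * (LBINT x. f x * partial_deriv i \<phi> (x + ?s))
          = - (?I t * (LBINT x. \<phi> x * g (x + t *\<^sub>R ?c)))" by simp
    qed
    also have "(- h) * (LBINT t. - (?I t * (LBINT x. \<phi> x * g (x + t *\<^sub>R ?c))))
      = h * (LBINT x. \<phi> x * segment_mean ?c g x)"
      by (simp add: integral_mult_segment_mean[OF \<phi>L2(1) g])
    finally have eq: "(LBINT x. \<phi> x * f (x + ?c)) - (LBINT x. \<phi> x * f x)
      = h * (LBINT x. \<phi> x * segment_mean ?c g x)" .
    have "(LBINT x. \<phi> x * ?D x)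
      = (LBINT x. (\<phi> x * f (x + ?c) - \<phi> x * f x) - h * (\<phi> x * segment_mean ?c g x))"
      by (simp add: algebra_simps)
    also have "\<dots> = (LBINT x. \<phi> x * f (x + ?c)) - (LBINT x. \<phi> x * f x)
       - h * (LBINT x. \<phi> x * segment_mean ?c g x)"
      using L2_integrable_mult[OF \<phi>L2(1) L2_translate[OF f, of ?c]] L2_integrable_mult[OF \<phi>L2(1) f]
        L2_integrable_mult[OF \<phi>L2(1) segment_mean_L2(1)[OF g, of ?c]]
      by simp
    finally show "(LBINT x. box_bump n a b x * ?D x) = 0" using eq by (simp add: \<phi>_def)
  qed
  then show ?thesis by simp
qed

text \<open>
  By Fubini's theorem the \<open>L\<^sup>1\<close> distance is at most the mean over \<open>t \<in> {0..1}\<close> of the \<open>L\<^sup>1\<close> distances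
  between \<open>g\<close> and its translates, which are small by continuity of translation. Since \<open>g\<close> need not be
  integrable, it is cut off outside a compact set that contains all segments of length at most
  \<open>norm e\<close> starting in \<open>K\<close>.
\<close>

lemma segment_mean_tendsto_L1:
  assumes g: "g \<in> L2" and K: "compact K" and h: "h \<longlonglongrightarrow> 0"
  shows "(\<lambda>n. LBINT x. indicator K x * \<bar>segment_mean (h n *\<^sub>R e) g x - g x\<bar>) \<longlonglongrightarrow> 0"
proof -
  let ?I = "indicator {0..1::real} :: real \<Rightarrow> real"
  define L where "L = {x + y | x y. x \<in> K \<and> y \<in> cball 0 (norm e)}"
  have L: "compact L" unfolding L_def by (rule compact_sums[OF K compact_cball])
  have [measurable]: "g \<in> borel_measurable borel" "K \<in> sets borel" "L \<in> sets borel"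
    using g borel_closed[OF compact_imp_closed[OF K]] borel_closed[OF compact_imp_closed[OF L]]
    by (simp_all add: L2_def)
  define G where "G x = indicator L x * g x" for x
  have Gm[measurable]: "G \<in> borel_measurable borel" unfolding G_def by measurable
  have G: "integrable lborel G"
    using L2_locally_integrable[OF g] L by (simp add: locally_integrable_def set_integrable_def G_def[abs_def])
  define w where "w c = (LBINT x. \<bar>G (x + c) - G x\<bar>)" for c
  have w_le: "w c \<le> 2 * (LBINT x. \<bar>G x\<bar>)" and w_ge: "0 \<le> w c" for c
  proof -
    note Gc = integrable_lborel_translate[OF G, of c]
    have "w c \<le> (LBINT x. \<bar>G (x + c)\<bar> + \<bar>G x\<bar>)"
      unfolding w_def using G Gc by (intro integral_mono) auto
    also have "\<dots> = 2 * (LBINT x. \<bar>G x\<bar>)"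
      using G Gc integral_lborel_translate[of "\<lambda>x. \<bar>G x\<bar>" c] by simp
    finally show "w c \<le> 2 * (LBINT x. \<bar>G x\<bar>)" .
    show "0 \<le> w c" by (simp add: w_def)
  qed
  have w_meas[measurable]: "w \<in> borel_measurable borel"
    unfolding w_def[abs_def] by (intro lborel.borel_measurable_lebesgue_integral) measurable
  have lim: "(\<lambda>n. LBINT t. ?I t * w (t *\<^sub>R (h n *\<^sub>R e))) \<longlonglongrightarrow> (\<integral>t. 0 \<partial>(lborel :: real measure))"
  proof (rule integral_dominated_convergence[where w="\<lambda>t. ?I t * (2 * (LBINT x. \<bar>G x\<bar>))"])
    show "integrable lborel (\<lambda>t. ?I t * (2 * (LBINT x. \<bar>G x\<bar>)))"
      by (intro integrable_mult_left) (auto simp: integrable_indicator_iff)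
    show "AE t in lborel. (\<lambda>n. ?I t * w (t *\<^sub>R (h n *\<^sub>R e))) \<longlonglongrightarrow> 0"
    proof (rule AE_I2)
      fix t
      have "(\<lambda>n. t *\<^sub>R (h n *\<^sub>R e)) \<longlonglongrightarrow> t *\<^sub>R (0 *\<^sub>R e)"
        by (intro tendsto_intros h)
      then have "(\<lambda>n. w (t *\<^sub>R (h n *\<^sub>R e))) \<longlonglongrightarrow> 0"
        using L1_continuous_translation[OF G] by (simp add: L1_continuous_translation_def w_def)
      from tendsto_mult_left[OF this, of "?I t"]
      show "(\<lambda>n. ?I t * w (t *\<^sub>R (h n *\<^sub>R e))) \<longlonglongrightarrow> 0" by simp
    qed
    show "AE t in lborel. norm (?I t * w (t *\<^sub>R (h n *\<^sub>R e))) \<le> ?I t * (2 * (LBINT x. \<bar>G x\<bar>))" for n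
      using w_le w_ge by (intro AE_I2) (auto split: split_indicator)
  qed auto
  have bound: "norm (LBINT x. indicator K x * \<bar>segment_mean (h n *\<^sub>R e) g x - g x\<bar>)
      \<le> (LBINT t. ?I t * w (t *\<^sub>R (h n *\<^sub>R e)))" if hn: "\<bar>h n\<bar> \<le> 1" for n
  proof -
    let ?c = "h n *\<^sub>R e"
    let ?F = "\<lambda>(x, t). ?I t * \<bar>G (x + t *\<^sub>R ?c) - G x\<bar>"
    have Fint: "integrable (lborel \<Otimes>\<^sub>M lborel) ?F"
    proof -
      have "(\<integral>\<^sup>+p. ennreal (norm (?F p)) \<partial>(lborel \<Otimes>\<^sub>M lborel))
        = (\<integral>\<^sup>+t. \<integral>\<^sup>+x. ennreal (?I t * \<bar>G (x + t *\<^sub>R ?c) - G x\<bar>) \<partial>lborel \<partial>lborel)"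
        by (subst lborel_pair.nn_integral_snd[symmetric]) (auto simp: abs_mult)
      also have "\<dots> = (\<integral>\<^sup>+t. ennreal (?I t * w (t *\<^sub>R ?c)) \<partial>lborel)"
      proof (intro nn_integral_cong)
        fix t
        show "(\<integral>\<^sup>+x. ennreal (?I t * \<bar>G (x + t *\<^sub>R ?c) - G x\<bar>) \<partial>lborel) = ennreal (?I t * w (t *\<^sub>R ?c))"
          unfolding w_def integral_mult_right_zero[symmetric]
          using G integrable_lborel_translate[OF G, of "t *\<^sub>R ?c"]
          by (intro nn_integral_eq_integral) auto
      qed
      also have "\<dots> \<le> (\<integral>\<^sup>+t. ennreal (2 * (LBINT x. \<bar>G x\<bar>)) * indicator {0..1::real} t \<partial>lborel)"
        using w_le by (intro nn_integral_mono) (auto split: split_indicator intro: ennreal_leI)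
      also have "\<dots> < \<infinity>" by (simp add: nn_integral_cmult ennreal_mult_less_top)
      finally show ?thesis by (intro integrableI_bounded) auto
    qed
    have Fint2: "integrable lborel (\<lambda>x. LBINT t. ?I t * \<bar>G (x + t *\<^sub>R ?c) - G x\<bar>)"
      using lborel_pair.integrable_fst'[OF Fint] by simp
    have "AE x in lborel. integrable lborel (\<lambda>t. ?I t * \<bar>G (x + t *\<^sub>R ?c) - G x\<bar>)"
      using lborel_pair.AE_integrable_fst'[OF Fint] by simp
    then have pt: "AE x in lborel. indicator K x * \<bar>segment_mean ?c g x - g x\<bar>
        \<le> (LBINT t. ?I t * \<bar>G (x + t *\<^sub>R ?c) - G x\<bar>)"
    proof eventually_elim
      case (elim x)
      show ?case
      proof (cases "x \<in> K")
        case True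
        have inL: "x + t *\<^sub>R ?c \<in> L" if "t \<in> {0..1}" for t
        proof -
          have "norm (t *\<^sub>R ?c) \<le> 1 * (1 * norm e)"
            unfolding norm_scaleR using that hn by (intro mult_mono mult_left_le_one_le) auto
          then show ?thesis using True unfolding L_def by (intro CollectI exI[of _ x] exI[of _ "t *\<^sub>R ?c"]) auto
        qed
        have "x \<in> L" using inL[of 0] by simp
        have i1: "integrable lborel (\<lambda>t. ?I t * (G (x + t *\<^sub>R ?c) - G x))"
          by (rule Bochner_Integration.integrable_bound[OF elim]) (auto simp: abs_mult)
        have i2: "integrable lborel (\<lambda>t. ?I t * g x)"
          by (intro integrable_mult_left) (auto simp: integrable_indicator_iff)
        have "segment_mean ?c g x = (LBINT t. ?I t * (G (x + t *\<^sub>R ?c) - G x) + ?I t * g x)"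
          unfolding segment_mean_def using inL \<open>x \<in> L\<close>
          by (intro Bochner_Integration.integral_cong) (auto simp: G_def split: split_indicator)
        also have "\<dots> = (LBINT t. ?I t * (G (x + t *\<^sub>R ?c) - G x)) + g x"
          using i1 i2 by simp
        finally have "\<bar>segment_mean ?c g x - g x\<bar> = \<bar>LBINT t. ?I t * (G (x + t *\<^sub>R ?c) - G x)\<bar>" by simp
        also have "\<dots> \<le> (LBINT t. \<bar>?I t * (G (x + t *\<^sub>R ?c) - G x)\<bar>)"
          by (rule integral_abs_bound)
        finally show ?thesis using True by (simp add: abs_mult)
      qed (auto intro!: integral_nonneg_AE)
    qed
    have "(LBINT x. indicator K x * \<bar>segment_mean ?c g x - g x\<bar>)
      \<le> (LBINT x. LBINT t. ?I t * \<bar>G (x + t *\<^sub>R ?c) - G x\<bar>)"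
    proof (rule integral_mono_AE)
      show "integrable lborel (\<lambda>x. indicator K x * \<bar>segment_mean ?c g x - g x\<bar>)"
        by (rule Bochner_Integration.integrable_bound[OF Fint2])
          (use pt in \<open>auto elim!: eventually_mono simp: abs_mult\<close>)
    qed (use Fint2 pt in auto)
    also have "\<dots> = (LBINT t. LBINT x. ?I t * \<bar>G (x + t *\<^sub>R ?c) - G x\<bar>)"
      using lborel_pair.Fubini_integral[OF Fint] by simp
    finally show ?thesis by (simp add: w_def)
  qed
  have "eventually (\<lambda>n. \<bar>h n\<bar> \<le> 1) sequentially"
    using tendstoD[OF h, of 1] by (auto elim!: eventually_mono simp: dist_real_def)
  then have ev: "eventually (\<lambda>n. norm (LBINT x. indicator K x * \<bar>segment_mean (h n *\<^sub>R e) g x - g x\<bar>)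
      \<le> (LBINT t. ?I t * w (t *\<^sub>R (h n *\<^sub>R e)))) sequentially"
    by (rule eventually_mono) (rule bound)
  from lim have "(\<lambda>n. LBINT t. ?I t * w (t *\<^sub>R (h n *\<^sub>R e))) \<longlonglongrightarrow> 0"
    unfolding integral_zero .
  then show ?thesis by (rule Lim_null_comparison[OF ev])
qed

section \<open>Hardy's inequality\<close>

text \<open>
  Formally \<open>\<integral> w\<^sup>2 \<partial>\<psi> = - 2 \<integral> \<psi> w \<partial>w\<close>, which is at most \<open>\<integral> w\<^sup>2 + \<integral> g\<^sup>2\<close> in absolute value. With difference
  quotients of \<open>w\<^sup>2\<close> in place of derivatives, the bound needs no product rule and holds for a \<open>\<psi>\<close>
  without compact support.
\<close>

lemma weak_partial_square_test:
  assumes w: "w \<in> L2" and g: "g \<in> L2" and wg: "weak_partial i w g"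
    and \<psi>_meas [measurable]: "\<psi> \<in> borel_measurable borel" "\<psi>' \<in> borel_measurable borel"
    and \<psi>: "\<And>x. \<bar>\<psi> x\<bar> \<le> 1"
    and deriv: "\<And>x t. ((\<lambda>t. \<psi> (x + t *\<^sub>R axis i 1)) has_real_derivative \<psi>' (x + t *\<^sub>R axis i 1)) (at t)"
    and L: "\<And>x. \<bar>\<psi>' x\<bar> \<le> L"
  shows "\<bar>LBINT x. (w x)\<^sup>2 * \<psi>' x\<bar> \<le> (LBINT x. (w x)\<^sup>2) + (LBINT x. (g x)\<^sup>2)"
proof -
  let ?e = "axis i 1 :: real^3"
  have wm[measurable]: "w \<in> borel_measurable borel" and wi: "integrable lborel (\<lambda>x. (w x)\<^sup>2)"
    and gi: "integrable lborel (\<lambda>x. (g x)\<^sup>2)" using w g by (simp_all add: L2_real_iff)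
  define h where "h n = inverse (real (Suc n))" for n
  have h0: "h \<longlonglongrightarrow> 0" and hpos: "h n > 0" for n
    unfolding h_def by (rule LIMSEQ_inverse_real_of_nat) simp
  let ?q = "\<lambda>n x. (\<psi> (x + h n *\<^sub>R ?e) - \<psi> x) / h n"
  have lip: "\<bar>?q n x\<bar> \<le> L" for n x
  proof -
    have "norm (\<psi> (x + h n *\<^sub>R ?e) - \<psi> (x + 0 *\<^sub>R ?e)) \<le> L * norm (h n - 0)"
      by (rule field_differentiable_bound[of UNIV "\<lambda>t. \<psi> (x + t *\<^sub>R ?e)" "\<lambda>t. \<psi>' (x + t *\<^sub>R ?e)"])
        (use deriv L in auto)
    then show ?thesis using hpos[of n] by (simp add: pos_divide_le_eq)
  qed
  have lim: "(\<lambda>n. LBINT x. (w x)\<^sup>2 * ?q n x) \<longlonglongrightarrow> (LBINT x. (w x)\<^sup>2 * \<psi>' x)"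
  proof (rule integral_dominated_convergence[where w="\<lambda>x. (w x)\<^sup>2 * L"])
    show "AE x in lborel. (\<lambda>n. (w x)\<^sup>2 * ?q n x) \<longlonglongrightarrow> (w x)\<^sup>2 * \<psi>' x"
    proof (rule AE_I2)
      fix x
      have "((\<lambda>t. (\<psi> (x + t *\<^sub>R ?e) - \<psi> x) / t) \<longlongrightarrow> \<psi>' x) (at 0)"
        using deriv[of x 0] by (simp add: DERIV_def)
      moreover have "filterlim h (at 0) sequentially"
        using h0 hpos by (auto simp: filterlim_at less_imp_neq[symmetric])
      ultimately have "(\<lambda>n. ?q n x) \<longlonglongrightarrow> \<psi>' x"
        by (rule filterlim_compose)
      then show "(\<lambda>n. (w x)\<^sup>2 * ?q n x) \<longlonglongrightarrow> (w x)\<^sup>2 * \<psi>' x"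
        by (rule tendsto_mult_left)
    qed
    show "AE x in lborel. norm ((w x)\<^sup>2 * ?q n x) \<le> (w x)\<^sup>2 * L" for n
    proof (rule AE_I2)
      fix x
      have "(w x)\<^sup>2 * \<bar>?q n x\<bar> \<le> (w x)\<^sup>2 * L" by (intro mult_left_mono lip) simp
      then show "norm ((w x)\<^sup>2 * ?q n x) \<le> (w x)\<^sup>2 * L"
        unfolding real_norm_def abs_mult by simp
    qed
  qed (use wi in auto)
  have bound: "\<bar>LBINT x. (w x)\<^sup>2 * ?q n x\<bar> \<le> (LBINT x. (w x)\<^sup>2) + (LBINT x. (g x)\<^sup>2)" for n
  proof -
    let ?c = "(- h n) *\<^sub>R ?e"
    let ?R = "\<lambda>x. ((w (x + ?c))\<^sup>2 * \<psi> x - (w x)\<^sup>2 * \<psi> x) / h n"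
    define m where "m = segment_mean ?c g"
    have m: "m \<in> L2" "(LBINT x. (m x)\<^sup>2) \<le> (LBINT x. (g x)\<^sup>2)"
      unfolding m_def by (rule segment_mean_L2[OF g])+
    have mi: "integrable lborel (\<lambda>x. (m x)\<^sup>2)" using m by (simp add: L2_real_iff)
    have wci: "integrable lborel (\<lambda>x. (w (x + ?c))\<^sup>2)"
      by (rule integrable_lborel_translate[OF wi])
    have b: "integrable lborel (\<lambda>x. f x * \<psi> x)" if "integrable lborel f" for f :: "real^3 \<Rightarrow> real"
    proof (rule Bochner_Integration.integrable_bound[OF that])
      show "(\<lambda>x. f x * \<psi> x) \<in> borel_measurable lborel"
        using borel_measurable_integrable[OF that] by simp
      show "AE x in lborel. norm (f x * \<psi> x) \<le> norm (f x)"
        using \<psi> by (intro AE_I2) (simp add: abs_mult mult_left_le)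
    qed
    have shift: "(LBINT x. (w x)\<^sup>2 * \<psi> (x + h n *\<^sub>R ?e)) = (LBINT x. (w (x + ?c))\<^sup>2 * \<psi> x)"
      by (subst integral_lborel_translate[of "\<lambda>x. (w x)\<^sup>2 * \<psi> (x + h n *\<^sub>R ?e)" ?c, symmetric]) simp_all
    have i1: "integrable lborel (\<lambda>x. (w x)\<^sup>2 * \<psi> (x + h n *\<^sub>R ?e))"
    proof (rule Bochner_Integration.integrable_bound[OF wi])
      show "AE x in lborel. norm ((w x)\<^sup>2 * \<psi> (x + h n *\<^sub>R ?e)) \<le> norm ((w x)\<^sup>2)"
        using \<psi> by (intro AE_I2) (simp add: abs_mult mult_left_le)
    qed measurable
    have "(LBINT x. (w x)\<^sup>2 * ?q n x)
      = (LBINT x. (w x)\<^sup>2 * \<psi> (x + h n *\<^sub>R ?e) - (w x)\<^sup>2 * \<psi> x) / h n"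
      by (simp add: right_diff_distrib diff_divide_distrib flip: integral_divide_zero)
    also have "\<dots> = ((LBINT x. (w (x + ?c))\<^sup>2 * \<psi> x) - (LBINT x. (w x)\<^sup>2 * \<psi> x)) / h n"
      by (subst Bochner_Integration.integral_diff[OF i1 b[OF wi]]) (simp only: shift)
    also have "\<dots> = (LBINT x. (w (x + ?c))\<^sup>2 * \<psi> x - (w x)\<^sup>2 * \<psi> x) / h n"
      using b[OF wci] b[OF wi] by simp
    also have "\<dots> = (LBINT x. ?R x)"
      by simp
    finally have eq: "(LBINT x. (w x)\<^sup>2 * ?q n x)
      = (LBINT x. ?R x)" .
    have AE: "AE x in lborel. \<bar>?R x\<bar>
        \<le> ((m x)\<^sup>2 + (w (x + ?c))\<^sup>2 / 2) + (w x)\<^sup>2 / 2"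
      using weak_partial_difference[OF w g wg, of "- h n"]
    proof eventually_elim
      case (elim x)
      have "?R x
        = (w (x + ?c) - w x) / h n * ((w (x + ?c) + w x) * \<psi> x)"
        by (simp add: algebra_simps power2_eq_square diff_divide_distrib add_divide_distrib)
      also have "(w (x + ?c) - w x) / h n = - m x"
        using elim hpos[of n] by (simp add: m_def)
      finally have "\<bar>?R x\<bar> = \<bar>m x\<bar> * (\<bar>w (x + ?c) + w x\<bar> * \<bar>\<psi> x\<bar>)"
        by (simp add: abs_mult)
      also have "\<dots> \<le> \<bar>m x\<bar> * (\<bar>w (x + ?c) + w x\<bar> * 1)"
        by (intro mult_left_mono \<psi>) auto
      also have "\<dots> \<le> \<bar>m x\<bar> * \<bar>w (x + ?c)\<bar> + \<bar>m x\<bar> * \<bar>w x\<bar>"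
        unfolding distrib_left[symmetric] by (intro mult_left_mono) auto
      also have "\<dots> \<le> ((m x)\<^sup>2 + (w (x + ?c))\<^sup>2 / 2) + (w x)\<^sup>2 / 2"
        using sum_squares_bound[of "\<bar>m x\<bar>" "\<bar>w (x + ?c)\<bar>"] sum_squares_bound[of "\<bar>m x\<bar>" "\<bar>w x\<bar>"] by simp
      finally show ?case .
    qed
    have int: "integrable lborel (\<lambda>x. ((m x)\<^sup>2 + (w (x + ?c))\<^sup>2 / 2) + (w x)\<^sup>2 / 2)"
      by (intro Bochner_Integration.integrable_add integrable_divide_zero mi wci wi)
    have "\<bar>LBINT x. ?R x\<bar>
      \<le> (LBINT x. \<bar>?R x\<bar>)"
      by (rule integral_abs_bound)
    also have "\<dots> \<le> (LBINT x. ((m x)\<^sup>2 + (w (x + ?c))\<^sup>2 / 2) + (w x)\<^sup>2 / 2)"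
      by (rule integral_mono_AE[OF _ int AE])
        (intro integrable_abs integrable_divide_zero Bochner_Integration.integrable_diff b wci wi)
    also have "\<dots> = (LBINT x. (m x)\<^sup>2) + (LBINT x. (w (x + ?c))\<^sup>2) / 2 + (LBINT x. (w x)\<^sup>2) / 2"
      using mi wci wi by simp
    also have "(LBINT x. (w (x + ?c))\<^sup>2) = (LBINT x. (w x)\<^sup>2)"
      by (rule integral_lborel_translate) simp
    finally show ?thesis unfolding eq using m(2) by linarith
  qed
  show ?thesis
    by (rule LIMSEQ_le_const2[OF tendsto_rabs[OF lim]]) (use bound in auto)
qed

text \<open>
  The field \<open>y / soft_norm \<epsilon> y\<close> is bounded by \<open>1\<close>, is smooth at the origin, and its divergence
  \<open>3 / s - |y|\<^sup>2 / s\<^sup>3\<close> with \<open>s = soft_norm \<epsilon> y\<close> is at least \<open>2 / s\<close>.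
\<close>

definition soft_norm :: "real \<Rightarrow> 'a::real_normed_vector \<Rightarrow> real" where
  "soft_norm \<epsilon> y = sqrt ((norm y)\<^sup>2 + \<epsilon>\<^sup>2)"

lemma soft_norm_pos: "\<epsilon> > 0 \<Longrightarrow> soft_norm \<epsilon> y > 0"
  unfolding soft_norm_def by (intro real_sqrt_gt_zero add_nonneg_pos) auto

lemma soft_norm_ge: "\<epsilon> > 0 \<Longrightarrow> soft_norm \<epsilon> y \<ge> \<epsilon>" "soft_norm \<epsilon> y \<ge> norm y"
  unfolding soft_norm_def by (intro real_le_rsqrt; simp)+

lemma norm_power2_axis: "(norm (y + t *\<^sub>R axis i 1 :: real^'n))\<^sup>2 = (norm y)\<^sup>2 + 2 * t * y $ i + t\<^sup>2"
proof -
  have "(norm (y + t *\<^sub>R axis i 1))\<^sup>2 = (norm y)\<^sup>2 + 2 * (y \<bullet> (t *\<^sub>R axis i 1)) + (norm (t *\<^sub>R axis i 1 :: real^'n))\<^sup>2"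
    unfolding power2_norm_eq_inner by (simp add: inner_add_left inner_add_right inner_commute)
  then show ?thesis by (simp add: inner_axis power_mult_distrib)
qed

lemma unit_field_has_derivative:
  fixes y :: "real^'n"
  assumes "\<epsilon> > 0"
  shows "((\<lambda>t. (y + t *\<^sub>R axis i 1) $ i / soft_norm \<epsilon> (y + t *\<^sub>R axis i 1)) has_real_derivative
    1 / soft_norm \<epsilon> (y + t *\<^sub>R axis i 1) - ((y + t *\<^sub>R axis i 1) $ i)\<^sup>2 / soft_norm \<epsilon> (y + t *\<^sub>R axis i 1) ^ 3) (at t)"
proof -
  let ?s = "soft_norm \<epsilon> (y + t *\<^sub>R axis i 1)"
  let ?z = "y $ i + t"
  have s: "?s > 0" by (rule soft_norm_pos[OF assms])
  have s2: "(norm y)\<^sup>2 + 2 * t * y $ i + t\<^sup>2 + \<epsilon>\<^sup>2 > 0"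
  proof -
    have "(norm y)\<^sup>2 + 2 * t * y $ i + t\<^sup>2 = (norm (y + t *\<^sub>R axis i 1))\<^sup>2" by (simp add: norm_power2_axis)
    then show ?thesis using assms by (simp add: add_nonneg_pos)
  qed
  have s': "sqrt ((norm y)\<^sup>2 + 2 * t * y $ i + t\<^sup>2 + \<epsilon>\<^sup>2) = ?s"
    by (simp add: soft_norm_def norm_power2_axis)
  have ds: "((\<lambda>t. sqrt ((norm y)\<^sup>2 + 2 * t * y $ i + t\<^sup>2 + \<epsilon>\<^sup>2)) has_real_derivative ?z / ?s) (at t)"
  proof -
    have "((\<lambda>t. (norm y)\<^sup>2 + 2 * t * y $ i + t\<^sup>2 + \<epsilon>\<^sup>2) has_real_derivative 2 * ?z) (at t)"
      by (auto intro!: derivative_eq_intros simp: algebra_simps)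
    from DERIV_chain2[OF DERIV_real_sqrt[OF s2] this]
    have "((\<lambda>t. sqrt ((norm y)\<^sup>2 + 2 * t * y $ i + t\<^sup>2 + \<epsilon>\<^sup>2)) has_real_derivative
      inverse (sqrt ((norm y)\<^sup>2 + 2 * t * y $ i + t\<^sup>2 + \<epsilon>\<^sup>2)) / 2 * (2 * ?z)) (at t)" .
    moreover have "inverse (sqrt ((norm y)\<^sup>2 + 2 * t * y $ i + t\<^sup>2 + \<epsilon>\<^sup>2)) / 2 * (2 * ?z) = ?z / ?s"
      unfolding s' using s by (simp add: field_simps)
    ultimately show ?thesis by (simp only:)
  qed
  have dz: "((\<lambda>t. y $ i + t) has_real_derivative 1) (at t)"
    using DERIV_add[OF DERIV_const DERIV_ident, of "y $ i" t] by simp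
  have "((\<lambda>t. (y $ i + t) / sqrt ((norm y)\<^sup>2 + 2 * t * y $ i + t\<^sup>2 + \<epsilon>\<^sup>2)) has_real_derivative
      (1 * ?s - ?z * (?z / ?s)) / (?s * ?s)) (at t)"
    using DERIV_divide[OF dz ds] s unfolding s' by simp
  moreover have "(1 * ?s - ?z * (?z / ?s)) / (?s * ?s) = 1 / ?s - ?z\<^sup>2 / ?s ^ 3"
    using s by (simp add: field_simps power2_eq_square power3_eq_cube)
  moreover have "soft_norm \<epsilon> (y + t *\<^sub>R axis i 1) = sqrt ((norm y)\<^sup>2 + 2 * t * y $ i + t\<^sup>2 + \<epsilon>\<^sup>2)" for t
    by (simp add: soft_norm_def norm_power2_axis)
  moreover have "(y + t *\<^sub>R axis i 1) $ i = y $ i + t" for t by (simp add: axis_def)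
  ultimately show ?thesis by (simp only:)
qed

lemma soft_hardy:
  fixes a :: "real^3"
  assumes w: "w \<in> L2" and g: "\<And>i. g i \<in> L2" and wg: "\<And>i. weak_partial i w (g i)" and \<epsilon>: "\<epsilon> > 0"
  shows "integrable lborel (\<lambda>x. (w x)\<^sup>2 / soft_norm \<epsilon> (x - a))"
    and "2 * (LBINT x. (w x)\<^sup>2 / soft_norm \<epsilon> (x - a))
      \<le> (\<Sum>i\<in>UNIV. (LBINT x. (w x)\<^sup>2) + (LBINT x. (g i x)\<^sup>2))"
proof -
  let ?s = "\<lambda>x. soft_norm \<epsilon> (x - a)"
  let ?d = "\<lambda>i x. 1 / ?s x - ((x - a) $ i)\<^sup>2 / ?s x ^ 3"
  have wm[measurable]: "w \<in> borel_measurable borel" and wi: "integrable lborel (\<lambda>x. (w x)\<^sup>2)"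
    using w by (simp_all add: L2_real_iff)
  have sm[measurable]: "?s \<in> borel_measurable borel"
    unfolding soft_norm_def by measurable
  have comp[measurable]: "(\<lambda>x. (x - a) $ i) \<in> borel_measurable borel" for i
    by (intro borel_measurable_continuous_onI continuous_intros)
  have spos: "?s x > 0" for x by (rule soft_norm_pos[OF \<epsilon>])
  have yi: "\<bar>(x - a) $ i\<bar> \<le> ?s x" for x i
    by (rule order_trans[OF component_le_norm_cart soft_norm_ge(2)])
  have d_bound: "\<bar>?d i x\<bar> \<le> 1 / \<epsilon>" for i x
  proof -
    have "((x - a) $ i)\<^sup>2 \<le> (?s x)\<^sup>2"
      using yi[where i=i and x=x] spos[of x] by (simp add: abs_le_square_iff[symmetric])
    then have "((x - a) $ i)\<^sup>2 / ?s x ^ 3 \<le> (?s x)\<^sup>2 / ?s x ^ 3"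
      using spos[of x] by (intro divide_right_mono) auto
    also have "\<dots> = 1 / ?s x" using spos[of x] by (simp add: power2_eq_square power3_eq_cube)
    finally have 1: "((x - a) $ i)\<^sup>2 / ?s x ^ 3 \<le> 1 / ?s x" .
    have 2: "0 \<le> ((x - a) $ i)\<^sup>2 / ?s x ^ 3" using spos[of x] by simp
    have 3: "1 / ?s x \<le> 1 / \<epsilon>" using soft_norm_ge(1)[OF \<epsilon>] \<epsilon> by (intro divide_left_mono) (auto simp: spos)
    show ?thesis using 1 2 3 by linarith
  qed
  have di: "integrable lborel (\<lambda>x. (w x)\<^sup>2 * ?d i x)" for i
  proof (rule Bochner_Integration.integrable_bound)
    show "integrable lborel (\<lambda>x. (w x)\<^sup>2 * (1 / \<epsilon>))" using wi by simp
    have "(w x)\<^sup>2 * \<bar>?d i x\<bar> \<le> (w x)\<^sup>2 * (1 / \<epsilon>)" for x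
      by (intro mult_left_mono d_bound) simp
    then show "AE x in lborel. norm ((w x)\<^sup>2 * ?d i x) \<le> norm ((w x)\<^sup>2 * (1 / \<epsilon>))"
      using \<epsilon> by (intro AE_I2) (simp add: abs_mult)
  qed measurable
  have test: "(LBINT x. (w x)\<^sup>2 * ?d i x) \<le> (LBINT x. (w x)\<^sup>2) + (LBINT x. (g i x)\<^sup>2)" for i
  proof -
    have "\<bar>LBINT x. (w x)\<^sup>2 * ?d i x\<bar> \<le> (LBINT x. (w x)\<^sup>2) + (LBINT x. (g i x)\<^sup>2)"
    proof (rule weak_partial_square_test[OF w g wg, where \<psi>="\<lambda>x. (x - a) $ i / ?s x" and L="1 / \<epsilon>"])
      show "\<bar>(x - a) $ i / ?s x\<bar> \<le> 1" for x 
        unfolding abs_divide abs_of_pos[OF spos] using yi[of x i] spos[of x] by simp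
      show "((\<lambda>t. (x + t *\<^sub>R axis i 1 - a) $ i / ?s (x + t *\<^sub>R axis i 1)) has_real_derivative
         ?d i (x + t *\<^sub>R axis i 1)) (at t)" for x t
        using unit_field_has_derivative[OF \<epsilon>, of "x - a" i t] by (simp add: add_diff_eq diff_add_eq)
    qed (use d_bound in auto)
    then show ?thesis by linarith
  qed
  show int: "integrable lborel (\<lambda>x. (w x)\<^sup>2 / ?s x)"
  proof (rule Bochner_Integration.integrable_bound)
    show "integrable lborel (\<lambda>x. (w x)\<^sup>2 / \<epsilon>)" using wi by simp
    have "(w x)\<^sup>2 / ?s x \<le> (w x)\<^sup>2 / \<epsilon>" for x
      using soft_norm_ge(1)[OF \<epsilon>] \<epsilon> by (intro divide_left_mono) (auto simp: spos)
    then show "AE x in lborel. norm ((w x)\<^sup>2 / ?s x) \<le> norm ((w x)\<^sup>2 / \<epsilon>)"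
      using \<epsilon> spos by (intro AE_I2) (simp add: abs_of_pos)
  qed measurable
  have "2 * (LBINT x. (w x)\<^sup>2 / ?s x) = (LBINT x. 2 * ((w x)\<^sup>2 / ?s x))"
    by (rule integral_mult_right_zero[symmetric])
  also have "\<dots> \<le> (LBINT x. (\<Sum>i\<in>UNIV. (w x)\<^sup>2 * ?d i x))"
  proof (rule integral_mono)
    show "integrable lborel (\<lambda>x. 2 * ((w x)\<^sup>2 / ?s x))"
      by (intro integrable_mult_right int)
    show "integrable lborel (\<lambda>x. \<Sum>i\<in>UNIV. (w x)\<^sup>2 * ?d i x)" by (intro Bochner_Integration.integrable_sum di)
    fix x
    have "(\<Sum>i\<in>UNIV. ((x - a) $ i)\<^sup>2) = (norm (x - a))\<^sup>2"
      by (simp add: norm_vec_def L2_set_def sum_nonneg)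
    then have "(\<Sum>i\<in>UNIV. ?d i x) = 3 / ?s x - (norm (x - a))\<^sup>2 / ?s x ^ 3"
      by (simp add: sum_subtractf sum_divide_distrib[symmetric])
    also have "\<dots> \<ge> 2 / ?s x"
    proof -
      have "(norm (x - a))\<^sup>2 / ?s x ^ 3 \<le> (?s x)\<^sup>2 / ?s x ^ 3"
        using spos[of x] soft_norm_ge(2)[of "x - a" \<epsilon>] by (intro divide_right_mono power_mono) auto
      also have "\<dots> = 1 / ?s x" using spos[of x] by (simp add: power2_eq_square power3_eq_cube)
      finally show ?thesis by simp
    qed
    finally have "(w x)\<^sup>2 * (2 / ?s x) \<le> (w x)\<^sup>2 * (\<Sum>i\<in>UNIV. ?d i x)"
      by (intro mult_left_mono) auto
    then show "2 * ((w x)\<^sup>2 / ?s x) \<le> (\<Sum>i\<in>UNIV. (w x)\<^sup>2 * ?d i x)"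
      unfolding sum_distrib_left by (simp only: times_divide_eq_right mult.commute)
  qed
  also have "\<dots> = (\<Sum>i\<in>UNIV. LBINT x. (w x)\<^sup>2 * ?d i x)"
    by (intro Bochner_Integration.integral_sum di)
  also have "\<dots> \<le> (\<Sum>i\<in>UNIV. (LBINT x. (w x)\<^sup>2) + (LBINT x. (g i x)\<^sup>2))"
    by (intro sum_mono test)
  finally show "2 * (LBINT x. (w x)\<^sup>2 / ?s x)
      \<le> (\<Sum>i\<in>UNIV. (LBINT x. (w x)\<^sup>2) + (LBINT x. (g i x)\<^sup>2))" .
qed

text \<open>
  The bound does not depend on the centre \<open>a\<close>. Thus the potential generated by the density \<open>w\<^sup>2\<close> is
  bounded, which makes the Coulomb energy finite as well. The limit \<open>\<epsilon> \<rightarrow> 0\<close> is taken with Fatou's lemma.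
\<close>

theorem hardy_bound:
  fixes a :: "real^3"
  assumes w: "w \<in> L2" and g: "\<And>i. g i \<in> L2" and wg: "\<And>i. weak_partial i w (g i)"
  defines "C \<equiv> (\<Sum>i\<in>UNIV. (LBINT x. (w x)\<^sup>2) + (LBINT x. (g i x)\<^sup>2)) / 2"
  shows "(\<integral>\<^sup>+x. ennreal ((w x)\<^sup>2 / norm (x - a)) \<partial>lborel) \<le> ennreal C"
proof -
  have wm[measurable]: "w \<in> borel_measurable borel" using w by (simp add: L2_def)
  define \<epsilon> where "\<epsilon> n = inverse (real (Suc n))" for n
  have \<epsilon>0: "\<epsilon> \<longlonglongrightarrow> 0" and \<epsilon>: "\<epsilon> n > 0" for n
    unfolding \<epsilon>_def by (rule LIMSEQ_inverse_real_of_nat) simp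
  let ?u = "\<lambda>n x. ennreal ((w x)\<^sup>2 / soft_norm (\<epsilon> n) (x - a))"
  have [measurable]: "(\<lambda>x. soft_norm (\<epsilon> n) (x - a)) \<in> borel_measurable borel" for n
    unfolding soft_norm_def by measurable
  have "AE x in lborel. x \<noteq> a" by (rule AE_lborel_singleton)
  then have "AE x in lborel. ennreal ((w x)\<^sup>2 / norm (x - a)) = liminf (\<lambda>n. ?u n x)"
  proof eventually_elim
    case (elim x)
    have "(\<lambda>n. sqrt ((norm (x - a))\<^sup>2 + (\<epsilon> n)\<^sup>2)) \<longlonglongrightarrow> sqrt ((norm (x - a))\<^sup>2 + 0\<^sup>2)"
      by (intro tendsto_intros \<epsilon>0)
    then have "(\<lambda>n. soft_norm (\<epsilon> n) (x - a)) \<longlonglongrightarrow> norm (x - a)" by (simp add: soft_norm_def)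
    then have "(\<lambda>n. ?u n x) \<longlonglongrightarrow> ennreal ((w x)\<^sup>2 / norm (x - a))"
      using elim by (intro tendsto_ennrealI tendsto_divide tendsto_const) auto
    then show ?case by (simp add: lim_imp_Liminf)
  qed
  then have "(\<integral>\<^sup>+x. ennreal ((w x)\<^sup>2 / norm (x - a)) \<partial>lborel) = (\<integral>\<^sup>+x. liminf (\<lambda>n. ?u n x) \<partial>lborel)"
    by (rule nn_integral_cong_AE)
  also have "\<dots> \<le> liminf (\<lambda>n. \<integral>\<^sup>+x. ?u n x \<partial>lborel)"
    by (rule nn_integral_liminf) measurable
  also have "\<dots> \<le> ennreal C"
  proof (rule Liminf_le)
    have "(\<integral>\<^sup>+x. ?u n x \<partial>lborel) \<le> ennreal C" for n
    proof -
      have "(\<integral>\<^sup>+x. ?u n x \<partial>lborel) = ennreal (LBINT x. (w x)\<^sup>2 / soft_norm (\<epsilon> n) (x - a))"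
        by (intro nn_integral_eq_integral soft_hardy(1)[OF w g wg \<epsilon>] AE_I2 divide_nonneg_nonneg
            less_imp_le[OF soft_norm_pos[OF \<epsilon>]]) simp
      also have "\<dots> \<le> ennreal C"
        using soft_hardy(2)[OF w g wg \<epsilon>[of n], of a] by (intro ennreal_leI) (simp add: C_def)
      finally show ?thesis .
    qed
    then show "eventually (\<lambda>n. (\<integral>\<^sup>+x. ?u n x \<partial>lborel) \<le> ennreal C) sequentially" by simp
  qed simp
  finally show ?thesis .
qed

section \<open>The weak gradient of a quadratic mean\<close>

lemma test_function_quotient_tendsto:
  assumes v: "locally_integrable v" and \<phi>: "test_function \<phi>"
    and h0: "h \<longlonglongrightarrow> 0" and hne: "\<And>n. h n \<noteq> 0"
  shows "(\<lambda>n. LBINT x. (\<phi> (x + h n *\<^sub>R axis i 1) - \<phi> x) / h n * v x)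
    \<longlonglongrightarrow> (LBINT x. partial_deriv i \<phi> x * v x)"
proof -
  let ?e = "axis i 1 :: real^3"
  note [measurable] = locally_integrable_measurable[OF v] test_function_measurable[OF \<phi>]
    test_function_partial_measurable[OF \<phi>]
  obtain K where K: "compact K" "\<And>x. x \<notin> K \<Longrightarrow> \<phi> x = 0" "\<And>x i. x \<notin> K \<Longrightarrow> partial_deriv i \<phi> x = 0"
    using test_function_support[OF \<phi>] by auto
  obtain M where M: "\<And>x. \<bar>partial_deriv i \<phi> x\<bar> \<le> M"
    using continuous_compact_support_bounded[OF test_function_continuous_partial[OF \<phi>] K(1,3)] by auto
  have lip: "\<bar>(\<phi> (x + t *\<^sub>R ?e) - \<phi> x) / t\<bar> \<le> M" if "t \<noteq> 0" for x t
  proof -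
    have "norm (\<phi> (x + t *\<^sub>R ?e) - \<phi> (x + 0 *\<^sub>R ?e)) \<le> M * norm (t - 0)"
      by (rule field_differentiable_bound[of UNIV "\<lambda>t. \<phi> (x + t *\<^sub>R ?e)" "\<lambda>t. partial_deriv i \<phi> (x + t *\<^sub>R ?e)"])
        (use test_function_directional_derivative[OF \<phi>] M in auto)
    then show ?thesis using that by (simp add: divide_le_eq)
  qed
  \<comment> \<open>Contains the supports of \<open>\<phi>\<close> and of all its translates by at most unit length.\<close>
  define L where "L = {x + y | x y. x \<in> K \<and> y \<in> cball 0 (1::real)}"
  have L: "compact L" unfolding L_def by (rule compact_sums[OF K(1) compact_cball])
  have supp: "(\<phi> (x + t *\<^sub>R ?e) - \<phi> x) / t = 0" if "x \<notin> L" "\<bar>t\<bar> \<le> 1" for x t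
  proof -
    have "x \<notin> K"
    proof
      assume "x \<in> K"
      then have "x + 0 \<in> L" unfolding L_def by (intro CollectI exI[of _ x] exI[of _ 0]) auto
      with that show False by simp
    qed
    moreover have "x + t *\<^sub>R ?e \<notin> K"
    proof
      assume "x + t *\<^sub>R ?e \<in> K"
      then have "(x + t *\<^sub>R ?e) + (- t *\<^sub>R ?e) \<in> L"
        unfolding L_def using that(2)
        by (intro CollectI exI[of _ "x + t *\<^sub>R ?e"] exI[of _ "- t *\<^sub>R ?e"]) auto
      with that show False by simp
    qed
    ultimately show ?thesis using K(2) by simp
  qed
  obtain N where N: "\<And>n. n \<ge> N \<Longrightarrow> \<bar>h n\<bar> \<le> 1"
    using LIMSEQ_D[OF h0, of 1] by (auto intro: less_imp_le)
  have "(\<lambda>n. LBINT x. (\<phi> (x + h (n + N) *\<^sub>R ?e) - \<phi> x) / h (n + N) * v x)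
      \<longlonglongrightarrow> (LBINT x. partial_deriv i \<phi> x * v x)"
  proof (rule integral_dominated_convergence[where w="\<lambda>x. M * \<bar>indicator L x * v x\<bar>"])
    show "integrable lborel (\<lambda>x. M * \<bar>indicator L x * v x\<bar>)"
      using v L by (intro integrable_mult_right integrable_abs) (simp add: locally_integrable_def set_integrable_def)
    show "AE x in lborel. (\<lambda>n. (\<phi> (x + h (n + N) *\<^sub>R ?e) - \<phi> x) / h (n + N) * v x) \<longlonglongrightarrow> partial_deriv i \<phi> x * v x"
    proof (rule AE_I2)
      fix x
      have "((\<lambda>t. (\<phi> (x + t *\<^sub>R ?e) - \<phi> x) / t) \<longlongrightarrow> partial_deriv i \<phi> x) (at 0)"
        using test_function_directional_derivative[OF \<phi>, of x i 0] by (simp add: DERIV_def)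
      moreover have "filterlim (\<lambda>n. h (n + N)) (at 0) sequentially"
        using LIMSEQ_ignore_initial_segment[OF h0, of N] hne by (auto simp: filterlim_at)
      ultimately have "(\<lambda>n. (\<phi> (x + h (n + N) *\<^sub>R ?e) - \<phi> x) / h (n + N)) \<longlonglongrightarrow> partial_deriv i \<phi> x"
        by (rule filterlim_compose)
      then show "(\<lambda>n. (\<phi> (x + h (n + N) *\<^sub>R ?e) - \<phi> x) / h (n + N) * v x) \<longlonglongrightarrow> partial_deriv i \<phi> x * v x"
        by (rule tendsto_mult_right)
    qed
    show "AE x in lborel. norm ((\<phi> (x + h (n + N) *\<^sub>R ?e) - \<phi> x) / h (n + N) * v x) \<le> M * \<bar>indicator L x * v x\<bar>" for n
    proof (rule AE_I2)
      fix x
      show "norm ((\<phi> (x + h (n + N) *\<^sub>R ?e) - \<phi> x) / h (n + N) * v x) \<le> M * \<bar>indicator L x * v x\<bar>"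
      proof (cases "x \<in> L")
        case True
        have "\<bar>(\<phi> (x + h (n + N) *\<^sub>R ?e) - \<phi> x) / h (n + N)\<bar> * \<bar>v x\<bar> \<le> M * \<bar>v x\<bar>"
          by (intro mult_right_mono lip hne) simp
        with True show ?thesis unfolding real_norm_def abs_mult[of _ "v x"] by simp
      next
        case False
        have q0: "(\<phi> (x + h (n + N) *\<^sub>R ?e) - \<phi> x) / h (n + N) = 0"
          by (rule supp[OF False N]) simp
        show ?thesis by (subst q0) (use False in simp)
      qed
    qed
  qed measurable
  then show ?thesis by (rule LIMSEQ_offset)
qed

text \<open>
  The coefficients converge only almost everywhere, but they are bounded and the segment means
  converge in \<open>L\<^sup>1\<close> on the support of \<open>\<phi>\<close>; dominated convergence handles the remaining factor \<open>g\<close>.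
\<close>

lemma test_weighted_segment_mean_tendsto:
  fixes a :: "real^3 \<Rightarrow> real"
  assumes g: "g \<in> L2" and \<phi>: "test_function \<phi>" and h0: "h \<longlonglongrightarrow> 0"
    and [measurable]: "\<And>n. b n \<in> borel_measurable borel" "a \<in> borel_measurable borel"
    and b: "\<And>n x. \<bar>b n x\<bar> \<le> 1" and lim: "AE x in lborel. (\<lambda>n. b n x) \<longlonglongrightarrow> a x"
  shows "(\<lambda>n. LBINT x. \<phi> x * (b n x * segment_mean (h n *\<^sub>R e) g x))
    \<longlonglongrightarrow> (LBINT x. \<phi> x * (a x * g x))"
proof -
  have [measurable]: "g \<in> borel_measurable borel" using g by (simp add: L2_def)
  note [measurable] = test_function_measurable[OF \<phi>]
  obtain K where K: "compact K" "\<And>x. x \<notin> K \<Longrightarrow> \<phi> x = 0"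
    using test_function_support[OF \<phi>] by auto
  obtain B where B: "\<And>x. \<bar>\<phi> x\<bar> \<le> B"
    using continuous_compact_support_bounded[OF test_function_continuous[OF \<phi>] K] by auto
  have \<phi>L2: "\<phi> \<in> L2" by (rule test_function_L2[OF \<phi>])
  have \<phi>g: "integrable lborel (\<lambda>x. \<phi> x * g x)" by (rule L2_integrable_mult[OF \<phi>L2 g])
  let ?m = "\<lambda>n. segment_mean (h n *\<^sub>R e) g"
  have m: "?m n \<in> L2" for n by (rule segment_mean_L2[OF g])
  have \<phi>m: "integrable lborel (\<lambda>x. \<phi> x * (?m n x - g x))" for n
    by (rule L2_integrable_mult[OF \<phi>L2 L2_diff[OF m g]])
  have bnd: "integrable lborel (\<lambda>x. b n x * f x)" if "integrable lborel f" for f n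
  proof (rule Bochner_Integration.integrable_bound[OF that])
    show "(\<lambda>x. b n x * f x) \<in> borel_measurable lborel"
      using borel_measurable_integrable[OF that] by simp
    show "AE x in lborel. norm (b n x * f x) \<le> norm (f x)"
      using b by (intro AE_I2) (simp add: abs_mult mult_left_le_one_le)
  qed
  have l1: "(\<lambda>n. LBINT x. b n x * (\<phi> x * g x)) \<longlonglongrightarrow> (LBINT x. a x * (\<phi> x * g x))"
  proof (rule integral_dominated_convergence[where w="\<lambda>x. \<bar>\<phi> x * g x\<bar>"])
    show "AE x in lborel. (\<lambda>n. b n x * (\<phi> x * g x)) \<longlonglongrightarrow> a x * (\<phi> x * g x)"
      using lim by eventually_elim (rule tendsto_mult_right)
    show "AE x in lborel. norm (b n x * (\<phi> x * g x)) \<le> \<bar>\<phi> x * g x\<bar>" for n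
      using b by (intro AE_I2) (simp add: abs_mult mult_left_le_one_le)
  qed (use \<phi>g in auto)
  have l2: "(\<lambda>n. LBINT x. b n x * (\<phi> x * (?m n x - g x))) \<longlonglongrightarrow> 0"
  proof (rule Lim_null_comparison)
    show "eventually (\<lambda>n. norm (LBINT x. b n x * (\<phi> x * (?m n x - g x)))
      \<le> B * (LBINT x. indicator K x * \<bar>?m n x - g x\<bar>)) sequentially"
    proof (intro always_eventually allI)
      fix n
      have li: "integrable lborel (\<lambda>x. indicator K x * \<bar>?m n x - g x\<bar>)"
      proof -
        have "integrable lborel (\<lambda>x. \<bar>indicator K x *\<^sub>R (?m n x - g x)\<bar>)"
          using L2_locally_integrable[OF L2_diff[OF m[of n] g]] K(1)
          by (intro integrable_abs) (simp add: locally_integrable_def set_integrable_def)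
        then show ?thesis by (simp add: abs_mult)
      qed
      have "norm (LBINT x. b n x * (\<phi> x * (?m n x - g x)))
        \<le> (LBINT x. norm (b n x * (\<phi> x * (?m n x - g x))))"
        by (rule integral_norm_bound)
      also have "\<dots> \<le> (LBINT x. B * (indicator K x * \<bar>?m n x - g x\<bar>))"
      proof (rule integral_mono)
        show "integrable lborel (\<lambda>x. norm (b n x * (\<phi> x * (?m n x - g x))))"
          by (intro integrable_norm bnd \<phi>m)
        show "integrable lborel (\<lambda>x. B * (indicator K x * \<bar>?m n x - g x\<bar>))"
          by (intro integrable_mult_right li)
        fix x
        have "\<bar>b n x\<bar> * (\<bar>\<phi> x\<bar> * \<bar>?m n x - g x\<bar>) \<le> \<bar>\<phi> x\<bar> * \<bar>?m n x - g x\<bar>"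
          using b by (simp add: mult_left_le_one_le)
        also have "\<dots> \<le> B * (indicator K x * \<bar>?m n x - g x\<bar>)"
        proof (cases "x \<in> K")
          case True
          have "\<bar>\<phi> x\<bar> * \<bar>?m n x - g x\<bar> \<le> B * \<bar>?m n x - g x\<bar>" by (intro mult_right_mono B) simp
          with True show ?thesis by simp
        qed (simp add: K)
        finally show "norm (b n x * (\<phi> x * (?m n x - g x))) \<le> B * (indicator K x * \<bar>?m n x - g x\<bar>)"
          by (simp add: abs_mult)
      qed
      finally show "norm (LBINT x. b n x * (\<phi> x * (?m n x - g x)))
        \<le> B * (LBINT x. indicator K x * \<bar>?m n x - g x\<bar>)" by simp
    qed
    from tendsto_mult_left[OF segment_mean_tendsto_L1[OF g K(1) h0, of e], of B]
    show "(\<lambda>n. B * (LBINT x. indicator K x * \<bar>?m n x - g x\<bar>)) \<longlonglongrightarrow> 0" by simp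
  qed
  have eq: "(LBINT x. \<phi> x * (b n x * ?m n x))
      = (LBINT x. b n x * (\<phi> x * (?m n x - g x))) + (LBINT x. b n x * (\<phi> x * g x))" for n
    unfolding Bochner_Integration.integral_add[OF bnd[OF \<phi>m] bnd[OF \<phi>g], symmetric]
    by (intro Bochner_Integration.integral_cong) (auto simp: algebra_simps)
  have "(LBINT x. a x * (\<phi> x * g x)) = (LBINT x. \<phi> x * (a x * g x))"
    by (intro Bochner_Integration.integral_cong) (auto simp: algebra_simps)
  with tendsto_add[OF l2 l1] show ?thesis unfolding eq by simp
qed

definition quadratic_mean :: "('a \<Rightarrow> real) \<Rightarrow> ('a \<Rightarrow> real) \<Rightarrow> 'a \<Rightarrow> real" where
  "quadratic_mean w1 w2 x = sqrt (((w1 x)\<^sup>2 + (w2 x)\<^sup>2) / 2)"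

lemma quadratic_mean_power2: "(quadratic_mean w1 w2 x)\<^sup>2 = ((w1 x)\<^sup>2 + (w2 x)\<^sup>2) / 2"
  by (simp add: quadratic_mean_def)

lemma quadratic_mean_nonneg: "0 \<le> quadratic_mean w1 w2 x"
  by (simp add: quadratic_mean_def)

lemma quadratic_mean_pos: "w1 x > 0 \<Longrightarrow> quadratic_mean w1 w2 x > 0"
  unfolding quadratic_mean_def by (intro real_sqrt_gt_zero divide_pos_pos add_pos_nonneg) auto

lemma abs_le_quadratic_mean:
  "\<bar>w1 x\<bar> \<le> 2 * quadratic_mean w1 w2 x" "\<bar>w2 x\<bar> \<le> 2 * quadratic_mean w1 w2 x"
proof -
  have "(w1 x)\<^sup>2 \<le> (2 * quadratic_mean w1 w2 x)\<^sup>2" "(w2 x)\<^sup>2 \<le> (2 * quadratic_mean w1 w2 x)\<^sup>2"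
    by (simp_all add: power_mult_distrib quadratic_mean_power2)
  then show "\<bar>w1 x\<bar> \<le> 2 * quadratic_mean w1 w2 x" "\<bar>w2 x\<bar> \<le> 2 * quadratic_mean w1 w2 x"
    using quadratic_mean_nonneg[of w1 w2 x]
    by (auto intro!: power2_le_imp_le[of "\<bar>_\<bar>"])
qed

lemma quadratic_mean_measurable [measurable]:
  assumes [measurable]: "w1 \<in> borel_measurable M" "w2 \<in> borel_measurable M"
  shows "quadratic_mean w1 w2 \<in> borel_measurable M"
  unfolding quadratic_mean_def[abs_def] by measurable

lemma quadratic_mean_L2:
  assumes "w1 \<in> L2" "w2 \<in> L2"
  shows "quadratic_mean w1 w2 \<in> L2"
  using assms by (auto simp: L2_real_iff quadratic_mean_power2)

text \<open>
  Continuity of translation is applied to the integrable squares, and a positive function is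
  recovered from its square. Both functions must converge along the same subsequence, whence one
  sum of two distances.
\<close>

lemma L2_AE_translates_tendsto:
  fixes w1 w2 :: "real^3 \<Rightarrow> real"
  assumes w1: "w1 \<in> L2" and w2: "w2 \<in> L2" and pos: "\<And>x. w1 x > 0" "\<And>x. w2 x > 0" and h0: "h \<longlonglongrightarrow> 0"
  shows "\<exists>r. strict_mono r \<and> (AE x in lborel. (\<lambda>n. w1 (x + h (r n))) \<longlonglongrightarrow> w1 x \<and> (\<lambda>n. w2 (x + h (r n))) \<longlonglongrightarrow> w2 x)"
proof -
  have i: "integrable lborel (\<lambda>x. (w1 x)\<^sup>2)" "integrable lborel (\<lambda>x. (w2 x)\<^sup>2)"
    using w1 w2 by (simp_all add: L2_real_iff)
  note t = integrable_lborel_translate[OF i(1)] integrable_lborel_translate[OF i(2)]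
  let ?u = "\<lambda>n x. \<bar>(w1 (x + h n))\<^sup>2 - (w1 x)\<^sup>2\<bar> + \<bar>(w2 (x + h n))\<^sup>2 - (w2 x)\<^sup>2\<bar>"
  have ui: "integrable lborel (?u n)" for n
    by (intro Bochner_Integration.integrable_add integrable_abs Bochner_Integration.integrable_diff t i)
  have l: "(\<lambda>n. (LBINT x. \<bar>(w1 (x + h n))\<^sup>2 - (w1 x)\<^sup>2\<bar>) + (LBINT x. \<bar>(w2 (x + h n))\<^sup>2 - (w2 x)\<^sup>2\<bar>)) \<longlonglongrightarrow> 0 + 0"
    by (rule tendsto_add)
      (use L1_continuous_translation[OF i(1)] L1_continuous_translation[OF i(2)] h0 in
        \<open>auto simp: L1_continuous_translation_def\<close>)
  have "(LBINT x. norm (?u n x))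
    = (LBINT x. \<bar>(w1 (x + h n))\<^sup>2 - (w1 x)\<^sup>2\<bar>) + (LBINT x. \<bar>(w2 (x + h n))\<^sup>2 - (w2 x)\<^sup>2\<bar>)" for n
  proof -
    have "norm (?u n x) = ?u n x" for x by simp
    then show ?thesis
      by (simp only:) (intro Bochner_Integration.integral_add integrable_abs Bochner_Integration.integrable_diff t i)
  qed
  with l have "(\<lambda>n. LBINT x. norm (?u n x)) \<longlonglongrightarrow> 0" by simp
  from tendsto_L1_AE_subseq[OF ui this] obtain r where
    r: "strict_mono r" "AE x in lborel. (\<lambda>n. ?u (r n) x) \<longlonglongrightarrow> 0" by blast
  have conv: "(\<lambda>n. w (x + h (r n))) \<longlonglongrightarrow> w x"
    if "\<And>n. \<bar>(w (x + h (r n)))\<^sup>2 - (w x)\<^sup>2\<bar> \<le> ?u (r n) x" "(\<lambda>n. ?u (r n) x) \<longlonglongrightarrow> 0" "\<And>x. w x > 0"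
    for w :: "real^3 \<Rightarrow> real" and x
  proof -
    have "(\<lambda>n. (w (x + h (r n)))\<^sup>2 - (w x)\<^sup>2) \<longlonglongrightarrow> 0"
      by (rule Lim_null_comparison[OF _ that(2)]) (use that(1) in simp)
    then have "(\<lambda>n. (w (x + h (r n)))\<^sup>2) \<longlonglongrightarrow> (w x)\<^sup>2" by (rule LIM_zero_cancel)
    from tendsto_real_sqrt[OF this] show ?thesis using that(3) by (simp add: less_imp_le)
  qed
  have "AE x in lborel. (\<lambda>n. w1 (x + h (r n))) \<longlonglongrightarrow> w1 x \<and> (\<lambda>n. w2 (x + h (r n))) \<longlonglongrightarrow> w2 x"
    using r(2)
  proof eventually_elim
    case (elim x)
    show ?case using elim pos by (intro conjI conv) auto
  qed
  with r(1) show ?thesis by blast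
qed

definition quadratic_mean_derivative ::
  "('a \<Rightarrow> real) \<Rightarrow> ('a \<Rightarrow> real) \<Rightarrow> ('a \<Rightarrow> real) \<Rightarrow> ('a \<Rightarrow> real) \<Rightarrow> 'a \<Rightarrow> real" where
  "quadratic_mean_derivative w1 w2 g1 g2 x = (w1 x * g1 x + w2 x * g2 x) / (2 * quadratic_mean w1 w2 x)"

text \<open>
  With \<open>y = x + h e\<close> the identity \<open>v\<^sup>2 = (w\<^sub>1\<^sup>2 + w\<^sub>2\<^sup>2) / 2\<close> gives
  \<open>(v y - v x) / h = \<Sum>\<^sub>j b\<^sub>j (w\<^sub>j y - w\<^sub>j x) / h\<close> with \<open>b\<^sub>j = (w\<^sub>j y + w\<^sub>j x) / (2 (v y + v x))\<close>. The
  coefficients are bounded by \<open>1\<close> and converge to \<open>w\<^sub>j / (2 v)\<close>, while the difference quotients of \<open>w\<^sub>j\<close>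
  are segment means of \<open>g\<^sub>j\<close>. Positivity keeps the denominators away from zero at each point.
\<close>

theorem quadratic_mean_weak_partial:
  assumes w1: "w1 \<in> L2" and w2: "w2 \<in> L2" and g1: "g1 \<in> L2" and g2: "g2 \<in> L2"
    and wg1: "weak_partial i w1 g1" and wg2: "weak_partial i w2 g2"
    and pos: "\<And>x. w1 x > 0" "\<And>x. w2 x > 0"
  shows "weak_partial i (quadratic_mean w1 w2) (quadratic_mean_derivative w1 w2 g1 g2)"
  unfolding weak_partial_def
proof (intro allI impI)
  fix \<phi> assume \<phi>: "test_function \<phi>"
  let ?e = "axis i 1 :: real^3"
  let ?v = "quadratic_mean w1 w2"
  have vL2: "?v \<in> L2" by (rule quadratic_mean_L2[OF w1 w2])
  have vpos: "?v x > 0" for x by (rule quadratic_mean_pos) (rule pos)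
  have [measurable]: "w1 \<in> borel_measurable borel" "w2 \<in> borel_measurable borel"
    "g1 \<in> borel_measurable borel" "g2 \<in> borel_measurable borel" using w1 w2 g1 g2 by (simp_all add: L2_def)
  note [measurable] = test_function_measurable[OF \<phi>]
  have \<phi>L2: "\<phi> \<in> L2" by (rule test_function_L2[OF \<phi>])
  define h0 where "h0 n = inverse (real (Suc n))" for n
  have "h0 \<longlonglongrightarrow> 0" unfolding h0_def by (rule LIMSEQ_inverse_real_of_nat)
  then have "(\<lambda>n. h0 n *\<^sub>R ?e) \<longlonglongrightarrow> 0 *\<^sub>R ?e" by (intro tendsto_intros)
  then have "(\<lambda>n. h0 n *\<^sub>R ?e) \<longlonglongrightarrow> 0" by simp
  from L2_AE_translates_tendsto[OF w1 w2 pos this] obtain r where r: "strict_mono r"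
    and AEc: "AE x in lborel. (\<lambda>n. w1 (x + h0 (r n) *\<^sub>R ?e)) \<longlonglongrightarrow> w1 x \<and> (\<lambda>n. w2 (x + h0 (r n) *\<^sub>R ?e)) \<longlonglongrightarrow> w2 x"
    by blast
  define h where "h n = h0 (r n)" for n
  have h: "h \<longlonglongrightarrow> 0" using LIMSEQ_subseq_LIMSEQ[OF \<open>h0 \<longlonglongrightarrow> 0\<close> r] by (simp add: h_def[abs_def] o_def)
  have hne: "h n \<noteq> 0" for n by (simp add: h_def h0_def)
  have lim: "AE x in lborel. (\<lambda>n. w1 (x + h n *\<^sub>R ?e)) \<longlonglongrightarrow> w1 x \<and> (\<lambda>n. w2 (x + h n *\<^sub>R ?e)) \<longlonglongrightarrow> w2 x"
    using AEc by (simp add: h_def)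
  define b where "b w n x = (w (x + h n *\<^sub>R ?e) + w x) / (2 * (?v (x + h n *\<^sub>R ?e) + ?v x))" for w :: "real^3 \<Rightarrow> real" and n x
  have bm[measurable]: "b w n \<in> borel_measurable borel" if [measurable]: "w \<in> borel_measurable borel" for w n
    unfolding b_def by measurable
  \<comment> \<open>The cruder bound \<open>2 v\<close> instead of \<open>sqrt 2 v\<close> already gives coefficients of modulus at most \<open>1\<close>.\<close>
  have b1: "\<bar>b w n x\<bar> \<le> 1" if "\<And>x. \<bar>w x\<bar> \<le> 2 * ?v x" for w n x
  proof -
    have "\<bar>w (x + h n *\<^sub>R ?e) + w x\<bar> \<le> 2 * (?v (x + h n *\<^sub>R ?e) + ?v x)"
      using that[of x] that[of "x + h n *\<^sub>R ?e"] abs_triangle_ineq[of "w (x + h n *\<^sub>R ?e)" "w x"]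
      by (simp add: distrib_left)
    then show ?thesis
      using vpos[of x] vpos[of "x + h n *\<^sub>R ?e"] unfolding b_def abs_divide
      by (subst pos_divide_le_eq) (auto simp: abs_of_pos)
  qed
  have vlim: "AE x in lborel. (\<lambda>n. ?v (x + h n *\<^sub>R ?e)) \<longlonglongrightarrow> ?v x"
    using lim
  proof eventually_elim
    case (elim x)
    then show ?case unfolding quadratic_mean_def by (intro tendsto_intros) auto
  qed
  have blim: "AE x in lborel. (\<lambda>n. b w n x) \<longlonglongrightarrow> w x / (2 * ?v x)"
    if "AE x in lborel. (\<lambda>n. w (x + h n *\<^sub>R ?e)) \<longlonglongrightarrow> w x" for w
    using that vlim
  proof eventually_elim
    case (elim x)
    have "(\<lambda>n. b w n x) \<longlonglongrightarrow> (w x + w x) / (2 * (?v x + ?v x))"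
      unfolding b_def using vpos[of x] by (intro tendsto_intros elim) auto
    then show ?case by (simp add: field_simps)
  qed
  have limw: "AE x in lborel. (\<lambda>n. w1 (x + h n *\<^sub>R ?e)) \<longlonglongrightarrow> w1 x"
    "AE x in lborel. (\<lambda>n. w2 (x + h n *\<^sub>R ?e)) \<longlonglongrightarrow> w2 x"
    using lim by (auto elim: eventually_mono)
  let ?m = "\<lambda>g n. segment_mean (h n *\<^sub>R ?e) g"
  note bb = b1[OF abs_le_quadratic_mean(1)[of w1 _ w2]] b1[OF abs_le_quadratic_mean(2)[of w2 _ w1]]
  have T1: "(\<lambda>n. LBINT x. \<phi> x * (b w1 n x * ?m g1 n x)) \<longlonglongrightarrow> (LBINT x. \<phi> x * (w1 x / (2 * ?v x) * g1 x))"
    by (rule test_weighted_segment_mean_tendsto[OF g1 \<phi> h _ _ bb(1) blim[OF limw(1)]]) measurable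
  have T2: "(\<lambda>n. LBINT x. \<phi> x * (b w2 n x * ?m g2 n x)) \<longlonglongrightarrow> (LBINT x. \<phi> x * (w2 x / (2 * ?v x) * g2 x))"
    by (rule test_weighted_segment_mean_tendsto[OF g2 \<phi> h _ _ bb(2) blim[OF limw(2)]]) measurable
  have int: "integrable lborel (\<lambda>x. \<phi> x * (c x * f x))"
    if "f \<in> L2" "c \<in> borel_measurable borel" "\<And>x. \<bar>c x\<bar> \<le> 1" for c f :: "real^3 \<Rightarrow> real"
  proof (rule Bochner_Integration.integrable_bound[OF L2_integrable_mult[OF \<phi>L2 that(1)]])
    have [measurable]: "f \<in> borel_measurable borel" "c \<in> borel_measurable borel" using that by (simp_all add: L2_def)
    show "(\<lambda>x. \<phi> x * (c x * f x)) \<in> borel_measurable lborel" by simp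
    have "\<bar>\<phi> x\<bar> * (\<bar>c x\<bar> * \<bar>f x\<bar>) \<le> \<bar>\<phi> x\<bar> * \<bar>f x\<bar>" for x
      using that(3) by (intro mult_left_mono mult_left_le_one_le) auto
    then show "AE x in lborel. norm (\<phi> x * (c x * f x)) \<le> norm (\<phi> x * f x)"
      by (intro AE_I2) (simp add: abs_mult)
  qed
  have half1: "\<bar>w1 x / (2 * ?v x)\<bar> \<le> 1" and half2: "\<bar>w2 x / (2 * ?v x)\<bar> \<le> 1" for x
    using abs_le_quadratic_mean[of w1 x w2] abs_le_quadratic_mean(2)[of w2 x w1] vpos[of x]
    by (auto simp: abs_divide pos_divide_le_eq abs_of_pos)
  have limit: "(LBINT x. \<phi> x * (w1 x / (2 * ?v x) * g1 x)) + (LBINT x. \<phi> x * (w2 x / (2 * ?v x) * g2 x))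
    = (LBINT x. \<phi> x * quadratic_mean_derivative w1 w2 g1 g2 x)"
  proof -
    have i1: "integrable lborel (\<lambda>x. \<phi> x * (w1 x / (2 * ?v x) * g1 x))"
      by (rule int[OF g1 _ half1]) measurable
    have i2: "integrable lborel (\<lambda>x. \<phi> x * (w2 x / (2 * ?v x) * g2 x))"
      by (rule int[OF g2 _ half2]) measurable
    show ?thesis
      unfolding Bochner_Integration.integral_add[OF i1 i2, symmetric] quadratic_mean_derivative_def
      by (simp add: add_divide_distrib distrib_left)
  qed
  \<comment> \<open>The step is negative for \<open>\<phi>\<close> because the translation is moved from \<open>v\<close> to \<open>\<phi>\<close>.\<close>
  have approx: "(LBINT x. (\<phi> (x + (- h n) *\<^sub>R ?e) - \<phi> x) / (- h n) * ?v x)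
    = - ((LBINT x. \<phi> x * (b w1 n x * ?m g1 n x)) + (LBINT x. \<phi> x * (b w2 n x * ?m g2 n x)))" for n
  proof -
    have i1: "integrable lborel (\<lambda>x. \<phi> x * ?v (x + h n *\<^sub>R ?e))"
      by (rule L2_integrable_mult[OF \<phi>L2 L2_translate[OF vL2]])
    have i2: "integrable lborel (\<lambda>x. \<phi> (x + (- h n) *\<^sub>R ?e) * ?v x)"
      by (rule L2_integrable_mult[OF L2_translate[OF \<phi>L2] vL2])
    have i3: "integrable lborel (\<lambda>x. \<phi> x * ?v x)"
      by (rule L2_integrable_mult[OF \<phi>L2 vL2])
    have shift: "(LBINT x. \<phi> (x + (- h n) *\<^sub>R ?e) * ?v x) = (LBINT x. \<phi> x * ?v (x + h n *\<^sub>R ?e))"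
      by (subst integral_lborel_translate[of "\<lambda>x. \<phi> (x + (- h n) *\<^sub>R ?e) * ?v x" "h n *\<^sub>R ?e", symmetric]) simp_all
    have "(LBINT x. (\<phi> (x + (- h n) *\<^sub>R ?e) - \<phi> x) / (- h n) * ?v x)
      = (LBINT x. (\<phi> (x + (- h n) *\<^sub>R ?e) * ?v x - \<phi> x * ?v x) / (- h n))"
      by (intro Bochner_Integration.integral_cong) (auto simp: left_diff_distrib)
    also have "\<dots> = ((LBINT x. \<phi> (x + (- h n) *\<^sub>R ?e) * ?v x) - (LBINT x. \<phi> x * ?v x)) / (- h n)"
      unfolding integral_divide_zero by (subst Bochner_Integration.integral_diff[OF i2 i3]) simp
    also have "\<dots> = (LBINT x. (\<phi> x * ?v (x + h n *\<^sub>R ?e) - \<phi> x * ?v x) / (- h n))"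
      unfolding integral_divide_zero shift by (subst Bochner_Integration.integral_diff[OF i1 i3]) simp
    also have "\<dots> = (LBINT x. - (\<phi> x * (b w1 n x * ?m g1 n x) + \<phi> x * (b w2 n x * ?m g2 n x)))"
    proof (rule integral_cong_AE)
      show "AE x in lborel. (\<phi> x * ?v (x + h n *\<^sub>R ?e) - \<phi> x * ?v x) / (- h n)
        = - (\<phi> x * (b w1 n x * ?m g1 n x) + \<phi> x * (b w2 n x * ?m g2 n x))"
        using weak_partial_difference[OF w1 g1 wg1, of "h n"] weak_partial_difference[OF w2 g2 wg2, of "h n"]
      proof eventually_elim
        case (elim x)
        let ?y = "x + h n *\<^sub>R ?e"
        have s: "?v ?y + ?v x > 0" using vpos[of x] vpos[of ?y] by simp
        have "(?v ?y - ?v x) * (?v ?y + ?v x) = (?v ?y)\<^sup>2 - (?v x)\<^sup>2"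
          by (simp add: algebra_simps power2_eq_square)
        also have "\<dots> = ((w1 ?y - w1 x) * (w1 ?y + w1 x) + (w2 ?y - w2 x) * (w2 ?y + w2 x)) / 2"
          unfolding quadratic_mean_power2 by (simp add: field_simps power2_eq_square)
        also have "\<dots> = h n * (?m g1 n x * (w1 ?y + w1 x) + ?m g2 n x * (w2 ?y + w2 x)) / 2"
          unfolding elim by (simp add: algebra_simps)
        finally have "?v ?y - ?v x = h n * (?m g1 n x * (w1 ?y + w1 x) + ?m g2 n x * (w2 ?y + w2 x)) / 2 / (?v ?y + ?v x)"
          by (rule eq_divide_imp[rotated]) (use s in simp)
        also have "\<dots> = h n * (b w1 n x * ?m g1 n x + b w2 n x * ?m g2 n x)"
          unfolding b_def by (simp add: add_divide_distrib distrib_left mult.commute)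
        finally have d: "?v ?y - ?v x = h n * (b w1 n x * ?m g1 n x + b w2 n x * ?m g2 n x)" .
        have "(\<phi> x * ?v ?y - \<phi> x * ?v x) / (- h n) = \<phi> x * (?v ?y - ?v x) / (- h n)"
          by (simp add: right_diff_distrib)
        also have "\<dots> = - (\<phi> x * (b w1 n x * ?m g1 n x + b w2 n x * ?m g2 n x))"
          unfolding d using hne[of n] by simp
        finally show ?case by (simp add: distrib_left)
      qed
    qed measurable
    also have "\<dots> = - (LBINT x. \<phi> x * (b w1 n x * ?m g1 n x) + \<phi> x * (b w2 n x * ?m g2 n x))"
      by (rule integral_minus)
    also have "(LBINT x. \<phi> x * (b w1 n x * ?m g1 n x) + \<phi> x * (b w2 n x * ?m g2 n x))
      = (LBINT x. \<phi> x * (b w1 n x * ?m g1 n x)) + (LBINT x. \<phi> x * (b w2 n x * ?m g2 n x))"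
      by (intro Bochner_Integration.integral_add int segment_mean_L2 g1 g2 bb) measurable
    finally show ?thesis .
  qed
  have "(\<lambda>n. LBINT x. (\<phi> (x + (- h n) *\<^sub>R ?e) - \<phi> x) / (- h n) * ?v x)
      \<longlonglongrightarrow> (LBINT x. partial_deriv i \<phi> x * ?v x)"
    by (rule test_function_quotient_tendsto[OF L2_locally_integrable[OF vL2] \<phi>])
      (use tendsto_minus[OF h] hne in auto)
  moreover have "(\<lambda>n. LBINT x. (\<phi> (x + (- h n) *\<^sub>R ?e) - \<phi> x) / (- h n) * ?v x)
      \<longlonglongrightarrow> - (LBINT x. \<phi> x * quadratic_mean_derivative w1 w2 g1 g2 x)"
    unfolding approx limit[symmetric] by (intro tendsto_minus tendsto_add T1 T2)
  ultimately show "(LBINT x. partial_deriv i \<phi> x * ?v x)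
      = - (LBINT x. \<phi> x * quadratic_mean_derivative w1 w2 g1 g2 x)"
    by (rule LIMSEQ_unique)
qed

section \<open>Positive definiteness of the Coulomb energy\<close>

lemma AE_lborel_fst_neq_snd:
  "AE q in (lborel :: ('a::euclidean_space \<times> 'a) measure). fst q \<noteq> snd q"
proof -
  have "AE q in lborel \<Otimes>\<^sub>M lborel. fst q \<noteq> (snd q :: 'a)"
  proof (rule lborel_pair.AE_pair_measure)
    have "open {q :: 'a \<times> 'a. fst q \<noteq> snd q}"
      by (intro open_Collect_neq continuous_intros)
    then have "{q :: 'a \<times> 'a. fst q \<noteq> snd q} \<in> sets borel" by simp
    then have "{q :: 'a \<times> 'a. fst q \<noteq> snd q} \<in> sets (borel \<Otimes>\<^sub>M borel)"
      by (simp only: borel_prod)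
    then show "{q \<in> space (lborel \<Otimes>\<^sub>M lborel). fst q \<noteq> (snd q :: 'a)} \<in> sets (lborel \<Otimes>\<^sub>M lborel)"
      by (simp add: space_pair_measure)
    show "AE x in lborel. AE y in lborel. fst (x, y) \<noteq> (snd (x, y) :: 'a)"
    proof (rule AE_I2)
      fix x :: 'a
      show "AE y in lborel. fst (x, y) \<noteq> snd (x, y)"
        using AE_lborel_singleton[of x] by eventually_elim simp
    qed
  qed
  then show ?thesis by (simp only: lborel_prod)
qed

text \<open>
  If \<open>K x y = \<integral> e\<^sub>p(x) e\<^sub>p(y) dp\<close> off the diagonal, then integrating first over \<open>x\<close> and \<open>y\<close> exhibits the
  quadratic form of \<open>K\<close> as an integral of squares. Nonnegativity of the factors makes the triple
  integral converge absolutely as soon as the form itself does. The diagonal is a null set, and a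
  singular \<open>K\<close> has no meaningful value there.
\<close>

lemma positive_kernel_form:
  fixes f :: "'a::euclidean_space \<Rightarrow> real" and e :: "'p::euclidean_space \<Rightarrow> 'a \<Rightarrow> real"
  assumes [measurable]: "f \<in> borel_measurable borel"
    and em: "(\<lambda>(p, x). e p x) \<in> borel_measurable (borel \<Otimes>\<^sub>M borel)" and e: "\<And>p x. 0 \<le> e p x"
    and K: "\<And>x y. x \<noteq> y \<Longrightarrow> (\<integral>\<^sup>+p. ennreal (e p x * e p y) \<partial>lborel) = ennreal (K x y)"
    and K0: "\<And>x y. 0 \<le> K x y"
    and int: "integrable (lborel \<Otimes>\<^sub>M lborel) (\<lambda>(x, y). f x * f y * K x y)"
  shows "integrable lborel (\<lambda>p. (LBINT x. f x * e p x)\<^sup>2)"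
    and "(LBINT x. LBINT y. f x * f y * K x y) = (LBINT p. (LBINT x. f x * e p x)\<^sup>2)"
proof -
  have em2[measurable]: "(\<lambda>x. e (g x) (h x)) \<in> borel_measurable M"
    if [measurable]: "g \<in> borel_measurable M" "h \<in> borel_measurable M" for g h and M :: "'z measure"
    using measurable_compose[OF measurable_Pair[OF that] em] by simp
  have em3[measurable]: "(\<lambda>x. e p (h x)) \<in> borel_measurable M"
    if [measurable]: "h \<in> borel_measurable M" for h p and M :: "'z measure"
    using em2[of "\<lambda>_. p" M h] that by simp
  have em4[measurable]: "(\<lambda>x. e (g x) y) \<in> borel_measurable M"
    if [measurable]: "g \<in> borel_measurable M" for g y and M :: "'z measure"
    using em2[of g M "\<lambda>_. y"] that by simp
  have fst_m: "fst \<in> (lborel :: ('a \<times> 'a) measure) \<rightarrow>\<^sub>M borel"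
    and snd_m: "snd \<in> (lborel :: ('a \<times> 'a) measure) \<rightarrow>\<^sub>M borel"
    by (simp_all add: borel_measurable_continuous_onI continuous_on_fst continuous_on_snd)
  have ff_m: "(\<lambda>q. fst (fst q)) \<in> (lborel :: ('a \<times> 'a) measure) \<Otimes>\<^sub>M (lborel :: 'p measure) \<rightarrow>\<^sub>M borel"
    by (rule measurable_compose[OF measurable_fst fst_m])
  have sf_m: "(\<lambda>q. snd (fst q)) \<in> (lborel :: ('a \<times> 'a) measure) \<Otimes>\<^sub>M (lborel :: 'p measure) \<rightarrow>\<^sub>M borel"
    by (rule measurable_compose[OF measurable_fst snd_m])
  have s_m: "snd \<in> (lborel :: ('a \<times> 'a) measure) \<Otimes>\<^sub>M (lborel :: 'p measure) \<rightarrow>\<^sub>M borel"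
    using measurable_snd[of "lborel :: ('a \<times> 'a) measure" "lborel :: 'p measure"] by simp
  let ?F = "\<lambda>q. f (fst q) * f (snd q) * K (fst q) (snd q)"
  let ?H = "\<lambda>(q, p). (f (fst q) * f (snd q)) * (e p (fst q) * e p (snd q))"
  have int': "integrable lborel ?F"
    using int by (simp add: lborel_prod case_prod_beta')
  have nn: "(\<integral>\<^sup>+p. ennreal (norm (?H (q, p))) \<partial>lborel) = ennreal (norm (?F q))" if "fst q \<noteq> snd q" for q
  proof -
    have "(\<integral>\<^sup>+p. ennreal (norm (?H (q, p))) \<partial>lborel)
      = (\<integral>\<^sup>+p. ennreal \<bar>f (fst q) * f (snd q)\<bar> * ennreal (e p (fst q) * e p (snd q)) \<partial>lborel)"
      by (intro nn_integral_cong) (simp add: abs_mult e ennreal_mult)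
    also have "\<dots> = ennreal \<bar>f (fst q) * f (snd q)\<bar> * ennreal (K (fst q) (snd q))"
      by (subst nn_integral_cmult) (simp_all add: K that)
    also have "\<dots> = ennreal (norm (?F q))" by (simp add: abs_mult K0 ennreal_mult)
    finally show ?thesis .
  qed
  have Hint: "integrable lborel (\<lambda>p. ?H (q, p))" if "fst q \<noteq> snd q" for q
    using nn[OF that] by (intro integrableI_bounded) auto
  have Hval: "(LBINT p. norm (?H (q, p))) = norm (?F q)" if "fst q \<noteq> snd q" for q
  proof -
    have "ennreal (LBINT p. norm (?H (q, p))) = ennreal (norm (?F q))"
      using nn_integral_eq_integral[OF integrable_norm[OF Hint[OF that]]] nn[OF that] by simp
    then show ?thesis by (subst (asm) ennreal_inj) (auto intro: integral_nonneg_AE)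
  qed
  have Hm: "?H \<in> borel_measurable (lborel \<Otimes>\<^sub>M lborel)"
    unfolding case_prod_beta'
    by (intro borel_measurable_times em2 measurable_compose[OF ff_m] measurable_compose[OF sf_m] ff_m sf_m s_m assms(1))
  have H: "integrable (lborel \<Otimes>\<^sub>M lborel) ?H"
  proof (rule lborel_pair.Fubini_integrable)
    show "?H \<in> borel_measurable (lborel \<Otimes>\<^sub>M lborel)" by (rule Hm)
    show "integrable lborel (\<lambda>q. LBINT p. norm (?H (q, p)))"
    proof (rule integrable_cong_AE_imp[OF integrable_norm[OF int']])
      show "(\<lambda>q. LBINT p. norm (?H (q, p))) \<in> borel_measurable lborel"
        using measurable_compose[OF Hm borel_measurable_norm]
        by (intro lborel.borel_measurable_lebesgue_integral) (simp add: case_prod_beta')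
      show "AE q in lborel. norm (?F q) = (LBINT p. norm (?H (q, p)))"
        using AE_lborel_fst_neq_snd by eventually_elim (rule Hval[symmetric])
    qed
    show "AE q in lborel. integrable lborel (\<lambda>p. ?H (q, p))"
      using AE_lborel_fst_neq_snd by eventually_elim (rule Hint)
  qed
  have H': "integrable (lborel \<Otimes>\<^sub>M lborel) (case_prod (\<lambda>q p. (f (fst q) * f (snd q)) * (e p (fst q) * e p (snd q))))"
    using H .
  have inner: "AE p in lborel. (LBINT q. (f (fst q) * f (snd q)) * (e p (fst q) * e p (snd q)))
      = (LBINT x. f x * e p x)\<^sup>2"
    using lborel_pair.AE_integrable_snd[OF H']
  proof eventually_elim
    case (elim p)
    have "(LBINT q. (f (fst q) * f (snd q)) * (e p (fst q) * e p (snd q)))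
      = (\<integral>q. (f (fst q) * f (snd q)) * (e p (fst q) * e p (snd q)) \<partial>(lborel \<Otimes>\<^sub>M lborel))"
      by (simp only: lborel_prod)
    also have "\<dots> = (LBINT x. LBINT y. (f x * f y) * (e p x * e p y))"
      using lborel_pair.integral_fst'[symmetric, OF elim[folded lborel_prod]] by simp
    also have "\<dots> = (LBINT x. LBINT y. (f x * e p x) * (f y * e p y))"
      by (simp only: mult_ac)
    also have "\<dots> = (LBINT x. f x * e p x)\<^sup>2"
      by (simp only: integral_mult_right_zero integral_mult_left_zero power2_eq_square)
    finally show ?case .
  qed
  have sqm: "(\<lambda>p. (LBINT x. f x * e p x)\<^sup>2) \<in> borel_measurable lborel"
    by (intro borel_measurable_power lborel.borel_measurable_lebesgue_integral) measurable
  have inm: "(\<lambda>p. LBINT q. (f (fst q) * f (snd q)) * (e p (fst q) * e p (snd q))) \<in> borel_measurable lborel"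
    by (rule borel_measurable_integrable[OF lborel_pair.integrable_snd[OF H']])
  show "integrable lborel (\<lambda>p. (LBINT x. f x * e p x)\<^sup>2)"
    by (rule integrable_cong_AE_imp[OF lborel_pair.integrable_snd[OF H'] sqm]) (rule inner)
  have "(LBINT x. LBINT y. f x * f y * K x y) = (LBINT q. ?F q)"
    using lborel_pair.integral_fst'[OF int] by (simp add: lborel_prod case_prod_beta')
  also have "\<dots> = (LBINT q. LBINT p. (f (fst q) * f (snd q)) * (e p (fst q) * e p (snd q)))"
  proof (rule integral_cong_AE)
    show "?F \<in> borel_measurable lborel" using int' by simp
    show "(\<lambda>q. LBINT p. (f (fst q) * f (snd q)) * (e p (fst q) * e p (snd q))) \<in> borel_measurable lborel"
      by (rule borel_measurable_integrable[OF lborel_pair.integrable_fst[OF H']])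
    show "AE q in lborel. ?F q = (LBINT p. (f (fst q) * f (snd q)) * (e p (fst q) * e p (snd q)))"
      using AE_lborel_fst_neq_snd
    proof eventually_elim
      case (elim q)
      have "(LBINT p. e p (fst q) * e p (snd q)) = enn2real (ennreal (K (fst q) (snd q)))"
        using K[OF elim] by (subst integral_eq_nn_integral) (auto simp: e)
      then show ?case by (simp add: K0)
    qed
  qed
  also have "\<dots> = (LBINT p. LBINT q. (f (fst q) * f (snd q)) * (e p (fst q) * e p (snd q)))"
    by (rule lborel_pair.Fubini_integral[OF H', symmetric])
  also have "\<dots> = (LBINT p. (LBINT x. f x * e p x)\<^sup>2)"
    by (rule integral_cong_AE[OF inm sqm inner])
  finally show "(LBINT x. LBINT y. f x * f y * K x y) = (LBINT p. (LBINT x. f x * e p x)\<^sup>2)" .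
qed

lemma nn_integral_exp_half_line:
  assumes d: "d > (0::real)"
  shows "(\<integral>\<^sup>+s. ennreal (indicator {0..} s * exp (- (s\<^sup>2 * d\<^sup>2))) \<partial>lborel) = ennreal (sqrt pi / 2 / d)"
proof -
  let ?N = "\<integral>\<^sup>+s. ennreal (indicator {0..} s * exp (- (s\<^sup>2 * d\<^sup>2))) \<partial>lborel"
  have "(\<integral>\<^sup>+s. ennreal (indicator {0..} s * exp (- s\<^sup>2)) \<partial>lborel) = ennreal (sqrt pi / 2)"
    using has_bochner_integral_iff[THEN iffD1, OF gaussian_moment_0]
    by (subst nn_integral_eq_integral) auto
  also have "(\<integral>\<^sup>+s. ennreal (indicator {0..} s * exp (- s\<^sup>2)) \<partial>lborel)
      = ennreal \<bar>d\<bar> * (\<integral>\<^sup>+s. ennreal (indicator {0..} (0 + d * s) * exp (- (0 + d * s)\<^sup>2)) \<partial>lborel)"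
    by (rule nn_integral_real_affine) (use d in auto)
  also have "(\<integral>\<^sup>+s. ennreal (indicator {0..} (0 + d * s) * exp (- (0 + d * s)\<^sup>2)) \<partial>lborel) = ?N"
    using d by (intro nn_integral_cong)
      (auto simp: power_mult_distrib zero_le_mult_iff mult.commute split: split_indicator)
  finally have eq: "ennreal d * ?N = ennreal (sqrt pi / 2)" using d by simp
  have "?N = ennreal (1 / d) * (ennreal d * ?N)"
    using d by (simp add: mult.assoc[symmetric] ennreal_mult[symmetric])
  also have "\<dots> = ennreal (sqrt pi / 2 / d)"
    unfolding eq using d by (subst ennreal_mult[symmetric]) (auto simp: field_simps)
  finally show ?thesis .
qed

lemma integrable_gaussian:
  assumes c: "c > (0::real)"
  shows "integrable lborel (\<lambda>x::'a::euclidean_space. exp (- (c * (norm x)\<^sup>2)))"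
proof -
  define \<sigma> where "\<sigma> = sqrt (1 / (2 * c))"
  have \<sigma>: "\<sigma> > 0" "\<sigma>\<^sup>2 = 1 / (2 * c)" using c by (simp_all add: \<sigma>_def)
  have "exp (- (c * t\<^sup>2)) = sqrt (2 * pi * \<sigma>\<^sup>2) * normal_density 0 \<sigma> t" for t
    using c \<sigma> by (simp add: normal_density_def field_simps)
  moreover have "integrable lborel (\<lambda>t. sqrt (2 * pi * \<sigma>\<^sup>2) * normal_density 0 \<sigma> t)"
    using \<sigma>(1) by (intro integrable_mult_right integrable_normal_density)
  ultimately have 1: "integrable lborel (\<lambda>t::real. exp (- (c * t\<^sup>2)))" by simp
  have "(\<integral>\<^sup>+x. ennreal (exp (- (c * (norm x)\<^sup>2))) \<partial>(lborel :: 'a measure))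
    = (\<integral>\<^sup>+x. (\<Prod>b\<in>Basis. ennreal (exp (- (c * (x \<bullet> b)\<^sup>2)))) \<partial>(lborel :: 'a measure))"
  proof (intro nn_integral_cong)
    fix x :: 'a
    have "(norm x)\<^sup>2 = (\<Sum>b\<in>Basis. (x \<bullet> b)\<^sup>2)"
      unfolding power2_norm_eq_inner by (subst euclidean_inner) (simp add: power2_eq_square)
    then have "exp (- (c * (norm x)\<^sup>2)) = (\<Prod>b\<in>Basis. exp (- (c * (x \<bullet> b)\<^sup>2)))"
      by (simp add: exp_sum[symmetric] sum_distrib_left sum_negf)
    then show "ennreal (exp (- (c * (norm x)\<^sup>2))) = (\<Prod>b\<in>Basis. ennreal (exp (- (c * (x \<bullet> b)\<^sup>2))))"
      by (simp add: prod_ennreal)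
  qed
  also have "\<dots> = (\<Prod>b\<in>(Basis :: 'a set). \<integral>\<^sup>+t. ennreal (exp (- (c * t\<^sup>2))) \<partial>lborel)"
    by (rule nn_integral_lborel_prod) auto
  also have "\<dots> = (\<Prod>b\<in>(Basis :: 'a set). ennreal (LBINT t. exp (- (c * t\<^sup>2))))"
    by (subst nn_integral_eq_integral[OF 1]) auto
  also have "\<dots> < \<infinity>" by (simp add: ennreal_power power_less_top_ennreal)
  finally show ?thesis by (intro integrableI_bounded) auto
qed

text \<open>
  This is the total mass of the product of two Gaussians \<open>exp (- 2 s\<^sup>2 |x - z|\<^sup>2)\<close> in the variable \<open>z\<close>, up
  to the factor that depends on the distance of the centres. Normalizing by it avoids computing it.
\<close>

definition gauss_mass :: "real \<Rightarrow> real" where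
  "gauss_mass s = (LBINT z. exp (- (4 * s\<^sup>2 * (norm (z :: real^3))\<^sup>2)))"

lemma gauss_mass_pos:
  assumes "s \<noteq> 0"
  shows "gauss_mass s > 0"
proof -
  have int: "integrable lborel (\<lambda>z::real^3. exp (- (4 * s\<^sup>2 * (norm z)\<^sup>2)))"
    using integrable_gaussian[of "4 * s\<^sup>2"] assms by simp
  have "gauss_mass s \<noteq> 0"
  proof
    assume "gauss_mass s = 0"
    then have "AE z in (lborel :: (real^3) measure). exp (- (4 * s\<^sup>2 * (norm z)\<^sup>2)) = 0"
      unfolding gauss_mass_def by (subst (asm) integral_nonneg_eq_0_iff_AE[OF int]) auto
    then have "AE z in (lborel :: (real^3) measure). False" by simp
    then have "emeasure (lborel :: (real^3) measure) UNIV = 0"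
      by (simp add: AE_iff_null null_sets_def)
    then show False by simp
  qed
  moreover have "gauss_mass s \<ge> 0" unfolding gauss_mass_def by (intro integral_nonneg_AE) simp
  ultimately show ?thesis by simp
qed

text \<open>
  The weight is chosen such that integrating the product of two factors over \<open>z\<close> leaves
  \<open>2 / sqrt \<pi> * exp (- s\<^sup>2 |x - y|\<^sup>2)\<close>, whose integral over \<open>s > 0\<close> is \<open>1 / |x - y|\<close>.
\<close>

definition coulomb_factor :: "real \<times> (real^3) \<Rightarrow> real^3 \<Rightarrow> real" where
  "coulomb_factor p x = (case p of (s, z) \<Rightarrow>
    indicator {0<..} s * (sqrt (2 / (sqrt pi * gauss_mass s)) * exp (- (2 * s\<^sup>2 * (norm (x - z))\<^sup>2))))"

lemma gauss_product:
  fixes x y z :: "'a::real_inner"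
  shows "(norm (x - z))\<^sup>2 + (norm (y - z))\<^sup>2 = (norm (x - y))\<^sup>2 / 2 + 2 * (norm (z - (x + y) /\<^sub>R 2))\<^sup>2"
proof -
  have "(norm ((x - z) + (y - z)))\<^sup>2 + (norm ((x - z) - (y - z)))\<^sup>2 = 2 * (norm (x - z))\<^sup>2 + 2 * (norm (y - z))\<^sup>2"
    by (simp add: power2_norm_eq_inner inner_add_left inner_add_right inner_diff_left inner_diff_right inner_commute)
  moreover have "(x - z) + (y - z) = - 2 *\<^sub>R (z - (x + y) /\<^sub>R 2)"
    by (simp add: algebra_simps scaleR_2)
  moreover have "(norm (- 2 *\<^sub>R (z - (x + y) /\<^sub>R 2)))\<^sup>2 = 4 * (norm (z - (x + y) /\<^sub>R 2))\<^sup>2"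
    by (simp only: norm_scaleR power_mult_distrib) simp
  ultimately show ?thesis by simp
qed

lemma gauss_mass_measurable [measurable]: "gauss_mass \<in> borel_measurable borel"
  unfolding gauss_mass_def[abs_def] by (intro lborel.borel_measurable_lebesgue_integral) measurable

lemma coulomb_factor_nonneg: "0 \<le> coulomb_factor p x"
proof -
  have "0 \<le> gauss_mass s" for s unfolding gauss_mass_def by (intro integral_nonneg_AE) simp
  then show ?thesis by (auto simp: coulomb_factor_def split: prod.split)
qed

lemma coulomb_factor_measurable:
  "(\<lambda>(p, x). coulomb_factor p x) \<in> borel_measurable (borel \<Otimes>\<^sub>M borel)"
proof -
  have "(\<lambda>q. indicator {0<..} (fst (fst q)) * (sqrt (2 / (sqrt pi * gauss_mass (fst (fst q))))
      * exp (- (2 * (fst (fst q))\<^sup>2 * (norm (snd q - snd (fst q)))\<^sup>2))) :: real)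
    \<in> borel_measurable ((borel \<Otimes>\<^sub>M borel) \<Otimes>\<^sub>M (borel :: (real^3) measure))" (is "?f \<in> _")
    by measurable
  moreover have "?f = (\<lambda>(p, x). coulomb_factor p x)"
    by (auto simp: coulomb_factor_def fun_eq_iff)
  ultimately show ?thesis by (simp only: borel_prod)
qed

lemma coulomb_factor_kernel:
  assumes "x \<noteq> y"
  shows "(\<integral>\<^sup>+p. ennreal (coulomb_factor p x * coulomb_factor p y) \<partial>lborel) = ennreal (1 / norm (x - y))"
proof -
  let ?d = "norm (x - y)"
  let ?m = "(x + y) /\<^sub>R 2"
  have cm[measurable]: "(\<lambda>p. coulomb_factor p w) \<in> borel_measurable borel" for w
    using measurable_compose[OF _ coulomb_factor_measurable, of "\<lambda>p. (p, w)" borel] by simp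
  have inner: "(\<integral>\<^sup>+z. ennreal (coulomb_factor (s, z) x * coulomb_factor (s, z) y) \<partial>lborel)
     = ennreal (2 / sqrt pi) * ennreal (indicator {0..} s * exp (- (s\<^sup>2 * ?d\<^sup>2)))" if "s \<noteq> 0" for s
  proof (cases "s > 0")
    case True
    have gm: "gauss_mass s > 0" using gauss_mass_pos[of s] True by simp
    let ?c = "2 / (sqrt pi * gauss_mass s) * exp (- (s\<^sup>2 * ?d\<^sup>2))"
    have "coulomb_factor (s, z) x * coulomb_factor (s, z) y
      = ?c * exp (- (4 * s\<^sup>2 * (norm (z + (- ?m)))\<^sup>2))" for z
    proof -
      have "coulomb_factor (s, z) x * coulomb_factor (s, z) y = (sqrt (2 / (sqrt pi * gauss_mass s)))\<^sup>2
        * (exp (- (2 * s\<^sup>2 * (norm (x - z))\<^sup>2)) * exp (- (2 * s\<^sup>2 * (norm (y - z))\<^sup>2)))"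
        unfolding power2_eq_square[of "sqrt _"] using True by (simp only: coulomb_factor_def prod.case) (simp only: mult_ac indicator_simps greaterThan_iff mult_1)
      also have "(sqrt (2 / (sqrt pi * gauss_mass s)))\<^sup>2 = 2 / (sqrt pi * gauss_mass s)"
        using gm by (intro real_sqrt_pow2) auto
      also have "exp (- (2 * s\<^sup>2 * (norm (x - z))\<^sup>2)) * exp (- (2 * s\<^sup>2 * (norm (y - z))\<^sup>2))
        = exp (- (2 * s\<^sup>2 * ((norm (x - z))\<^sup>2 + (norm (y - z))\<^sup>2)))"
        by (simp add: mult_exp_exp algebra_simps)
      also have "- (2 * s\<^sup>2 * ((norm (x - z))\<^sup>2 + (norm (y - z))\<^sup>2))
        = - (s\<^sup>2 * ?d\<^sup>2) + - (4 * s\<^sup>2 * (norm (z + (- ?m)))\<^sup>2)"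
        unfolding gauss_product by (simp add: algebra_simps)
      also have "exp (- (s\<^sup>2 * ?d\<^sup>2) + - (4 * s\<^sup>2 * (norm (z + (- ?m)))\<^sup>2))
        = exp (- (s\<^sup>2 * ?d\<^sup>2)) * exp (- (4 * s\<^sup>2 * (norm (z + (- ?m)))\<^sup>2))"
        by (rule exp_add)
      finally show ?thesis by (simp only: mult.assoc)
    qed
    moreover have "ennreal (?c * exp (- (4 * s\<^sup>2 * (norm (z + (- ?m)))\<^sup>2)))
        = ennreal ?c * ennreal (exp (- (4 * s\<^sup>2 * (norm (z + (- ?m)))\<^sup>2)))" for z :: "real^3"
      by (rule ennreal_mult) (use gm in auto)
    ultimately have "(\<integral>\<^sup>+z. ennreal (coulomb_factor (s, z) x * coulomb_factor (s, z) y) \<partial>lborel)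
      = (\<integral>\<^sup>+z. ennreal ?c * ennreal (exp (- (4 * s\<^sup>2 * (norm (z + (- ?m)))\<^sup>2))) \<partial>lborel)"
      by (simp only:)
    also have "\<dots> = ennreal ?c * (\<integral>\<^sup>+z. ennreal (exp (- (4 * s\<^sup>2 * (norm (z + (- ?m)))\<^sup>2))) \<partial>lborel)"
      by (rule nn_integral_cmult) measurable
    also have "(\<integral>\<^sup>+z. ennreal (exp (- (4 * s\<^sup>2 * (norm (z + (- ?m)))\<^sup>2))) \<partial>lborel)
      = (\<integral>\<^sup>+z. ennreal (exp (- (4 * s\<^sup>2 * (norm (z::real^3))\<^sup>2))) \<partial>lborel)"
      by (rule nn_integral_lborel_translate[of "\<lambda>z. ennreal (exp (- (4 * s\<^sup>2 * (norm z)\<^sup>2)))" "- ?m"]) measurable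
    also have "\<dots> = ennreal (gauss_mass s)"
      unfolding gauss_mass_def using integrable_gaussian[of "4 * s\<^sup>2"] True
      by (intro nn_integral_eq_integral) auto
    also have "ennreal ?c * ennreal (gauss_mass s) = ennreal (2 / sqrt pi * exp (- (s\<^sup>2 * ?d\<^sup>2)))"
      using gm by (subst ennreal_mult[symmetric]) (auto simp: field_simps)
    also have "\<dots> = ennreal (2 / sqrt pi) * ennreal (indicator {0..} s * exp (- (s\<^sup>2 * ?d\<^sup>2)))"
      using True by (subst ennreal_mult) auto
    finally show ?thesis .
  next
    case False
    with that show ?thesis by (simp add: coulomb_factor_def)
  qed
  have "(\<integral>\<^sup>+p. ennreal (coulomb_factor p x * coulomb_factor p y) \<partial>lborel)
    = (\<integral>\<^sup>+p. ennreal (coulomb_factor p x * coulomb_factor p y) \<partial>(lborel \<Otimes>\<^sub>M lborel))"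
    by (simp only: lborel_prod)
  also have "\<dots> = (\<integral>\<^sup>+s. \<integral>\<^sup>+z. ennreal (coulomb_factor (s, z) x * coulomb_factor (s, z) y) \<partial>lborel \<partial>lborel)"
    by (rule lborel.nn_integral_fst[symmetric]) (simp add: lborel_prod)
  also have "\<dots> = (\<integral>\<^sup>+s. ennreal (2 / sqrt pi) * ennreal (indicator {0..} s * exp (- (s\<^sup>2 * ?d\<^sup>2))) \<partial>lborel)"
    using AE_lborel_singleton[of "0::real"] by (intro nn_integral_cong_AE) (auto elim!: eventually_mono simp: inner)
  also have "\<dots> = ennreal (2 / sqrt pi) * ennreal (sqrt pi / 2 / ?d)"
    using assms by (subst nn_integral_cmult) (simp_all add: nn_integral_exp_half_line)
  also have "\<dots> = ennreal (1 / ?d)"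
    by (subst ennreal_mult[symmetric]) auto
  finally show ?thesis .
qed

lemma integral_lborel_affine:
  fixes f :: "'a::euclidean_space \<Rightarrow> real"
  assumes [measurable]: "f \<in> borel_measurable borel" and c: "c \<noteq> 0"
  shows "(LBINT x. f x) = \<bar>c\<bar> ^ DIM('a) * (LBINT x. f (t + c *\<^sub>R x))"
proof -
  have "(LBINT x. f x)
      = integral\<^sup>L (density (distr lborel borel (\<lambda>x. t + c *\<^sub>R x)) (\<lambda>_. ennreal (\<bar>c\<bar> ^ DIM('a)))) f"
    using lborel_affine[OF c, of t] by (simp add: ennreal_power)
  also have "\<dots> = \<bar>c\<bar> ^ DIM('a) * (LBINT x. f (t + c *\<^sub>R x))"
    by (subst integral_density) (simp_all add: integral_distr)
  finally show ?thesis .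
qed

text \<open>
  Gaussian averages of \<open>f\<close> tested against \<open>\<phi>\<close> are \<open>f\<close> tested against Gaussian averages \<open>\<Psi> n\<close> of \<open>\<phi>\<close>. The
  scaling \<open>z = x + y / s n\<close> shows that the latter tend to a positive multiple of \<open>\<phi>\<close> as the Gaussians
  concentrate.
\<close>

lemma gauss_transform_zero_imp_test_zero:
  fixes f \<phi> :: "real^3 \<Rightarrow> real"
  assumes f: "integrable lborel f" and \<phi>c: "continuous_on UNIV \<phi>" and \<phi>b: "\<And>x. \<bar>\<phi> x\<bar> \<le> B"
    and s: "\<And>n. s n > (0::real)" "filterlim s at_top sequentially"
    and zero: "\<And>n. AE z in lborel. (LBINT x. f x * exp (- (2 * (s n)\<^sup>2 * (norm (x - z))\<^sup>2))) = 0"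
  shows "(LBINT x. \<phi> x * f x) = 0"
proof -
  let ?E = "\<lambda>y::real^3. exp (- (2 * (norm y)\<^sup>2))"
  define M where "M = (LBINT y. ?E y)"
  have [measurable]: "f \<in> borel_measurable borel" "\<phi> \<in> borel_measurable borel"
    using f \<phi>c by (auto intro: borel_measurable_continuous_onI)
  have E: "integrable lborel ?E" by (rule integrable_gaussian) simp
  have B: "B \<ge> 0" using \<phi>b[of 0] by linarith
  define \<Psi> where "\<Psi> n x = (LBINT y. \<phi> (x + (1 / s n) *\<^sub>R y) * ?E y)" for n x
  have \<Psi>m[measurable]: "\<Psi> n \<in> borel_measurable borel" for n
    unfolding \<Psi>_def[abs_def] by (intro lborel.borel_measurable_lebesgue_integral) measurable
  have bE: "integrable lborel (\<lambda>y. B * ?E y)" using E by simp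
  have bd: "norm (\<phi> w * ?E y) \<le> B * ?E y" for w y
    using mult_right_mono[OF \<phi>b[of w], of "?E y"] by (simp add: abs_mult)
  have \<Psi>b: "\<bar>\<Psi> n x\<bar> \<le> B * M" for n x
  proof -
    have "norm (\<Psi> n x) \<le> (LBINT y. norm (\<phi> (x + (1 / s n) *\<^sub>R y) * ?E y))"
      unfolding \<Psi>_def by (rule integral_norm_bound)
    also have "\<dots> \<le> (LBINT y. B * ?E y)"
    proof (rule integral_mono)
      show "integrable lborel (\<lambda>y. norm (\<phi> (x + (1 / s n) *\<^sub>R y) * ?E y))"
        by (rule integrable_norm, rule Bochner_Integration.integrable_bound[OF bE])
          (use bd B in \<open>auto simp: abs_mult\<close>)
    qed (use bE bd in auto)
    finally show ?thesis by (simp add: M_def)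
  qed
  have \<Psi>lim: "(\<lambda>n. \<Psi> n x) \<longlonglongrightarrow> \<phi> x * M" for x
  proof -
    have "(\<lambda>n. \<Psi> n x) \<longlonglongrightarrow> (LBINT y. \<phi> x * ?E y)"
      unfolding \<Psi>_def
    proof (rule integral_dominated_convergence[where w="\<lambda>y. B * ?E y"])
      show "AE y in lborel. (\<lambda>n. \<phi> (x + (1 / s n) *\<^sub>R y) * ?E y) \<longlonglongrightarrow> \<phi> x * ?E y"
      proof (rule AE_I2)
        fix y
        have "(\<lambda>n. 1 / s n) \<longlonglongrightarrow> 0"
          using tendsto_inverse_0_at_top[OF s(2)] by (simp add: inverse_eq_divide)
        then have "(\<lambda>n. x + (1 / s n) *\<^sub>R y) \<longlonglongrightarrow> x + 0 *\<^sub>R y" by (intro tendsto_intros)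
        then have "(\<lambda>n. x + (1 / s n) *\<^sub>R y) \<longlonglongrightarrow> x" by simp
        moreover have "isCont \<phi> x" using \<phi>c by (simp add: continuous_on_eq_continuous_at)
        ultimately have "(\<lambda>n. \<phi> (x + (1 / s n) *\<^sub>R y)) \<longlonglongrightarrow> \<phi> x"
          using isCont_tendsto_compose by blast
        then show "(\<lambda>n. \<phi> (x + (1 / s n) *\<^sub>R y) * ?E y) \<longlonglongrightarrow> \<phi> x * ?E y"
          by (rule tendsto_mult_right)
      qed
    qed (use bE bd in auto)
    then show ?thesis by (simp add: M_def)
  qed
  have \<Psi>zero: "(LBINT x. f x * \<Psi> n x) = 0" for n
  proof -
    let ?g = "\<lambda>x z. exp (- (2 * (s n)\<^sup>2 * (norm (x - z))\<^sup>2))"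
    have sub: "(LBINT z. \<phi> z * ?g x z) = \<bar>1 / s n\<bar> ^ 3 * \<Psi> n x" for x
    proof -
      have e1: "(LBINT z. \<phi> z * ?g x z) = \<bar>1 / s n\<bar> ^ DIM(real^3)
          * (LBINT y. \<phi> (x + (1 / s n) *\<^sub>R y) * ?g x (x + (1 / s n) *\<^sub>R y))"
        by (rule integral_lborel_affine) (use s(1)[of n] in auto)
      have e2: "?g x (x + (1 / s n) *\<^sub>R y) = ?E y" for y
        using s(1)[of n] by (simp add: power_divide)
      show ?thesis unfolding e1 e2 \<Psi>_def by simp
    qed
    let ?k = "\<lambda>z::real^3. exp (- (2 * (s n)\<^sup>2 * (norm z)\<^sup>2))"
    have gi: "integrable lborel ?k"
      by (rule integrable_gaussian) (use s(1)[of n] in simp)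
    have pint: "integrable (lborel \<Otimes>\<^sub>M lborel) (\<lambda>(x, z). f x * (\<phi> z * ?g x z))"
    proof (rule integrableI_bounded)
      show "(\<lambda>(x, z). f x * (\<phi> z * ?g x z)) \<in> borel_measurable (lborel \<Otimes>\<^sub>M lborel)" by measurable
      have "(\<integral>\<^sup>+q. ennreal (norm (case q of (x, z) \<Rightarrow> f x * (\<phi> z * ?g x z))) \<partial>(lborel \<Otimes>\<^sub>M lborel))
        = (\<integral>\<^sup>+x. \<integral>\<^sup>+z. ennreal (norm (f x * (\<phi> z * ?g x z))) \<partial>lborel \<partial>lborel)"
        by (subst lborel.nn_integral_fst[symmetric]) auto
      also have "\<dots> \<le> (\<integral>\<^sup>+x. \<integral>\<^sup>+z. ennreal (\<bar>f x\<bar> * B) * ennreal (?k (z + (- x))) \<partial>lborel \<partial>lborel)"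
      proof (intro nn_integral_mono)
        fix x z
        have "\<bar>f x\<bar> * (\<bar>\<phi> z\<bar> * ?g x z) \<le> \<bar>f x\<bar> * (B * ?g x z)"
          by (intro mult_left_mono mult_right_mono \<phi>b) auto
        then show "ennreal (norm (f x * (\<phi> z * ?g x z)))
          \<le> ennreal (\<bar>f x\<bar> * B) * ennreal (?k (z + (- x)))"
          using B by (subst ennreal_mult[symmetric])
            (auto simp: abs_mult norm_minus_commute mult.assoc intro!: ennreal_leI)
      qed
      also have "\<dots> = (\<integral>\<^sup>+x. ennreal (\<bar>f x\<bar> * B) * ennreal (LBINT z. ?k z) \<partial>lborel)"
      proof (intro nn_integral_cong)
        fix x :: "real^3"
        have "(\<integral>\<^sup>+z. ennreal (?k (z + (- x))) \<partial>lborel)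
          = (\<integral>\<^sup>+z. ennreal (?k z) \<partial>lborel)"
          by (rule nn_integral_lborel_translate[of "\<lambda>z. ennreal (?k z)" "- x"]) measurable
        also have "\<dots> = ennreal (LBINT z. ?k z)"
          by (rule nn_integral_eq_integral[OF gi]) simp
        finally show "(\<integral>\<^sup>+z. ennreal (\<bar>f x\<bar> * B) * ennreal (?k (z + (- x))) \<partial>lborel)
          = ennreal (\<bar>f x\<bar> * B) * ennreal (LBINT z. ?k z)"
          by (subst nn_integral_cmult) simp_all
      qed
      also have "\<dots> = (\<integral>\<^sup>+x. ennreal (\<bar>f x\<bar> * B) \<partial>lborel) * ennreal (LBINT z. ?k z)"
        by (rule nn_integral_multc) measurable
      also have "(\<integral>\<^sup>+x. ennreal (\<bar>f x\<bar> * B) \<partial>lborel) = ennreal (LBINT x. \<bar>f x\<bar> * B)"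
        using f B by (intro nn_integral_eq_integral) auto
      also have "\<dots> * ennreal (LBINT z. ?k z) < \<infinity>"
        by (simp add: ennreal_mult_less_top)
      finally show "(\<integral>\<^sup>+q. ennreal (norm (case q of (x, z) \<Rightarrow> f x * (\<phi> z * ?g x z))) \<partial>(lborel \<Otimes>\<^sub>M lborel)) < \<infinity>" .
    qed
    have "(LBINT z. LBINT x. f x * (\<phi> z * ?g x z)) = (LBINT x. LBINT z. f x * (\<phi> z * ?g x z))"
      by (rule lborel_pair.Fubini_integral[OF pint])
    also have "\<dots> = \<bar>1 / s n\<bar> ^ 3 * (LBINT x. f x * \<Psi> n x)"
    proof -
      have "(LBINT z. f x * (\<phi> z * ?g x z)) = \<bar>1 / s n\<bar> ^ 3 * (f x * \<Psi> n x)" for x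
        unfolding integral_mult_right_zero sub by (rule mult.left_commute)
      then show ?thesis by (simp only: integral_mult_right_zero)
    qed
    also have "(LBINT z. LBINT x. f x * (\<phi> z * ?g x z)) = 0"
    proof (rule integral_eq_zero_AE)
      show "AE z in lborel. (LBINT x. f x * (\<phi> z * ?g x z)) = 0"
        using zero[of n]
      proof eventually_elim
        case (elim z)
        have "(LBINT x. f x * (\<phi> z * ?g x z)) = \<phi> z * (LBINT x. f x * ?g x z)"
          by (simp only: integral_mult_right_zero[symmetric] mult.left_commute)
        with elim show ?case by simp
      qed
    qed
    finally show ?thesis using s(1)[of n] by simp
  qed
  have "(\<lambda>n. LBINT x. f x * \<Psi> n x) \<longlonglongrightarrow> (LBINT x. f x * (\<phi> x * M))"
  proof (rule integral_dominated_convergence[where w="\<lambda>x. \<bar>f x\<bar> * (B * M)"])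
    show "AE x in lborel. (\<lambda>n. f x * \<Psi> n x) \<longlonglongrightarrow> f x * (\<phi> x * M)"
      by (intro AE_I2 tendsto_mult_left \<Psi>lim)
    show "AE x in lborel. norm (f x * \<Psi> n x) \<le> \<bar>f x\<bar> * (B * M)" for n
      unfolding real_norm_def abs_mult by (intro AE_I2 mult_left_mono \<Psi>b) simp
  qed (use f in auto)
  then have "(LBINT x. f x * (\<phi> x * M)) = 0"
    unfolding \<Psi>zero using LIMSEQ_unique tendsto_const by blast
  moreover have "(LBINT x. f x * (\<phi> x * M)) = (LBINT x. \<phi> x * f x) * M"
    unfolding integral_mult_left_zero[symmetric] by (simp only: mult_ac)
  moreover have "M > 0"
  proof -
    have "M = gauss_mass (1 / sqrt 2)" by (simp add: M_def gauss_mass_def power_divide)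
    then show ?thesis using gauss_mass_pos[of "1 / sqrt 2"] by simp
  qed
  ultimately show ?thesis by simp
qed

text \<open>
  If the integral of the squares vanishes, then so do almost all Gaussian averages; in particular
  there are arbitrarily narrow Gaussians for which the averages vanish for almost every centre.
\<close>

theorem coulomb_positive_definite:
  fixes f :: "real^3 \<Rightarrow> real"
  assumes f: "integrable lborel f"
    and int: "integrable (lborel \<Otimes>\<^sub>M lborel) (\<lambda>(x, y). f x * f y / norm (x - y))"
    and le: "coulomb f \<le> 0"
  shows "AE x in lborel. f x = 0"
proof -
  have [measurable]: "f \<in> borel_measurable borel" using f by auto
  let ?T = "\<lambda>p. LBINT x. f x * coulomb_factor p x"
  have int': "integrable (lborel \<Otimes>\<^sub>M lborel) (\<lambda>(x, y). f x * f y * (1 / norm (x - y)))"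
    using int by simp
  note form = positive_kernel_form[of f coulomb_factor "\<lambda>x y. 1 / norm (x - y)",
      OF _ coulomb_factor_measurable coulomb_factor_nonneg coulomb_factor_kernel _ int']
  have i: "integrable lborel (\<lambda>p. (?T p)\<^sup>2)" by (rule form(1)) auto
  have "coulomb f = (LBINT x. LBINT y. f x * f y * (1 / norm (x - y)))"
    by (simp add: coulomb_def)
  also have "\<dots> = (LBINT p. (?T p)\<^sup>2)" by (rule form(2)) auto
  finally have "(LBINT p. (?T p)\<^sup>2) \<le> 0" using le by simp
  moreover have "0 \<le> (LBINT p. (?T p)\<^sup>2)" by (intro integral_nonneg_AE) simp
  ultimately have "(LBINT p. (?T p)\<^sup>2) = 0" by simp
  then have "AE p in lborel. (?T p)\<^sup>2 = 0"
    using integral_nonneg_eq_0_iff_AE[OF i] by simp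
  then have "AE p in lborel. ?T p = 0" by simp
  then have "AE p in lborel \<Otimes>\<^sub>M lborel. ?T p = 0" by (simp only: lborel_prod)
  from lborel_pair.AE_pair[OF this] have AEs: "AE s in lborel. AE z in lborel. ?T (s, z) = 0" .
  \<comment> \<open>Almost every width is admissible, so some admissible width lies in each interval.\<close>
  have "\<exists>s>real n. AE z in lborel. ?T (s, z) = 0" for n
  proof (rule ccontr)
    assume "\<not> (\<exists>s>real n. AE z in lborel. ?T (s, z) = 0)"
    with AEs have "AE s in lborel. s \<notin> {real n<..<real n + 1}"
      by (auto elim!: eventually_mono)
    then have "{real n<..<real n + 1} \<in> null_sets lborel"
      by (subst AE_iff_null_sets) auto
    then have "emeasure lborel {real n<..<real n + 1} = 0" by blast
    then show False by simp
  qed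
  then have "\<forall>n. \<exists>s. s > real n \<and> (AE z in lborel. ?T (s, z) = 0)" ..
  then obtain s where s': "\<forall>n. s n > real n \<and> (AE z in lborel. ?T (s n, z) = 0)"
    using choice[of "\<lambda>n s. s > real n \<and> (AE z in lborel. ?T (s, z) = 0)"] by auto
  have s: "s n > real n" "AE z in lborel. ?T (s n, z) = 0" for n
    using spec[OF s', of n] by auto
  have spos: "s n > 0" for n using s(1)[of n] by (rule le_less_trans[rotated]) simp
  have slim: "filterlim s at_top sequentially"
    by (rule filterlim_at_top_mono[OF filterlim_real_sequentially]) (intro always_eventually allI less_imp_le s(1))
  have zero: "AE z in lborel. (LBINT x. f x * exp (- (2 * (s n)\<^sup>2 * (norm (x - z))\<^sup>2))) = 0" for n
    using s(2)[of n]
  proof eventually_elim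
    case (elim z)
    let ?c = "sqrt (2 / (sqrt pi * gauss_mass (s n)))"
    have c: "?c \<noteq> 0" using gauss_mass_pos[of "s n"] spos[of n] by simp
    have "?T (s n, z) = ?c * (LBINT x. f x * exp (- (2 * (s n)\<^sup>2 * (norm (x - z))\<^sup>2)))"
      unfolding integral_mult_right_zero[symmetric] using spos[of n]
      by (intro Bochner_Integration.integral_cong) (auto simp: coulomb_factor_def)
    then have "?c * (LBINT x. f x * exp (- (2 * (s n)\<^sup>2 * (norm (x - z))\<^sup>2))) = 0"
      unfolding elim by (rule sym)
    with c show ?case unfolding mult_eq_0_iff by blast
  qed
  show ?thesis
  proof (rule AE_zero_if_box_bump_integrals_zero)
    show "locally_integrable f"
      unfolding locally_integrable_def set_integrable_def
    proof (intro allI impI integrable_mult_indicator f)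
      fix K :: "(real^3) set" assume "compact K"
      then show "K \<in> sets lborel" using borel_closed[OF compact_imp_closed] by simp
    qed
    show "(LBINT x. box_bump n a b x * f x) = 0" for n a b
      by (rule gauss_transform_zero_imp_test_zero[OF f continuous_on_box_bump _ spos slim zero, of _ _ _ 1])
        (simp add: abs_of_nonneg box_bump_nonneg box_bump_le_1)
  qed
qed

section \<open>Weak gradients of complex functions\<close>

lemma locally_integrable_bounded_linear:
  fixes f :: "real^3 \<Rightarrow> 'b::euclidean_space" and T :: "'b \<Rightarrow> 'c::euclidean_space"
  assumes f: "locally_integrable f" and T: "bounded_linear T"
  shows "locally_integrable (\<lambda>x. T (f x))"
  unfolding locally_integrable_def set_integrable_def
proof (intro allI impI)
  fix K :: "(real^3) set" assume "compact K"
  then have "integrable lborel (\<lambda>x. indicator K x *\<^sub>R f x)"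
    using f by (auto simp: locally_integrable_def set_integrable_def)
  from integrable_bounded_linear[OF T this]
  show "integrable lborel (\<lambda>x. indicator K x *\<^sub>R T (f x))"
    by (simp add: linear_cmul[OF bounded_linear.linear[OF T]])
qed

lemma locally_integrable_diff:
  fixes f g :: "real^3 \<Rightarrow> 'b::euclidean_space"
  assumes "locally_integrable f" "locally_integrable g"
  shows "locally_integrable (\<lambda>x. f x - g x)"
  using assms by (auto simp: locally_integrable_def set_integrable_def scaleR_diff_right)

lemma integrable_compact_support_mult:
  fixes f :: "real^3 \<Rightarrow> 'b::euclidean_space"
  assumes f: "locally_integrable f"
    and \<psi>: "continuous_on UNIV \<psi>" "compact K" "\<And>x. x \<notin> K \<Longrightarrow> \<psi> x = (0::real)"
  shows "integrable lborel (\<lambda>x. \<psi> x *\<^sub>R f x)"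
proof -
  obtain B where B: "\<And>x. \<bar>\<psi> x\<bar> \<le> B" using continuous_compact_support_bounded[OF \<psi>] by auto
  have [measurable]: "f \<in> borel_measurable borel" "\<psi> \<in> borel_measurable borel"
    using locally_integrable_measurable[OF f] \<psi>(1) by (auto intro: borel_measurable_continuous_onI)
  have i: "integrable lborel (\<lambda>x. B *\<^sub>R (indicator K x *\<^sub>R f x))"
    using f \<psi>(2) by (intro integrable_scaleR_right) (simp add: locally_integrable_def set_integrable_def)
  show ?thesis
  proof (rule Bochner_Integration.integrable_bound[OF i])
    show "AE x in lborel. norm (\<psi> x *\<^sub>R f x) \<le> norm (B *\<^sub>R (indicator K x *\<^sub>R f x))"
    proof (rule AE_I2)
      fix x
      have "\<bar>\<psi> x\<bar> \<le> \<bar>B\<bar>" using B[of x] by simp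
      then show "norm (\<psi> x *\<^sub>R f x) \<le> norm (B *\<^sub>R (indicator K x *\<^sub>R f x))"
        using \<psi>(3)[of x] by (cases "x \<in> K") (simp_all add: mult_right_mono)
    qed
  qed measurable
qed

lemma integrable_test_mult:
  fixes f :: "real^3 \<Rightarrow> 'b::euclidean_space"
  assumes f: "locally_integrable f" and \<phi>: "test_function \<phi>"
  shows "integrable lborel (\<lambda>x. \<phi> x *\<^sub>R f x)" "integrable lborel (\<lambda>x. partial_deriv i \<phi> x *\<^sub>R f x)"
proof -
  obtain K where K: "compact K" "\<And>x. x \<notin> K \<Longrightarrow> \<phi> x = 0" "\<And>x i. x \<notin> K \<Longrightarrow> partial_deriv i \<phi> x = 0"
    using test_function_support[OF \<phi>] by auto
  show "integrable lborel (\<lambda>x. \<phi> x *\<^sub>R f x)"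
    by (rule integrable_compact_support_mult[OF f test_function_continuous[OF \<phi>] K(1,2)])
  show "integrable lborel (\<lambda>x. partial_deriv i \<phi> x *\<^sub>R f x)"
    by (rule integrable_compact_support_mult[OF f test_function_continuous_partial[OF \<phi>] K(1,3)])
qed

text \<open>
  The fundamental lemma is applied to the real and imaginary part of each component of the
  difference. Uniqueness is what gives the norm of a chosen weak gradient its meaning.
\<close>

theorem weak_gradient_unique:
  assumes G: "has_weak_gradient f G" and H: "has_weak_gradient f H"
  shows "AE x in lborel. G x = H x"
proof -
  have part: "AE x in lborel. T (G x $ i) = T (H x $ i)"
    if T: "bounded_linear T" for T :: "complex \<Rightarrow> real" and i
  proof -
    let ?D = "\<lambda>x. G x $ i - H x $ i"
    have "locally_integrable G" "locally_integrable H"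
      using G H unfolding has_weak_gradient_def by blast+
    note Gl = locally_integrable_bounded_linear[OF this(1) bounded_linear_vec_nth[of i]]
      and Hl = locally_integrable_bounded_linear[OF this(2) bounded_linear_vec_nth[of i]]
    have D: "locally_integrable ?D" by (rule locally_integrable_diff[OF Gl Hl])
    have "AE x in lborel. T (?D x) = 0"
    proof (rule AE_zero_if_box_bump_integrals_zero)
      show "locally_integrable (\<lambda>x. T (?D x))" by (rule locally_integrable_bounded_linear[OF D T])
      fix n a b
      let ?\<phi> = "box_bump n a b"
      note \<phi> = test_function_box_bump[of n a b]
      have "(LBINT x. ?\<phi> x *\<^sub>R ?D x) = (LBINT x. ?\<phi> x *\<^sub>R (G x $ i)) - (LBINT x. ?\<phi> x *\<^sub>R (H x $ i))"
        unfolding scaleR_diff_right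
        by (rule Bochner_Integration.integral_diff[OF integrable_test_mult(1)[OF Gl \<phi>] integrable_test_mult(1)[OF Hl \<phi>]])
      also have "\<dots> = 0"
      proof -
        have "- (LBINT x. ?\<phi> x *\<^sub>R (G x $ i)) = - (LBINT x. ?\<phi> x *\<^sub>R (H x $ i))"
          using conjunct2[OF conjunct2[OF G[unfolded has_weak_gradient_def]], rule_format, OF \<phi>, of i]
            conjunct2[OF conjunct2[OF H[unfolded has_weak_gradient_def]], rule_format, OF \<phi>, of i]
          by (rule trans[OF sym])
        then show ?thesis by simp
      qed
      finally have "T (LBINT x. ?\<phi> x *\<^sub>R ?D x) = 0"
        by (simp add: linear_0[OF bounded_linear.linear[OF T]])
      also have "T (LBINT x. ?\<phi> x *\<^sub>R ?D x) = (LBINT x. T (?\<phi> x *\<^sub>R ?D x))"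
        by (rule integral_bounded_linear[OF T integrable_test_mult(1)[OF D \<phi>], symmetric])
      also have "(\<lambda>x. T (?\<phi> x *\<^sub>R ?D x)) = (\<lambda>x. ?\<phi> x * T (?D x))"
        using linear_cmul[OF bounded_linear.linear[OF T]] by auto
      finally show "(LBINT x. ?\<phi> x * T (?D x)) = 0" .
    qed
    then show ?thesis
      by eventually_elim (simp add: linear_diff[OF bounded_linear.linear[OF T]])
  qed
  have "AE x in lborel. \<forall>i\<in>UNIV. Re (G x $ i) = Re (H x $ i) \<and> Im (G x $ i) = Im (H x $ i)"
    using part[OF bounded_linear_Re] part[OF bounded_linear_Im] by (intro AE_finite_allI) auto
  then show ?thesis by eventually_elim (simp add: vec_eq_iff complex_eq_iff)
qed

lemma has_weak_gradient_measurable: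
  "has_weak_gradient f G \<Longrightarrow> G \<in> borel_measurable borel"
  unfolding has_weak_gradient_def by (blast intro: locally_integrable_measurable)

lemma L2_norm_weak_gradient:
  assumes G: "has_weak_gradient f G"
  shows "(L2_norm (weak_gradient f))\<^sup>2 = (LBINT x. (norm (G x))\<^sup>2)"
proof -
  have W: "has_weak_gradient f (weak_gradient f)"
    unfolding weak_gradient_def by (rule someI[of "has_weak_gradient f", OF G])
  note [measurable] = has_weak_gradient_measurable[OF G] has_weak_gradient_measurable[OF W]
  have "(LBINT x. (norm (weak_gradient f x))\<^sup>2) = (LBINT x. (norm (G x))\<^sup>2)"
    using weak_gradient_unique[OF W G] by (intro integral_cong_AE) (auto elim: eventually_mono)
  moreover have "0 \<le> (LBINT x. (norm (G x))\<^sup>2)" by (intro integral_nonneg_AE) simp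
  ultimately show ?thesis by (simp add: L2_norm_def)
qed

lemma norm_complex_vec_power2: "(norm (v :: complex^3))\<^sup>2 = (\<Sum>i\<in>UNIV. (norm (v $ i))\<^sup>2)"
  by (simp add: norm_vec_def L2_set_def sum_nonneg)

section \<open>Comparison with the quadratic mean\<close>

definition real_sobolev :: "(real^3 \<Rightarrow> real) \<Rightarrow> (3 \<Rightarrow> real^3 \<Rightarrow> real) \<Rightarrow> bool" where
  "real_sobolev w g \<longleftrightarrow> w \<in> L2 \<and> (\<forall>i. g i \<in> L2 \<and> weak_partial i w (g i))"

lemma L2_cong_AE:
  fixes f g :: "real^3 \<Rightarrow> real"
  assumes "f \<in> L2" "g \<in> borel_measurable borel" "AE x in lborel. f x = g x"
  shows "g \<in> L2"
proof -
  have [measurable]: "f \<in> borel_measurable borel" "g \<in> borel_measurable borel"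
    using assms by (auto simp: L2_def)
  have "integrable lborel (\<lambda>x. (g x)\<^sup>2)"
    by (rule integrable_cong_AE_imp[of _ "\<lambda>x. (f x)\<^sup>2"])
      (use assms in \<open>auto simp: L2_real_iff elim: eventually_mono\<close>)
  then show ?thesis by (simp add: L2_real_iff)
qed

text \<open>
  A representative that is positive everywhere, not only almost everywhere, makes the quadratic mean
  positive everywhere and its difference quotients defined at each point. Passing to real parts can
  only decrease the norm of the gradient.
\<close>

lemma positive_H1_real_sobolev:
  assumes u: "u \<in> H1" and pos: "positive_ae u"
  shows "\<exists>w g. real_sobolev w g \<and> (\<forall>x. w x > 0) \<and> (AE x in lborel. u x = of_real (w x)) \<and>
    (LBINT x. (\<Sum>i\<in>UNIV. (g i x)\<^sup>2)) \<le> (L2_norm (weak_gradient u))\<^sup>2"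
proof -
  obtain G where uL2: "u \<in> L2" and GL2: "G \<in> L2" and uG: "has_weak_gradient u G"
    using u by (auto simp: H1_def)
  have um[measurable]: "u \<in> borel_measurable borel" and Gm[measurable]: "G \<in> borel_measurable borel"
    using uL2 GL2 by (simp_all add: L2_def)
  have ui: "integrable lborel (\<lambda>x. (norm (u x))\<^sup>2)" and Gi: "integrable lborel (\<lambda>x. (norm (G x))\<^sup>2)"
    using uL2 GL2 by (simp_all add: L2_def)
  define g where "g i x = Re (G x $ i)" for i x
  have cm[measurable]: "(\<lambda>x. G x $ i) \<in> borel_measurable borel" for i
    by (rule measurable_compose[OF Gm]) (intro borel_measurable_continuous_onI continuous_intros)
  have gm[measurable]: "g i \<in> borel_measurable borel" for i unfolding g_def[abs_def] by measurable
  have gG: "(\<Sum>i\<in>UNIV. (g i x)\<^sup>2) \<le> (norm (G x))\<^sup>2" for x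
    unfolding norm_complex_vec_power2 g_def
    by (intro sum_mono) (simp add: cmod_power2)
  have g1: "(g i x)\<^sup>2 \<le> (norm (G x))\<^sup>2" for i x
    by (rule order_trans[OF _ gG]) (rule member_le_sum, auto)
  have gL2: "g i \<in> L2" for i
  proof -
    have "integrable lborel (\<lambda>x. (g i x)\<^sup>2)"
      by (rule Bochner_Integration.integrable_bound[OF Gi]) (use g1 in auto)
    then show ?thesis by (simp add: L2_real_iff)
  qed
  \<comment> \<open>Any positive value would do on the null set where \<open>u\<close> is not positive.\<close>
  define w where "w x = (if Re (u x) > 0 then Re (u x) else 1)" for x
  have wm[measurable]: "w \<in> borel_measurable borel" unfolding w_def[abs_def] by measurable
  have wu: "AE x in lborel. u x = of_real (w x)"
    using pos unfolding positive_ae_def by eventually_elim (simp add: w_def complex_eq_iff)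
  have Rew: "AE x in lborel. Re (u x) = w x" using wu by eventually_elim simp
  have "(\<lambda>x. Re (u x)) \<in> L2"
  proof -
    have "integrable lborel (\<lambda>x. (Re (u x))\<^sup>2)"
      by (rule Bochner_Integration.integrable_bound[OF ui]) (auto simp: cmod_power2)
    then show ?thesis by (simp add: L2_real_iff)
  qed
  then have wL2: "w \<in> L2" by (rule L2_cong_AE[OF _ wm Rew])
  have "weak_partial i w (g i)" for i
    unfolding weak_partial_def
  proof (intro allI impI)
    fix \<phi> assume \<phi>: "test_function \<phi>"
    note [measurable] = test_function_partial_measurable[OF \<phi>, of i]
    have ul: "locally_integrable u" and Gl: "locally_integrable G"
      using uG by (auto simp: has_weak_gradient_def)
    have Gil: "locally_integrable (\<lambda>x. G x $ i)"
      by (rule locally_integrable_bounded_linear[OF Gl bounded_linear_vec_nth])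
    have "(LBINT x. partial_deriv i \<phi> x * w x) = (LBINT x. Re (partial_deriv i \<phi> x *\<^sub>R u x))"
      using Rew by (intro integral_cong_AE) (auto elim: eventually_mono)
    also have "\<dots> = Re (LBINT x. partial_deriv i \<phi> x *\<^sub>R u x)"
      by (rule integral_bounded_linear[OF bounded_linear_Re integrable_test_mult(2)[OF ul \<phi>]])
    also have "(LBINT x. partial_deriv i \<phi> x *\<^sub>R u x) = - (LBINT x. \<phi> x *\<^sub>R (G x $ i))"
      using uG \<phi> by (simp add: has_weak_gradient_def)
    also have "Re \<dots> = - (LBINT x. Re (\<phi> x *\<^sub>R (G x $ i)))"
      by (simp only: uminus_complex.simps integral_bounded_linear[OF bounded_linear_Re integrable_test_mult(1)[OF Gil \<phi>]])
    also have "\<dots> = - (LBINT x. \<phi> x * g i x)" by (simp add: g_def)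
    finally show "(LBINT x. partial_deriv i \<phi> x * w x) = - (LBINT x. \<phi> x * g i x)" .
  qed
  then have "real_sobolev w g" using wL2 gL2 by (simp add: real_sobolev_def)
  moreover have "(LBINT x. (\<Sum>i\<in>UNIV. (g i x)\<^sup>2)) \<le> (L2_norm (weak_gradient u))\<^sup>2"
    unfolding L2_norm_weak_gradient[OF uG]
    using gL2 Gi gG by (intro integral_mono Bochner_Integration.integrable_sum) (auto simp: L2_real_iff)
  moreover have "\<forall>x. w x > 0" by (simp add: w_def)
  ultimately show ?thesis using wu by blast
qed

lemma real_sobolev_H1:
  assumes wg: "real_sobolev w g"
  shows "(\<lambda>x. complex_of_real (w x)) \<in> H1"
    and "(L2_norm (weak_gradient (\<lambda>x. complex_of_real (w x))))\<^sup>2 = (LBINT x. (\<Sum>i\<in>UNIV. (g i x)\<^sup>2))"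
proof -
  let ?u = "\<lambda>x. complex_of_real (w x)"
  define G :: "real^3 \<Rightarrow> complex^3" where "G x = (\<chi> i. complex_of_real (g i x))" for x
  have wL2: "w \<in> L2" and gL2: "g i \<in> L2" and wp: "weak_partial i w (g i)" for i
    using wg by (auto simp: real_sobolev_def)
  have [measurable]: "w \<in> borel_measurable borel" "g i \<in> borel_measurable borel" for i
    using wL2 gL2 by (auto simp: L2_def)
  have normG: "(norm (G x))\<^sup>2 = (\<Sum>i\<in>UNIV. (g i x)\<^sup>2)" for x
    by (simp add: norm_complex_vec_power2 G_def)
  have Gm[measurable]: "G \<in> borel_measurable borel"
  proof (rule borel_measurable_euclidean_space[THEN iffD2], intro ballI)
    fix b :: "complex^3" assume "b \<in> Basis"
    then obtain i c where b: "b = axis i c" by (auto simp: Basis_vec_def)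
    have "(\<lambda>x. G x \<bullet> b) = (\<lambda>x. complex_of_real (g i x) \<bullet> c)" by (simp add: b inner_axis G_def)
    then show "(\<lambda>x. G x \<bullet> b) \<in> borel_measurable borel" by simp
  qed
  have uL2: "?u \<in> L2" using wL2 by (auto simp: L2_def)
  have GL2: "G \<in> L2"
  proof -
    have "integrable lborel (\<lambda>x. \<Sum>i\<in>UNIV. (g i x)\<^sup>2)"
      using gL2 by (intro Bochner_Integration.integrable_sum) (simp add: L2_real_iff)
    then show ?thesis by (simp add: L2_def normG)
  qed
  have uG: "has_weak_gradient ?u G"
    unfolding has_weak_gradient_def
  proof (intro conjI allI impI)
    show "locally_integrable ?u" by (rule L2_locally_integrable[OF uL2])
    show "locally_integrable G" by (rule L2_locally_integrable[OF GL2])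
    fix \<phi> i assume \<phi>: "test_function \<phi>"
    have "(LBINT x. partial_deriv i \<phi> x *\<^sub>R ?u x) = (LBINT x. complex_of_real (partial_deriv i \<phi> x * w x))"
      by (simp add: scaleR_conv_of_real)
    also have "\<dots> = complex_of_real (LBINT x. partial_deriv i \<phi> x * w x)"
      by (rule integral_complex_of_real)
    also have "\<dots> = complex_of_real (- (LBINT x. \<phi> x * g i x))"
      using wp[of i] \<phi> unfolding weak_partial_def by simp
    also have "\<dots> = - (LBINT x. complex_of_real (\<phi> x * g i x))"
      by (simp only: of_real_minus integral_complex_of_real)
    also have "\<dots> = - (LBINT x. \<phi> x *\<^sub>R (G x $ i))"
      by (simp add: scaleR_conv_of_real G_def)
    finally show "(LBINT x. partial_deriv i \<phi> x *\<^sub>R ?u x) = - (LBINT x. \<phi> x *\<^sub>R (G x $ i))" .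
  qed
  show "?u \<in> H1" using uL2 GL2 uG by (auto simp: H1_def)
  show "(L2_norm (weak_gradient ?u))\<^sup>2 = (LBINT x. (\<Sum>i\<in>UNIV. (g i x)\<^sup>2))"
    by (simp only: L2_norm_weak_gradient[OF uG] normG)
qed

text \<open>The Cauchy-Schwarz inequality for \<open>(w\<^sub>1, w\<^sub>2)\<close> and \<open>(g\<^sub>1, g\<^sub>2)\<close>, in Lagrange's form.\<close>

lemma quadratic_mean_gradient_pointwise:
  assumes "w1 x > 0"
  shows "(quadratic_mean_derivative w1 w2 g1 g2 x)\<^sup>2 \<le> ((g1 x)\<^sup>2 + (g2 x)\<^sup>2) / 2"
proof -
  let ?v = "quadratic_mean w1 w2 x"
  have v: "?v > 0" by (rule quadratic_mean_pos) (rule assms)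
  have "(w1 x * g1 x + w2 x * g2 x)\<^sup>2 + (w1 x * g2 x - w2 x * g1 x)\<^sup>2 = ((w1 x)\<^sup>2 + (w2 x)\<^sup>2) * ((g1 x)\<^sup>2 + (g2 x)\<^sup>2)"
    by (simp add: algebra_simps power2_eq_square)
  then have "(w1 x * g1 x + w2 x * g2 x)\<^sup>2 \<le> ((w1 x)\<^sup>2 + (w2 x)\<^sup>2) * ((g1 x)\<^sup>2 + (g2 x)\<^sup>2)"
    using zero_le_power2[of "w1 x * g2 x - w2 x * g1 x"] by linarith
  also have "(w1 x)\<^sup>2 + (w2 x)\<^sup>2 = 2 * ?v\<^sup>2" by (simp add: quadratic_mean_power2)
  finally show ?thesis
    unfolding quadratic_mean_derivative_def power_divide power_mult_distrib using v
    by (subst pos_divide_le_eq) (auto simp: algebra_simps)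
qed

lemma real_sobolev_quadratic_mean:
  assumes wg1: "real_sobolev w1 g1" and wg2: "real_sobolev w2 g2" and pos: "\<And>x. w1 x > 0" "\<And>x. w2 x > 0"
  defines "q \<equiv> \<lambda>i. quadratic_mean_derivative w1 w2 (g1 i) (g2 i)"
  shows "real_sobolev (quadratic_mean w1 w2) q"
    and "(LBINT x. (\<Sum>i\<in>UNIV. (q i x)\<^sup>2))
      \<le> ((LBINT x. (\<Sum>i\<in>UNIV. (g1 i x)\<^sup>2)) + (LBINT x. (\<Sum>i\<in>UNIV. (g2 i x)\<^sup>2))) / 2"
proof -
  have w1: "w1 \<in> L2" and g1: "g1 i \<in> L2" and p1: "weak_partial i w1 (g1 i)"
    and w2: "w2 \<in> L2" and g2: "g2 i \<in> L2" and p2: "weak_partial i w2 (g2 i)" for i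
    using wg1 wg2 by (auto simp: real_sobolev_def)
  have [measurable]: "w1 \<in> borel_measurable borel" "w2 \<in> borel_measurable borel"
    "g1 i \<in> borel_measurable borel" "g2 i \<in> borel_measurable borel" for i
    using w1 w2 g1 g2 by (auto simp: L2_def)
  have gi: "integrable lborel (\<lambda>x. (g1 i x)\<^sup>2)" "integrable lborel (\<lambda>x. (g2 i x)\<^sup>2)" for i
    using g1 g2 by (auto simp: L2_real_iff)
  have qle: "(q i x)\<^sup>2 \<le> ((g1 i x)\<^sup>2 + (g2 i x)\<^sup>2) / 2" for i x
    unfolding q_def by (rule quadratic_mean_gradient_pointwise) (rule pos)
  have qm[measurable]: "q i \<in> borel_measurable borel" for i
    unfolding q_def quadratic_mean_derivative_def[abs_def] by measurable
  have qi: "integrable lborel (\<lambda>x. (q i x)\<^sup>2)" for i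
  proof (rule Bochner_Integration.integrable_bound)
    show "integrable lborel (\<lambda>x. ((g1 i x)\<^sup>2 + (g2 i x)\<^sup>2) / 2)" using gi by simp
    show "AE x in lborel. norm ((q i x)\<^sup>2) \<le> norm (((g1 i x)\<^sup>2 + (g2 i x)\<^sup>2) / 2)"
      using qle by (intro AE_I2) simp
  qed measurable
  show "real_sobolev (quadratic_mean w1 w2) q"
    unfolding real_sobolev_def
  proof (intro conjI allI)
    show "quadratic_mean w1 w2 \<in> L2" by (rule quadratic_mean_L2[OF w1 w2])
    show "q i \<in> L2" for i using qi by (simp add: L2_real_iff)
    show "weak_partial i (quadratic_mean w1 w2) (q i)" for i
      unfolding q_def by (rule quadratic_mean_weak_partial[OF w1 w2 g1 g2 p1 p2 pos])
  qed
  have "(LBINT x. (\<Sum>i\<in>UNIV. (q i x)\<^sup>2)) \<le> (LBINT x. (\<Sum>i\<in>UNIV. ((g1 i x)\<^sup>2 + (g2 i x)\<^sup>2) / 2))"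
    by (intro integral_mono Bochner_Integration.integrable_sum sum_mono qle qi
        integrable_divide_zero Bochner_Integration.integrable_add gi)
  also have "\<dots> = (LBINT x. ((\<Sum>i\<in>UNIV. (g1 i x)\<^sup>2) + (\<Sum>i\<in>UNIV. (g2 i x)\<^sup>2)) / 2)"
    by (simp only: sum_divide_distrib[symmetric] sum.distrib)
  also have "\<dots> = ((LBINT x. (\<Sum>i\<in>UNIV. (g1 i x)\<^sup>2)) + (LBINT x. (\<Sum>i\<in>UNIV. (g2 i x)\<^sup>2))) / 2"
    using gi by (simp add: Bochner_Integration.integrable_sum)
  finally show "(LBINT x. (\<Sum>i\<in>UNIV. (q i x)\<^sup>2))
      \<le> ((LBINT x. (\<Sum>i\<in>UNIV. (g1 i x)\<^sup>2)) + (LBINT x. (\<Sum>i\<in>UNIV. (g2 i x)\<^sup>2))) / 2" .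
qed

lemma real_sobolev_potential_integrable:
  assumes wg: "real_sobolev w g"
  shows "integrable lborel (\<lambda>x. (w x)\<^sup>2 / norm x)"
proof -
  have [measurable]: "w \<in> borel_measurable borel" using wg by (auto simp: real_sobolev_def L2_def)
  have "(\<integral>\<^sup>+x. ennreal ((w x)\<^sup>2 / norm (x - 0)) \<partial>lborel) < \<infinity>"
    by (rule le_less_trans[OF hardy_bound[of w g 0]]) (use wg in \<open>auto simp: real_sobolev_def\<close>)
  then show ?thesis by (intro integrableI_bounded) auto
qed

lemma real_sobolev_coulomb_integrable:
  assumes wg1: "real_sobolev w1 g1" and wg2: "real_sobolev w2 g2"
  shows "integrable (lborel \<Otimes>\<^sub>M lborel) (\<lambda>(x, y). (w1 x)\<^sup>2 * (w2 y)\<^sup>2 / norm (x - y))"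
proof (rule integrableI_bounded)
  have [measurable]: "w1 \<in> borel_measurable borel" "w2 \<in> borel_measurable borel"
    using wg1 wg2 by (auto simp: real_sobolev_def L2_def)
  show "(\<lambda>(x, y). (w1 x)\<^sup>2 * (w2 y)\<^sup>2 / norm (x - y)) \<in> borel_measurable (lborel \<Otimes>\<^sub>M lborel)"
    by measurable
  define C where "C = (\<Sum>i\<in>UNIV. (LBINT x. (w2 x)\<^sup>2) + (LBINT x. (g2 i x)\<^sup>2)) / 2"
  have pot: "(\<integral>\<^sup>+y. ennreal ((w2 y)\<^sup>2 / norm (y - x)) \<partial>lborel) \<le> ennreal C" for x
    unfolding C_def by (rule hardy_bound) (use wg2 in \<open>auto simp: real_sobolev_def\<close>)
  have "(\<integral>\<^sup>+q. ennreal (norm (case q of (x, y) \<Rightarrow> (w1 x)\<^sup>2 * (w2 y)\<^sup>2 / norm (x - y))) \<partial>(lborel \<Otimes>\<^sub>M lborel))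
    = (\<integral>\<^sup>+x. \<integral>\<^sup>+y. ennreal (norm ((w1 x)\<^sup>2 * (w2 y)\<^sup>2 / norm (x - y))) \<partial>lborel \<partial>lborel)"
    by (subst lborel.nn_integral_fst[symmetric]) auto
  also have "\<dots> = (\<integral>\<^sup>+x. \<integral>\<^sup>+y. ennreal ((w1 x)\<^sup>2) * ennreal ((w2 y)\<^sup>2 / norm (y - x)) \<partial>lborel \<partial>lborel)"
    by (intro nn_integral_cong) (simp add: ennreal_mult[symmetric] norm_minus_commute)
  also have "\<dots> = (\<integral>\<^sup>+x. ennreal ((w1 x)\<^sup>2) * (\<integral>\<^sup>+y. ennreal ((w2 y)\<^sup>2 / norm (y - x)) \<partial>lborel) \<partial>lborel)"
    by (intro nn_integral_cong nn_integral_cmult) measurable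
  also have "\<dots> \<le> (\<integral>\<^sup>+x. ennreal ((w1 x)\<^sup>2) * ennreal C \<partial>lborel)"
    by (intro nn_integral_mono mult_left_mono pot) simp
  also have "\<dots> = (\<integral>\<^sup>+x. ennreal ((w1 x)\<^sup>2) \<partial>lborel) * ennreal C"
    by (rule nn_integral_multc) measurable
  also have "(\<integral>\<^sup>+x. ennreal ((w1 x)\<^sup>2) \<partial>lborel) = ennreal (LBINT x. (w1 x)\<^sup>2)"
    using wg1 by (intro nn_integral_eq_integral) (auto simp: real_sobolev_def L2_real_iff)
  also have "\<dots> * ennreal C < \<infinity>" by (simp add: ennreal_mult_less_top)
  finally show "(\<integral>\<^sup>+q. ennreal (norm (case q of (x, y) \<Rightarrow> (w1 x)\<^sup>2 * (w2 y)\<^sup>2 / norm (x - y))) \<partial>(lborel \<Otimes>\<^sub>M lborel)) < \<infinity>" .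
qed

lemma coulomb_eq_pair_integral:
  assumes "integrable (lborel \<Otimes>\<^sub>M lborel) (\<lambda>(x, y). f x * f y / norm (x - y))"
  shows "coulomb f = (\<integral>(x, y). f x * f y / norm (x - y) \<partial>(lborel \<Otimes>\<^sub>M lborel))"
  unfolding coulomb_def using lborel_pair.integral_fst'[OF assms] by simp

text \<open>
  The parallelogram identity for the quadratic form \<open>A\<close>. It holds because all mixed terms are
  integrable over the product space, by the bounded potentials from Hardy's inequality.
\<close>

lemma coulomb_parallelogram:
  assumes wg1: "real_sobolev w1 g1" and wg2: "real_sobolev w2 g2"
  shows "integrable (lborel \<Otimes>\<^sub>M lborel)
      (\<lambda>(x, y). ((w1 x)\<^sup>2 - (w2 x)\<^sup>2) * ((w1 y)\<^sup>2 - (w2 y)\<^sup>2) / norm (x - y))"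
    and "coulomb (\<lambda>x. (quadratic_mean w1 w2 x)\<^sup>2)
      = coulomb (\<lambda>x. (w1 x)\<^sup>2) / 2 + coulomb (\<lambda>x. (w2 x)\<^sup>2) / 2 - coulomb (\<lambda>x. (w1 x)\<^sup>2 - (w2 x)\<^sup>2) / 4"
proof -
  let ?P = "\<lambda>u v q. (u (fst q))\<^sup>2 * (v (snd q))\<^sup>2 / norm (fst q - snd q :: real^3) :: real"
  let ?M = "lborel \<Otimes>\<^sub>M lborel :: ((real^3) \<times> (real^3)) measure"
  have i: "integrable ?M (?P w1 w1)" "integrable ?M (?P w1 w2)" "integrable ?M (?P w2 w1)" "integrable ?M (?P w2 w2)"
    using real_sobolev_coulomb_integrable[OF wg1 wg1] real_sobolev_coulomb_integrable[OF wg1 wg2]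
      real_sobolev_coulomb_integrable[OF wg2 wg1] real_sobolev_coulomb_integrable[OF wg2 wg2]
    by (simp_all add: case_prod_beta')
  have d_eq: "(\<lambda>(x, y). ((w1 x)\<^sup>2 - (w2 x)\<^sup>2) * ((w1 y)\<^sup>2 - (w2 y)\<^sup>2) / norm (x - y))
      = (\<lambda>q. (?P w1 w1 q - ?P w1 w2 q) - (?P w2 w1 q - ?P w2 w2 q))"
    by (auto simp: fun_eq_iff left_diff_distrib right_diff_distrib diff_divide_distrib)
  have m_eq: "(\<lambda>(x, y). (quadratic_mean w1 w2 x)\<^sup>2 * (quadratic_mean w1 w2 y)\<^sup>2 / norm (x - y))
      = (\<lambda>q. ((?P w1 w1 q + ?P w1 w2 q) + (?P w2 w1 q + ?P w2 w2 q)) / 4)"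
    by (auto simp: fun_eq_iff quadratic_mean_power2 distrib_right distrib_left add_divide_distrib)
  show d: "integrable ?M (\<lambda>(x, y). ((w1 x)\<^sup>2 - (w2 x)\<^sup>2) * ((w1 y)\<^sup>2 - (w2 y)\<^sup>2) / norm (x - y))"
    unfolding d_eq using i by (intro Bochner_Integration.integrable_diff)
  have m: "integrable ?M (\<lambda>(x, y). (quadratic_mean w1 w2 x)\<^sup>2 * (quadratic_mean w1 w2 y)\<^sup>2 / norm (x - y))"
    unfolding m_eq using i by (intro integrable_divide_zero Bochner_Integration.integrable_add)
  have c1: "coulomb (\<lambda>x. (w1 x)\<^sup>2) = integral\<^sup>L ?M (?P w1 w1)"
    using coulomb_eq_pair_integral[of "\<lambda>x. (w1 x)\<^sup>2"] i(1) by (simp add: case_prod_beta')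
  have c2: "coulomb (\<lambda>x. (w2 x)\<^sup>2) = integral\<^sup>L ?M (?P w2 w2)"
    using coulomb_eq_pair_integral[of "\<lambda>x. (w2 x)\<^sup>2"] i(4) by (simp add: case_prod_beta')
  have cd: "coulomb (\<lambda>x. (w1 x)\<^sup>2 - (w2 x)\<^sup>2)
      = (integral\<^sup>L ?M (?P w1 w1) - integral\<^sup>L ?M (?P w1 w2)) - (integral\<^sup>L ?M (?P w2 w1) - integral\<^sup>L ?M (?P w2 w2))"
    unfolding coulomb_eq_pair_integral[OF d] d_eq using i by simp
  have cm: "coulomb (\<lambda>x. (quadratic_mean w1 w2 x)\<^sup>2)
      = ((integral\<^sup>L ?M (?P w1 w1) + integral\<^sup>L ?M (?P w1 w2)) + (integral\<^sup>L ?M (?P w2 w1) + integral\<^sup>L ?M (?P w2 w2))) / 4"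
    unfolding coulomb_eq_pair_integral[OF m] m_eq using i by simp
  show "coulomb (\<lambda>x. (quadratic_mean w1 w2 x)\<^sup>2)
      = coulomb (\<lambda>x. (w1 x)\<^sup>2) / 2 + coulomb (\<lambda>x. (w2 x)\<^sup>2) / 2 - coulomb (\<lambda>x. (w1 x)\<^sup>2 - (w2 x)\<^sup>2) / 4"
    unfolding c1 c2 cd cm by (simp add: field_simps)
qed

lemma coulomb_cong_AE:
  assumes [measurable]: "f \<in> borel_measurable borel" "g \<in> borel_measurable borel"
    and fg: "AE x in lborel. f x = g x"
  shows "coulomb f = coulomb g"
proof -
  have inner: "(LBINT y. f x * f y / norm (x - y)) = (LBINT y. f x * g y / norm (x - y))" for x
    using fg by (intro integral_cong_AE) (auto elim: eventually_mono)
  have "(LBINT x. LBINT y. f x * g y / norm (x - y)) = (LBINT x. LBINT y. g x * g y / norm (x - y))"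
  proof (rule integral_cong_AE)
    show "(\<lambda>x. LBINT y. f x * g y / norm (x - y)) \<in> borel_measurable lborel"
      "(\<lambda>x. LBINT y. g x * g y / norm (x - y)) \<in> borel_measurable lborel"
      by (intro lborel.borel_measurable_lebesgue_integral; measurable)+
    show "AE x in lborel. (LBINT y. f x * g y / norm (x - y)) = (LBINT y. g x * g y / norm (x - y))"
      using fg by eventually_elim simp
  qed
  then show ?thesis by (simp add: coulomb_def inner)
qed

lemma action_of_real_representative:
  assumes u: "u \<in> H1" and wg: "real_sobolev w g" and uw: "AE x in lborel. u x = complex_of_real (w x)"
  shows "action \<omega> u = 1/2 * (L2_norm (weak_gradient u))\<^sup>2 + 1/4 * coulomb (\<lambda>x. (w x)\<^sup>2)
    - 1/2 * (LBINT x. (w x)\<^sup>2 / norm x) + \<omega>/2 * (LBINT x. (w x)\<^sup>2)"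
proof -
  have [measurable]: "u \<in> borel_measurable borel" "w \<in> borel_measurable borel"
    using u wg by (auto simp: H1_def L2_def real_sobolev_def)
  have sq: "AE x in lborel. (norm (u x))\<^sup>2 = (w x)\<^sup>2" using uw by eventually_elim simp
  have "coulomb (\<lambda>x. (norm (u x))\<^sup>2) = coulomb (\<lambda>x. (w x)\<^sup>2)"
    by (rule coulomb_cong_AE[OF _ _ sq]) auto
  moreover have "(LBINT x. (norm (u x))\<^sup>2 / norm x) = (LBINT x. (w x)\<^sup>2 / norm x)"
    using sq by (intro integral_cong_AE) (auto elim: eventually_mono)
  moreover have "(L2_norm u)\<^sup>2 = (LBINT x. (w x)\<^sup>2)"
  proof -
    have "(LBINT x. (norm (u x))\<^sup>2) = (LBINT x. (w x)\<^sup>2)"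
      using sq by (intro integral_cong_AE) auto
    moreover have "0 \<le> (LBINT x. (w x)\<^sup>2)" by (intro integral_nonneg_AE) simp
    ultimately show ?thesis by (simp add: L2_norm_def)
  qed
  ultimately show ?thesis by (simp add: action_def)
qed

theorem action_quadratic_mean_le:
  assumes u1: "u1 \<in> H1" "real_sobolev w1 g1" "AE x in lborel. u1 x = complex_of_real (w1 x)"
      "(LBINT x. (\<Sum>i\<in>UNIV. (g1 i x)\<^sup>2)) \<le> (L2_norm (weak_gradient u1))\<^sup>2"
    and u2: "u2 \<in> H1" "real_sobolev w2 g2" "AE x in lborel. u2 x = complex_of_real (w2 x)"
      "(LBINT x. (\<Sum>i\<in>UNIV. (g2 i x)\<^sup>2)) \<le> (L2_norm (weak_gradient u2))\<^sup>2"
    and pos: "\<And>x. w1 x > 0" "\<And>x. w2 x > 0"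
  shows "action \<omega> (\<lambda>x. complex_of_real (quadratic_mean w1 w2 x))
    \<le> (action \<omega> u1 + action \<omega> u2) / 2 - coulomb (\<lambda>x. (w1 x)\<^sup>2 - (w2 x)\<^sup>2) / 16"
proof -
  let ?v = "quadratic_mean w1 w2"
  note q = real_sobolev_quadratic_mean[OF u1(2) u2(2) pos]
  have i: "integrable lborel (\<lambda>x. (w1 x)\<^sup>2)" "integrable lborel (\<lambda>x. (w2 x)\<^sup>2)"
    using u1(2) u2(2) by (auto simp: real_sobolev_def L2_real_iff)
  have mass: "(LBINT x. (?v x)\<^sup>2) = ((LBINT x. (w1 x)\<^sup>2) + (LBINT x. (w2 x)\<^sup>2)) / 2"
    unfolding quadratic_mean_power2 using i by simp
  have "(LBINT x. (?v x)\<^sup>2 / norm x) = (LBINT x. ((w1 x)\<^sup>2 / norm x + (w2 x)\<^sup>2 / norm x) / 2)"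
    unfolding quadratic_mean_power2 by (simp add: add_divide_distrib mult.commute)
  also have "\<dots> = ((LBINT x. (w1 x)\<^sup>2 / norm x) + (LBINT x. (w2 x)\<^sup>2 / norm x)) / 2"
    using real_sobolev_potential_integrable[OF u1(2)] real_sobolev_potential_integrable[OF u2(2)] by simp
  finally have pot: "(LBINT x. (?v x)\<^sup>2 / norm x)
    = ((LBINT x. (w1 x)\<^sup>2 / norm x) + (LBINT x. (w2 x)\<^sup>2 / norm x)) / 2" .
  have kin: "(L2_norm (weak_gradient (\<lambda>x. complex_of_real (?v x))))\<^sup>2
    \<le> ((L2_norm (weak_gradient u1))\<^sup>2 + (L2_norm (weak_gradient u2))\<^sup>2) / 2"
    unfolding real_sobolev_H1(2)[OF q(1)]
    by (rule order_trans[OF q(2)]) (intro divide_right_mono add_mono u1(4) u2(4), simp)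
  have av: "action \<omega> (\<lambda>x. complex_of_real (?v x)) = 1/2 * (L2_norm (weak_gradient (\<lambda>x. complex_of_real (?v x))))\<^sup>2
    + 1/4 * coulomb (\<lambda>x. (?v x)\<^sup>2) - 1/2 * (LBINT x. (?v x)\<^sup>2 / norm x) + \<omega>/2 * (LBINT x. (?v x)\<^sup>2)"
    by (rule action_of_real_representative[OF real_sobolev_H1(1)[OF q(1)] q(1)]) simp
  show ?thesis
    unfolding av mass pot coulomb_parallelogram(2)[OF u1(2) u2(2)]
      action_of_real_representative[OF u1(1-3)] action_of_real_representative[OF u2(1-3)]
    using kin by (simp add: field_simps)
qed

theorem theorem4:
  fixes \<omega> :: real and u1 u2 :: "real^3 \<Rightarrow> complex"
  assumes "1/16 < \<omega>" and "\<omega> < 1/4"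
    and "is_arg_min (action \<omega>) (\<lambda>\<psi>. \<psi> \<in> H1) u1" and "positive_ae u1"
    and "is_arg_min (action \<omega>) (\<lambda>\<psi>. \<psi> \<in> H1) u2" and "positive_ae u2"
  shows "AE x in lborel. u1 x = u2 x"
proof -
  have u1: "u1 \<in> H1" and min1: "\<And>\<psi>. \<psi> \<in> H1 \<Longrightarrow> action \<omega> u1 \<le> action \<omega> \<psi>"
    and u2: "u2 \<in> H1" and min2: "\<And>\<psi>. \<psi> \<in> H1 \<Longrightarrow> action \<omega> u2 \<le> action \<omega> \<psi>"
    using assms(3,5) by (auto simp: is_arg_min_linorder)
  obtain w1 g1 where 1: "real_sobolev w1 g1" "\<forall>x. w1 x > 0" "AE x in lborel. u1 x = complex_of_real (w1 x)"
    "(LBINT x. (\<Sum>i\<in>UNIV. (g1 i x)\<^sup>2)) \<le> (L2_norm (weak_gradient u1))\<^sup>2"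
    using positive_H1_real_sobolev[OF u1 assms(4)] by blast
  obtain w2 g2 where 2: "real_sobolev w2 g2" "\<forall>x. w2 x > 0" "AE x in lborel. u2 x = complex_of_real (w2 x)"
    "(LBINT x. (\<Sum>i\<in>UNIV. (g2 i x)\<^sup>2)) \<le> (L2_norm (weak_gradient u2))\<^sup>2"
    using positive_H1_real_sobolev[OF u2 assms(6)] by blast
  let ?f = "\<lambda>x. (w1 x)\<^sup>2 - (w2 x)\<^sup>2"
  have pos: "\<And>x. w1 x > 0" "\<And>x. w2 x > 0" using 1(2) 2(2) by auto
  let ?v = "\<lambda>x. complex_of_real (quadratic_mean w1 w2 x)"
  have v: "?v \<in> H1" by (rule real_sobolev_H1(1)[OF real_sobolev_quadratic_mean(1)[OF 1(1) 2(1) pos]])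
  have arith: "c \<le> 0" if "b \<le> (a1 + a2) / 2 - c / 16" "a1 \<le> b" "a2 \<le> b" for a1 a2 b c :: real
    using that by (simp add: field_simps)
  have "coulomb ?f \<le> 0"
    by (rule arith[OF action_quadratic_mean_le[OF u1 1(1,3,4) u2 2(1,3,4) pos, of \<omega>] min1[OF v] min2[OF v]])
  moreover have "integrable lborel ?f"
    using 1(1) 2(1) by (auto simp: real_sobolev_def L2_real_iff)
  ultimately have "AE x in lborel. ?f x = 0"
    using coulomb_parallelogram(1)[OF 1(1) 2(1)] by (intro coulomb_positive_definite)
  with 1(3) 2(3) show ?thesis
  proof eventually_elim
    case (elim x)
    then have "w1 x = w2 x"
      using pos[of x] by (simp add: power2_eq_iff)
    with elim show ?case by simp
  qed
qed

end
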